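(* Let $N$ be a normal subgroup of a finite group $G$. Suppose that for each prime number $p$ dividing $|N|$, the pair $(b_0(p),B_0(p))$ of principal $p$-blocks is a pair of Frobenius corresponding blocks. Then there exists a subgroup $H\le G$ such that $G=NH$ and $N\cap H=1$.
   Context: For a prime $p$, $b_0(p)$ and $B_0(p)$ denote the principal $p$-blocks of $N$ and of $G$ respectively (the blocks containing the trivial character). $\mathrm{Irr}(b)$ is the set of ordinary irreducible characters in $b$. Definition: for $N\unlhd G$, a $p$-block $b$ of $N$ and a $p$-block $B$ of $G$ with $b$ covered by $B$, $(b,B)$ is a pair of Frobenius corresponding blocks if for every nontrivial $\chi\in\mathrm{Irr}(b)$ the induced character $\chi^G$ is irreducible. *)

theory Defs
  imports
    "HOL-Algebra.Coset"
    "HOL-Algebra.Ideal"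
    "HOL-Computational_Algebra.Polynomial"
    "HOL-Computational_Algebra.Primes"
    "Jordan_Normal_Form.VS_Connect"
begin

section \<open>Ordinary characters of finite groups\<close>

abbreviation GL :: "nat \<Rightarrow> complex mat monoid" where
  "GL n \<equiv> units_of (ring_mat TYPE(complex) n ())"

definition irreducible_rep ::
    "('a, 'b) monoid_scheme \<Rightarrow> nat \<Rightarrow> ('a \<Rightarrow> complex mat) \<Rightarrow> bool" where
  "irreducible_rep G n \<rho> \<longleftrightarrow> \<rho> \<in> hom G (GL n) \<and> n > 0 \<and>
     (\<forall>W. subspace (class_ring :: complex ring) W (module_vec TYPE(complex) n) \<longrightarrow>
          (\<forall>g\<in>carrier G. \<forall>w\<in>W. \<rho> g *\<^sub>v w \<in> W) \<longrightarrow>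
          W = {0\<^sub>v n} \<or> W = carrier_vec n)"

text \<open>
  Characters are functions on the whole type which vanish outside the carrier. In this way
  equality of functions is equality of characters, and a character of a subgroup is at the same
  time its own extension by zero to the ambient group.
\<close>

definition character_of ::
    "('a, 'b) monoid_scheme \<Rightarrow> nat \<Rightarrow> ('a \<Rightarrow> complex mat) \<Rightarrow> 'a \<Rightarrow> complex" where
  "character_of G n \<rho> = (\<lambda>g. if g \<in> carrier G then (\<Sum>i<n. \<rho> g $$ (i, i)) else 0)"

definition Irr :: "('a, 'b) monoid_scheme \<Rightarrow> ('a \<Rightarrow> complex) set" where
  "Irr G = {character_of G n \<rho> | n \<rho>. irreducible_rep G n \<rho>}"

definition trivial_char :: "('a, 'b) monoid_scheme \<Rightarrow> 'a \<Rightarrow> complex" where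
  "trivial_char G = (\<lambda>g. if g \<in> carrier G then 1 else 0)"

definition char_inner ::
    "('a, 'b) monoid_scheme \<Rightarrow> ('a \<Rightarrow> complex) \<Rightarrow> ('a \<Rightarrow> complex) \<Rightarrow> complex" where
  "char_inner G \<chi> \<psi> = (\<Sum>g\<in>carrier G. \<chi> g * cnj (\<psi> g)) / of_nat (card (carrier G))"

definition induced_char ::
    "('a, 'b) monoid_scheme \<Rightarrow> 'a set \<Rightarrow> ('a \<Rightarrow> complex) \<Rightarrow> 'a \<Rightarrow> complex" where
  "induced_char G H \<chi> = (\<lambda>g. if g \<in> carrier G then
     (\<Sum>x\<in>carrier G.
        let y = x \<otimes>\<^bsub>G\<^esub> g \<otimes>\<^bsub>G\<^esub> inv\<^bsub>G\<^esub> x in if y \<in> H then \<chi> y else 0) / of_nat (card H)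
     else 0)"


section \<open>Blocks\<close>

definition algebraic_int_ring :: "complex ring" where
  "algebraic_int_ring = class_ring\<lparr>carrier := {z. algebraic_int z}\<rparr>"

text \<open>
  Blocks are defined, as usual, relative to a maximal ideal \<open>M\<close> of the ring of algebraic integers
  that contains \<open>p\<close>. The partition into blocks does not depend on the choice of \<open>M\<close>.
\<close>

definition maximal_ideal_over :: "nat \<Rightarrow> complex set \<Rightarrow> bool" where
  "maximal_ideal_over p M \<longleftrightarrow> maximalideal M algebraic_int_ring \<and> of_nat p \<in> M"

definition conj_class :: "('a, 'b) monoid_scheme \<Rightarrow> 'a \<Rightarrow> 'a set" where
  "conj_class G g = {x \<otimes>\<^bsub>G\<^esub> g \<otimes>\<^bsub>G\<^esub> inv\<^bsub>G\<^esub> x | x. x \<in> carrier G}"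

text \<open>
  The value of the central character \<open>\<omega>\<^sub>\<chi> : Z(\<complex>G) \<rightarrow> \<complex>\<close> on the sum of the
  conjugacy class of \<open>g\<close>; it is an algebraic integer.
\<close>

definition central_char ::
    "('a, 'b) monoid_scheme \<Rightarrow> ('a \<Rightarrow> complex) \<Rightarrow> 'a \<Rightarrow> complex" where
  "central_char G \<chi> g = of_nat (card (conj_class G g)) * \<chi> g / \<chi> \<one>\<^bsub>G\<^esub>"

text \<open>
  Two irreducible characters lie in the same block iff the reductions of their central
  characters modulo \<open>M\<close> coincide.
\<close>

definition block_rel ::
    "('a, 'b) monoid_scheme \<Rightarrow> complex set \<Rightarrow> (('a \<Rightarrow> complex) \<times> ('a \<Rightarrow> complex)) set" where
  "block_rel G M = {(\<chi>, \<psi>). \<chi> \<in> Irr G \<and> \<psi> \<in> Irr G \<and>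
     (\<forall>g\<in>carrier G. central_char G \<chi> g - central_char G \<psi> g \<in> M)}"

text \<open>
  A block is identified with the (nonempty) set \<open>Irr(B)\<close> of ordinary irreducible characters in it,
  which determines it; Brauer characters are not recorded.
\<close>

definition blocks :: "('a, 'b) monoid_scheme \<Rightarrow> complex set \<Rightarrow> ('a \<Rightarrow> complex) set set" where
  "blocks G M = Irr G // block_rel G M"

definition principal_block ::
    "('a, 'b) monoid_scheme \<Rightarrow> complex set \<Rightarrow> ('a \<Rightarrow> complex) set" where
  "principal_block G M = block_rel G M `` {trivial_char G}"

text \<open>
  \<open>b\<close> is covered by \<open>B\<close>: the restriction to \<open>N\<close> of some character in \<open>B\<close> has an irreducible
  constituent in \<open>b\<close>. The inner product over \<open>N\<close> only sees the restriction.
\<close>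

definition covered_by ::
    "('a, 'b) monoid_scheme \<Rightarrow> 'a set \<Rightarrow> ('a \<Rightarrow> complex) set \<Rightarrow> ('a \<Rightarrow> complex) set \<Rightarrow> bool" where
  "covered_by G N b B \<longleftrightarrow> (\<exists>\<chi>\<in>B. \<exists>\<theta>\<in>b. char_inner (G\<lparr>carrier := N\<rparr>) \<chi> \<theta> \<noteq> 0)"

definition frobenius_corresponding_blocks ::
    "('a, 'b) monoid_scheme \<Rightarrow> 'a set \<Rightarrow> complex set \<Rightarrow>
       ('a \<Rightarrow> complex) set \<Rightarrow> ('a \<Rightarrow> complex) set \<Rightarrow> bool" where
  "frobenius_corresponding_blocks G N M b B \<longleftrightarrow>
     b \<in> blocks (G\<lparr>carrier := N\<rparr>) M \<and> B \<in> blocks G M \<and> covered_by G N b B \<and>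
     (\<forall>\<chi>\<in>b. \<chi> \<noteq> trivial_char (G\<lparr>carrier := N\<rparr>) \<longrightarrow> induced_char G N \<chi> \<in> Irr G)"

end

theory Submission
  imports Defs "Jordan_Normal_Form.Char_Poly" "HOL-Algebra.Sylow" "HOL-Algebra.Zassenhaus"
    "HOL-Algebra.Generated_Groups" "HOL-Algebra.Multiplicative_Group"
begin

text \<open>
  Let \<open>p\<close> be a prime divisor of \<open>|N|\<close>. The block hypothesis at \<open>p\<close> forces \<open>p\<close> not to divide \<open>|G : N|\<close>.
  Suppose that it does, so that a Sylow \<open>p\<close>-subgroup \<open>P\<close> of \<open>G\<close> is not contained in \<open>N\<close>, and let
  \<open>P\<close> act by conjugation on the nontrivial characters in the principal block of \<open>N\<close>. For each such
  \<open>\<chi>\<close> the squared norm of \<open>\<chi>\<^sup>G\<close> is \<open>|T : N|\<close>, where \<open>T\<close> is the stabilizer of \<open>\<chi>\<close>; as \<open>\<chi>\<^sup>G\<close> is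
  irreducible, \<open>T = N\<close> (\<open>inertia_of_irreducible_induced\<close>), and \<open>P\<close> has no fixed point. Hence \<open>p\<close>
  divides the number of nontrivial characters of any given degree in the block
  (\<open>prime_power_group_fixed_point\<close>), and the sum of the \<open>\<chi>(1)\<^sup>2\<close> over the whole block is
  congruent to \<open>1\<close> modulo \<open>p\<close>. On the other hand this sum is divisible by \<open>p\<close> whenever \<open>p\<close> divides
  the group order (\<open>principal_block_degree_squares\<close>), a contradiction. So \<open>|N|\<close> and \<open>|G : N|\<close> are
  coprime, and a complement exists by the theorem of Schur and Zassenhaus.

  The divisibility result replaces the usual theory of block idempotents by one product. A class
  function \<open>a\<close>, seen as a central element of the group algebra, acts on each irreducible character
  \<open>\<chi>\<close> by a scalar \<open>\<omega>\<^sub>\<chi>(a)\<close>, and \<open>\<omega>\<^sub>\<chi>\<close> turns convolution into multiplication. For \<open>\<psi>\<close> outside the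
  principal block there is an element \<open>g\<close> whose class sum, shifted by \<open>- \<omega>\<^sub>\<psi>(g)\<close>, is killed by \<open>\<psi>\<close>
  but not by the trivial character modulo \<open>M\<close>. The product \<open>a\<close> of these elements over all such \<open>\<psi>\<close>
  has algebraic integer coefficients, \<open>\<omega>\<^sub>\<psi>(a) = 0\<close> outside the block and
  \<open>\<omega>\<^sub>\<chi>(a) \<equiv> u \<notin> M\<close> inside. Column orthogonality gives
  \<open>\<Sum>\<^sub>\<chi> \<chi>(1)\<^sup>2 \<omega>\<^sub>\<chi>(a) = |G| a(1) \<in> M\<close>; the left side is \<open>u\<close> times the sum of squared degrees in the block,
  modulo \<open>M\<close>, and \<open>M\<close> is prime.

  The character theory that this needs (Schur's lemma, both orthogonality relations, integrality of
  central characters) is developed from matrix representations. The Schur--Zassenhaus theorem is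
  proved by taking a minimal supplement \<open>H\<close> of \<open>N\<close>: if \<open>N \<inter> H\<close> were nontrivial, the Frattini argument
  together with an averaging over cosets would produce a smaller supplement
  (\<open>proper_supplement\<close>). Minimality thus refers to subgroups of one group only; a quotient group
  occurs merely as the abelian group in which the averages are formed.
\<close>

section \<open>Sums and traces of matrices\<close>

definition mat_sum :: "nat \<Rightarrow> nat \<Rightarrow> ('c \<Rightarrow> complex mat) \<Rightarrow> 'c set \<Rightarrow> complex mat" where
  "mat_sum n m f S = mat n m (\<lambda>(i, j). \<Sum>g\<in>S. f g $$ (i, j))"

definition mat_trace :: "nat \<Rightarrow> complex mat \<Rightarrow> complex" where
  "mat_trace n A = (\<Sum>i<n. A $$ (i, i))"

lemma mat_sum_carrier [simp]: "mat_sum n m f S \<in> carrier_mat n m"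
  by (simp add: mat_sum_def)

lemma mat_sum_index [simp]:
  "i < n \<Longrightarrow> j < m \<Longrightarrow> mat_sum n m f S $$ (i, j) = (\<Sum>g\<in>S. f g $$ (i, j))"
  by (simp add: mat_sum_def)

lemma mat_mult_index:
  assumes "A \<in> carrier_mat n k" "B \<in> carrier_mat k m" "i < n" "j < m"
  shows "(A * B) $$ (i, j) = (\<Sum>l<k. A $$ (i, l) * B $$ (l, j))"
  using assms by (auto simp: scalar_prod_def atLeast0LessThan intro!: sum.cong)

lemma mat_vec_index:
  assumes "A \<in> carrier_mat n k" "v \<in> carrier_vec k" "i < n"
  shows "(A *\<^sub>v v) $ i = (\<Sum>l<k. A $$ (i, l) * v $ l)"
  using assms by (auto simp: scalar_prod_def atLeast0LessThan intro!: sum.cong)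

lemma mat_sum_cong: "(\<And>g. g \<in> S \<Longrightarrow> f g = f' g) \<Longrightarrow> mat_sum n m f S = mat_sum n m f' S"
  by (auto simp: mat_sum_def intro!: eq_matI sum.cong)

lemma mat_sum_reindex:
  assumes "bij_betw h S T"
  shows "mat_sum n m (\<lambda>g. f (h g)) S = mat_sum n m f T"
  by (rule eq_matI) (auto simp: mat_sum_def sum.reindex_bij_betw[OF assms, of "\<lambda>g. f g $$ _"])

lemma mat_mult_mat_sum:
  assumes "X \<in> carrier_mat k n" "\<And>g. g \<in> S \<Longrightarrow> f g \<in> carrier_mat n m"
  shows "X * mat_sum n m f S = mat_sum k m (\<lambda>g. X * f g) S"
proof (rule eq_matI)
  fix i j assume "i < dim_row (mat_sum k m (\<lambda>g. X * f g) S)" "j < dim_col (mat_sum k m (\<lambda>g. X * f g) S)"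
  then have ij: "i < k" "j < m" by (auto simp: mat_sum_def)
  have "(X * mat_sum n m f S) $$ (i, j) = (\<Sum>l<n. X $$ (i, l) * (\<Sum>g\<in>S. f g $$ (l, j)))"
    using ij by (subst mat_mult_index[OF assms(1) mat_sum_carrier]) auto
  also have "\<dots> = (\<Sum>g\<in>S. \<Sum>l<n. X $$ (i, l) * f g $$ (l, j))"
    by (simp add: sum_distrib_left sum.swap[of _ S])
  also have "\<dots> = (\<Sum>g\<in>S. (X * f g) $$ (i, j))"
    using ij assms by (intro sum.cong refl) (subst mat_mult_index, auto)
  finally show "(X * mat_sum n m f S) $$ (i, j) = mat_sum k m (\<lambda>g. X * f g) S $$ (i, j)"
    using ij by simp
qed (use assms in \<open>auto simp: mat_sum_def\<close>)

lemma mat_sum_mult_mat: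
  assumes "X \<in> carrier_mat m k" "\<And>g. g \<in> S \<Longrightarrow> f g \<in> carrier_mat n m"
  shows "mat_sum n m f S * X = mat_sum n k (\<lambda>g. f g * X) S"
proof (rule eq_matI)
  fix i j assume "i < dim_row (mat_sum n k (\<lambda>g. f g * X) S)" "j < dim_col (mat_sum n k (\<lambda>g. f g * X) S)"
  then have ij: "i < n" "j < k" by (auto simp: mat_sum_def)
  have "(mat_sum n m f S * X) $$ (i, j) = (\<Sum>l<m. (\<Sum>g\<in>S. f g $$ (i, l)) * X $$ (l, j))"
    using ij by (subst mat_mult_index[OF mat_sum_carrier assms(1)]) auto
  also have "\<dots> = (\<Sum>g\<in>S. \<Sum>l<m. f g $$ (i, l) * X $$ (l, j))"
    by (simp add: sum_distrib_right sum.swap[of _ S])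
  also have "\<dots> = (\<Sum>g\<in>S. (f g * X) $$ (i, j))"
    using ij assms by (intro sum.cong refl) (subst mat_mult_index, auto)
  finally show "(mat_sum n m f S * X) $$ (i, j) = mat_sum n k (\<lambda>g. f g * X) S $$ (i, j)"
    using ij by simp
qed (use assms in \<open>auto simp: mat_sum_def\<close>)

lemma mat_trace_mat_sum: "mat_trace n (mat_sum n n f S) = (\<Sum>g\<in>S. mat_trace n (f g))"
  by (simp add: mat_trace_def sum.swap[of _ S])

lemma mat_trace_mult_commute:
  assumes "A \<in> carrier_mat n m" "B \<in> carrier_mat m n"
  shows "mat_trace n (A * B) = mat_trace m (B * A)"
proof -
  have "mat_trace n (A * B) = (\<Sum>i<n. \<Sum>l<m. A $$ (i, l) * B $$ (l, i))"
    unfolding mat_trace_def by (intro sum.cong refl mat_mult_index[OF assms]) auto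
  also have "\<dots> = (\<Sum>l<m. \<Sum>i<n. B $$ (l, i) * A $$ (i, l))"
    by (subst sum.swap) (simp add: mult.commute)
  also have "\<dots> = mat_trace m (B * A)"
    unfolding mat_trace_def by (intro sum.cong refl mat_mult_index[OF assms(2,1), symmetric]) auto
  finally show ?thesis .
qed

lemma mat_trace_one [simp]: "mat_trace n (1\<^sub>m n) = of_nat n"
  by (simp add: mat_trace_def)

lemma mat_trace_smult [simp]:
  "A \<in> carrier_mat n n \<Longrightarrow> mat_trace n (c \<cdot>\<^sub>m A) = c * mat_trace n A"
  by (simp add: mat_trace_def sum_distrib_left)

section \<open>Subspaces and their bases\<close>

lemma subspace_vecI:
  fixes W :: "complex vec set"
  assumes "W \<subseteq> carrier_vec n" "0\<^sub>v n \<in> W"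
    "\<And>v w. v \<in> W \<Longrightarrow> w \<in> W \<Longrightarrow> v + w \<in> W" "\<And>c v. v \<in> W \<Longrightarrow> c \<cdot>\<^sub>v v \<in> W"
  shows "VectorSpace.subspace class_ring W (module_vec TYPE(complex) n)"
  unfolding VectorSpace.subspace_def submodule_def
  using assms vec_vs[where 'a = complex, of n] vec_module[where 'a = complex, of n] by (auto simp: module_vec_simps)

lemma subspace_vecD:
  fixes W :: "complex vec set"
  assumes "VectorSpace.subspace class_ring W (module_vec TYPE(complex) n)"
  shows "W \<subseteq> carrier_vec n" "0\<^sub>v n \<in> W"
    "\<And>v w. v \<in> W \<Longrightarrow> w \<in> W \<Longrightarrow> v + w \<in> W" "\<And>c v. v \<in> W \<Longrightarrow> c \<cdot>\<^sub>v v \<in> W"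
  using assms unfolding VectorSpace.subspace_def submodule_def by (auto simp: module_vec_simps)

lemma subspace_range:
  fixes A :: "complex mat"
  assumes A: "A \<in> carrier_mat n m"
  shows "VectorSpace.subspace class_ring ((*\<^sub>v) A ` carrier_vec m) (module_vec TYPE(complex) n)"
proof (rule subspace_vecI)
  show "(*\<^sub>v) A ` carrier_vec m \<subseteq> carrier_vec n" using A by auto
  have "A *\<^sub>v 0\<^sub>v m = 0\<^sub>v n" using A by auto
  then show "0\<^sub>v n \<in> (*\<^sub>v) A ` carrier_vec m" by (metis image_eqI zero_carrier_vec)
qed (auto simp: mult_add_distrib_mat_vec[OF A, symmetric] mult_mat_vec[OF A, symmetric])

lemma range_no_columns:
  fixes A :: "complex mat"
  assumes "A \<in> carrier_mat n 0"
  shows "(*\<^sub>v) A ` carrier_vec 0 \<subseteq> {0\<^sub>v n}"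
  using assms by (auto intro!: eq_vecI simp: scalar_prod_def)

definition injective_mat :: "complex mat \<Rightarrow> bool" where
  "injective_mat Q \<longleftrightarrow> (\<forall>v\<in>carrier_vec (dim_col Q). Q *\<^sub>v v = 0\<^sub>v (dim_row Q) \<longrightarrow> v = 0\<^sub>v (dim_col Q))"

lemma injective_matD:
  "injective_mat Q \<Longrightarrow> Q \<in> carrier_mat n d \<Longrightarrow> v \<in> carrier_vec d \<Longrightarrow> Q *\<^sub>v v = 0\<^sub>v n \<Longrightarrow> v = 0\<^sub>v d"
  unfolding injective_mat_def by auto

text \<open>
  Padding with zero rows would give a square matrix that has determinant zero and the same kernel.
\<close>

lemma injective_mat_cols_le_rows:
  assumes Q: "Q \<in> carrier_mat n d" and inj: "injective_mat Q"
  shows "d \<le> n"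
proof (rule ccontr)
  assume "\<not> d \<le> n"
  then have nd: "n < d" by simp
  define Q' where "Q' = mat d d (\<lambda>(i, j). if i < n then Q $$ (i, j) else 0)"
  have Q': "Q' \<in> carrier_mat d d" by (simp add: Q'_def)
  have "det Q' = 0"
  proof (subst det_transpose[OF Q', symmetric])
    let ?T = "transpose_mat Q'"
    have "?T *\<^sub>v unit_vec d n = 0\<^sub>v d"
      using nd by (intro eq_vecI) (auto simp: Q'_def)
    moreover have "unit_vec d n \<noteq> (0\<^sub>v d :: complex vec)"
      using nd unit_vec_nonzero by auto
    ultimately show "det ?T = 0"
      using det_0_iff_vec_prod_zero[of ?T d] Q' unit_vec_carrier[of d n, where 'a = complex]
        transpose_carrier_mat[of Q' d d] by blast
  qed
  then obtain v where v: "v \<in> carrier_vec d" "v \<noteq> 0\<^sub>v d" "Q' *\<^sub>v v = 0\<^sub>v d"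
    using det_0_iff_vec_prod_zero[OF Q'] by auto
  have "Q *\<^sub>v v = 0\<^sub>v n"
  proof (rule eq_vecI)
    fix i assume "i < dim_vec (0\<^sub>v n :: complex vec)"
    then have i: "i < n" by simp
    have "(Q' *\<^sub>v v) $ i = (Q *\<^sub>v v) $ i"
      using i nd mat_vec_index[OF Q' v(1), of i] mat_vec_index[OF Q v(1) i] by (simp add: Q'_def)
    then show "(Q *\<^sub>v v) $ i = 0\<^sub>v n $ i" using v(3) i nd by simp
  qed (use Q in auto)
  then show False using injective_matD[OF inj Q v(1)] v(2) by simp
qed

lemma injective_mat_snoc_col:
  assumes Q: "Q \<in> carrier_mat n d" and inj: "injective_mat Q"
    and w: "w \<in> carrier_vec n" "w \<notin> (*\<^sub>v) Q ` carrier_vec d"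
  defines "Q' \<equiv> mat n (Suc d) (\<lambda>(i, j). if j < d then Q $$ (i, j) else w $ i)"
  shows "injective_mat Q'"
    and "\<And>v. v \<in> carrier_vec (Suc d) \<Longrightarrow> Q' *\<^sub>v v = Q *\<^sub>v vec d (($) v) + v $ d \<cdot>\<^sub>v w"
proof -
  show eq: "Q' *\<^sub>v v = Q *\<^sub>v vec d (($) v) + v $ d \<cdot>\<^sub>v w" if v: "v \<in> carrier_vec (Suc d)" for v
  proof (rule eq_vecI)
    fix i assume "i < dim_vec (Q *\<^sub>v vec d (($) v) + v $ d \<cdot>\<^sub>v w)"
    then have i: "i < n" using w Q by auto
    have "(Q' *\<^sub>v v) $ i = (\<Sum>l<Suc d. Q' $$ (i, l) * v $ l)"
      using i v by (subst mat_vec_index[of _ n "Suc d"]) (auto simp: Q'_def)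
    also have "\<dots> = (\<Sum>l<d. Q $$ (i, l) * v $ l) + w $ i * v $ d"
      using i by (simp add: Q'_def)
    also have "(\<Sum>l<d. Q $$ (i, l) * v $ l) = (Q *\<^sub>v vec d (($) v)) $ i"
      using i Q by (subst mat_vec_index[OF Q]) auto
    finally show "(Q' *\<^sub>v v) $ i = (Q *\<^sub>v vec d (($) v) + v $ d \<cdot>\<^sub>v w) $ i"
      using i w Q by (simp add: mult.commute)
  qed (use w Q in \<open>auto simp: Q'_def\<close>)
  show "injective_mat Q'"
    unfolding injective_mat_def
  proof (intro ballI impI)
    fix v assume v: "v \<in> carrier_vec (dim_col Q')" and z: "Q' *\<^sub>v v = 0\<^sub>v (dim_row Q')"
    from v have v: "v \<in> carrier_vec (Suc d)" by (simp add: Q'_def)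
    let ?u = "vec d (($) v)"
    have z: "Q *\<^sub>v ?u + v $ d \<cdot>\<^sub>v w = 0\<^sub>v n" using z eq[OF v] by (simp add: Q'_def)
    have vd: "v $ d = 0"
    proof (rule ccontr)
      assume nz: "v $ d \<noteq> 0"
      have "Q *\<^sub>v (- inverse (v $ d) \<cdot>\<^sub>v ?u) = w"
      proof (rule eq_vecI)
        fix i assume "i < dim_vec w"
        then have i: "i < n" using w by auto
        have "(Q *\<^sub>v ?u + v $ d \<cdot>\<^sub>v w) $ i = 0" using z i by simp
        then have "(Q *\<^sub>v ?u) $ i = - (v $ d * w $ i)" using i Q w by (simp add: eq_neg_iff_add_eq_0)
        then show "(Q *\<^sub>v (- inverse (v $ d) \<cdot>\<^sub>v ?u)) $ i = w $ i"
          using i Q nz by (subst mult_mat_vec[OF Q]) auto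
      qed (use w Q in auto)
      then have "w \<in> (*\<^sub>v) Q ` carrier_vec d"
        by (metis image_eqI smult_carrier_vec vec_carrier)
      then show False using w by simp
    qed
    then have "Q *\<^sub>v ?u = 0\<^sub>v n"
    proof -
      have "v $ d \<cdot>\<^sub>v w = 0\<^sub>v n" using vd w by (intro eq_vecI) auto
      then show ?thesis using z Q right_zero_vec[of "Q *\<^sub>v ?u" n] by simp
    qed
    then have u: "?u = 0\<^sub>v d" using injective_matD[OF inj Q] by simp
    show "v = 0\<^sub>v (dim_col Q')"
    proof (rule eq_vecI)
      fix i assume "i < dim_vec (0\<^sub>v (dim_col Q') :: complex vec)"
      then have i: "i < Suc d" by (simp add: Q'_def)
      show "v $ i = 0\<^sub>v (dim_col Q') $ i"
      proof (cases "i < d")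
        case True
        then have "v $ i = ?u $ i" by simp
        then show ?thesis using u i True by (simp add: Q'_def)
      next
        case False
        then have "i = d" using i by simp
        then show ?thesis using vd by (simp add: Q'_def)
      qed
    qed (use v in \<open>simp add: Q'_def\<close>)
  qed
qed

text \<open>
  Subspaces occur below through injective matrices with the given range, whose columns form a
  basis: this keeps a representation on a subspace within the calculus of matrices. Such a matrix
  arises from a maximal number of columns.
\<close>

lemma subspace_mat_basis:
  assumes W: "VectorSpace.subspace class_ring W (module_vec TYPE(complex) n)"
  obtains d Q where "Q \<in> carrier_mat n d" "injective_mat Q" "(*\<^sub>v) Q ` carrier_vec d = W"
    "W \<noteq> carrier_vec n \<Longrightarrow> d < n"
proof -
  define ok where "ok d \<longleftrightarrow> (\<exists>Q. Q \<in> carrier_mat n d \<and> injective_mat Q \<and> (*\<^sub>v) Q ` carrier_vec d \<subseteq> W)" for d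
  define m where "m = Greatest ok"
  have "ok 0"
    unfolding ok_def
  proof (intro exI conjI)
    let ?Q = "mat n 0 (\<lambda>_. 0 :: complex)"
    show c: "?Q \<in> carrier_mat n 0" by simp
    show "injective_mat ?Q" unfolding injective_mat_def by auto
    show "(*\<^sub>v) ?Q ` carrier_vec 0 \<subseteq> W"
      by (rule subset_trans[OF range_no_columns[OF c]]) (use subspace_vecD(2)[OF W] in simp)
  qed
  moreover have bnd: "d \<le> n" if "ok d" for d
    using that injective_mat_cols_le_rows unfolding ok_def by blast
  ultimately have okm: "ok m" and gr: "\<And>d. ok d \<Longrightarrow> d \<le> m"
    unfolding m_def by (auto intro: GreatestI_nat Greatest_le_nat)
  from okm obtain Q where Q: "Q \<in> carrier_mat n m" "injective_mat Q"
      "(*\<^sub>v) Q ` carrier_vec m \<subseteq> W"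
    unfolding ok_def by blast
  have step: "\<exists>Q'. Q' \<in> carrier_mat n (Suc m) \<and> injective_mat Q' \<and>
      (\<forall>v\<in>carrier_vec (Suc m). Q' *\<^sub>v v = Q *\<^sub>v vec m (($) v) + v $ m \<cdot>\<^sub>v w)"
    if "w \<in> carrier_vec n" "w \<notin> (*\<^sub>v) Q ` carrier_vec m" for w
    using injective_mat_snoc_col[OF Q(1,2) that] by (intro exI[of _ "mat n (Suc m) _"]) auto
  have "W \<subseteq> (*\<^sub>v) Q ` carrier_vec m"
  proof
    fix w assume w: "w \<in> W"
    show "w \<in> (*\<^sub>v) Q ` carrier_vec m"
    proof (rule ccontr)
      assume nw: "w \<notin> (*\<^sub>v) Q ` carrier_vec m"
      with w subspace_vecD(1)[OF W] step obtain Q' where Q': "Q' \<in> carrier_mat n (Suc m)" "injective_mat Q'"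
        "\<And>v. v\<in>carrier_vec (Suc m) \<Longrightarrow> Q' *\<^sub>v v = Q *\<^sub>v vec m (($) v) + v $ m \<cdot>\<^sub>v w" by blast
      have "(*\<^sub>v) Q' ` carrier_vec (Suc m) \<subseteq> W"
      proof
        fix x assume "x \<in> (*\<^sub>v) Q' ` carrier_vec (Suc m)"
        then obtain v where v: "v \<in> carrier_vec (Suc m)" and x: "x = Q' *\<^sub>v v" by blast
        have "Q *\<^sub>v vec m (($) v) \<in> W" using Q(3) by auto
        then show "x \<in> W" unfolding x Q'(3)[OF v]
          by (intro subspace_vecD(3,4)[OF W] w)
      qed
      then have "ok (Suc m)" unfolding ok_def using Q' by blast
      then show False using gr by fastforce
    qed
  qed
  with Q(3) have eq: "(*\<^sub>v) Q ` carrier_vec m = W" by blast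
  have "m < n" if ne: "W \<noteq> carrier_vec n"
  proof -
    obtain w where "w \<in> carrier_vec n" "w \<notin> W" using ne subspace_vecD(1)[OF W] by blast
    with step eq obtain Q' where "Q' \<in> carrier_mat n (Suc m)" "injective_mat Q'" by blast
    from injective_mat_cols_le_rows[OF this] show ?thesis by simp
  qed
  with Q eq show ?thesis using that by blast
qed

section \<open>Representations and Schur's lemma\<close>

locale finite_group = group G for G (structure) +
  assumes fin: "finite (carrier G)"

lemma GL_simps [simp]:
  "(\<otimes>\<^bsub>GL n\<^esub>) = (*)" "one (GL n) = 1\<^sub>m n"
  by (simp_all add: units_of_def ring_mat_def)

lemma GL_carrierD: "A \<in> carrier (GL n) \<Longrightarrow> A \<in> carrier_mat n n"
  by (auto simp: units_of_def Units_def ring_mat_def)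

lemma GL_carrierI:
  "A \<in> carrier_mat n n \<Longrightarrow> B \<in> carrier_mat n n \<Longrightarrow> A * B = 1\<^sub>m n \<Longrightarrow> B * A = 1\<^sub>m n \<Longrightarrow> A \<in> carrier (GL n)"
  by (auto simp: units_of_def Units_def ring_mat_def)

lemma group_GL: "group (GL n)"
proof -
  interpret ring "ring_mat TYPE(complex) n ()" by (rule ring_mat)
  show ?thesis by (rule units_group)
qed

context finite_group
begin

lemma rep_homI:
  assumes "\<And>g. g \<in> carrier G \<Longrightarrow> \<rho> g \<in> carrier_mat n n" "\<rho> \<one> = 1\<^sub>m n"
    "\<And>g h. g \<in> carrier G \<Longrightarrow> h \<in> carrier G \<Longrightarrow> \<rho> (g \<otimes> h) = \<rho> g * \<rho> h"
  shows "\<rho> \<in> hom G (GL n)"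
proof (rule homI)
  fix g assume g: "g \<in> carrier G"
  show "\<rho> g \<in> carrier (GL n)"
    by (rule GL_carrierI[of _ _ "\<rho> (inv g)"]) (use assms(1,2) g in \<open>auto simp: assms(3)[symmetric]\<close>)
qed (use assms(3) in auto)

lemma rep_facts:
  assumes "\<rho> \<in> hom G (GL n)"
  shows rep_carrier: "g \<in> carrier G \<Longrightarrow> \<rho> g \<in> carrier_mat n n"
    and rep_one: "\<rho> \<one> = 1\<^sub>m n"
    and rep_mult: "g \<in> carrier G \<Longrightarrow> h \<in> carrier G \<Longrightarrow> \<rho> (g \<otimes> h) = \<rho> g * \<rho> h"
proof -
  show "g \<in> carrier G \<Longrightarrow> \<rho> g \<in> carrier_mat n n"
    using assms GL_carrierD by (auto simp: hom_def)
  show "\<rho> \<one> = 1\<^sub>m n"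
    using hom_one[OF assms is_group group_GL] by simp
  show "g \<in> carrier G \<Longrightarrow> h \<in> carrier G \<Longrightarrow> \<rho> (g \<otimes> h) = \<rho> g * \<rho> h"
    using hom_mult[OF assms] by simp
qed

lemma irreducible_repD:
  assumes "irreducible_rep G n \<rho>"
  shows "\<rho> \<in> hom G (GL n)" "n > 0"
    "\<And>W. VectorSpace.subspace class_ring W (module_vec TYPE(complex) n) \<Longrightarrow>
       (\<And>g w. g \<in> carrier G \<Longrightarrow> w \<in> W \<Longrightarrow> \<rho> g *\<^sub>v w \<in> W) \<Longrightarrow> W = {0\<^sub>v n} \<or> W = carrier_vec n"
  using assms unfolding irreducible_rep_def by auto

lemma inv_mult_cancel_right: "g \<in> carrier G \<Longrightarrow> h \<in> carrier G \<Longrightarrow> inv (h \<otimes> g) \<otimes> h = inv g"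
  by (simp add: inv_mult_group m_assoc)

end

lemma mat_eqI_vec:
  fixes A B :: "complex mat"
  assumes "A \<in> carrier_mat n m" "B \<in> carrier_mat n m"
    "\<And>v. v \<in> carrier_vec m \<Longrightarrow> A *\<^sub>v v = B *\<^sub>v v"
  shows "A = B"
proof (rule eq_matI)
  fix i j assume ij: "i < dim_row B" "j < dim_col B"
  have "(A *\<^sub>v unit_vec m j) $ i = (B *\<^sub>v unit_vec m j) $ i" using assms(3) by simp
  then show "A $$ (i, j) = B $$ (i, j)" using ij assms(1,2) by simp
qed (use assms in auto)

lemma complex_mat_eigenvector:
  fixes T :: "complex mat"
  assumes "T \<in> carrier_mat n n" "n > 0"
  obtains c v where "v \<in> carrier_vec n" "v \<noteq> 0\<^sub>v n" "T *\<^sub>v v = c \<cdot>\<^sub>v v"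
proof -
  have "degree (char_poly T) \<noteq> 0" using degree_monic_char_poly[OF assms(1)] assms(2) by simp
  then have "\<not> constant (poly (char_poly T))" by (simp add: constant_degree)
  then obtain c where "poly (char_poly T) c = 0" using fundamental_theorem_of_algebra by blast
  then have "eigenvalue T c" using eigenvalue_root_char_poly[OF assms(1)] by simp
  then show ?thesis using that assms(1) unfolding eigenvalue_def eigenvector_def by auto
qed

context finite_group
begin

text \<open>
  An eigenspace of \<open>T\<close> is invariant, hence the whole space.
\<close>

lemma Schur_scalar:
  assumes irr: "irreducible_rep G n \<rho>" and T: "T \<in> carrier_mat n n"
    and comm: "\<And>g. g \<in> carrier G \<Longrightarrow> \<rho> g * T = T * \<rho> g"
  obtains c where "T = c \<cdot>\<^sub>m 1\<^sub>m n"
proof -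
  note \<rho> = irreducible_repD[OF irr]
  obtain c v where v: "v \<in> carrier_vec n" "v \<noteq> 0\<^sub>v n" "T *\<^sub>v v = c \<cdot>\<^sub>v v"
    using complex_mat_eigenvector[OF T \<rho>(2)] by blast
  define W where "W = {w \<in> carrier_vec n. T *\<^sub>v w = c \<cdot>\<^sub>v w}"
  have "W = {0\<^sub>v n} \<or> W = carrier_vec n"
  proof (rule \<rho>(3))
    show "VectorSpace.subspace class_ring W (module_vec TYPE(complex) n)"
    proof (rule subspace_vecI)
      show "0\<^sub>v n \<in> W" using T by (auto simp: W_def)
      show "v + w \<in> W" if "v \<in> W" "w \<in> W" for v w
        using that T by (auto simp: W_def mult_add_distrib_mat_vec[OF T] smult_add_distrib_vec)
      show "k \<cdot>\<^sub>v w \<in> W" if "w \<in> W" for k w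
        using that by (auto simp: W_def mult_mat_vec[OF T] smult_smult_assoc mult.commute)
    qed (auto simp: W_def)
    fix g w assume g: "g \<in> carrier G" and w: "w \<in> W"
    note cg = rep_carrier[OF \<rho>(1) g]
    have "T *\<^sub>v (\<rho> g *\<^sub>v w) = (T * \<rho> g) *\<^sub>v w"
      using w by (subst assoc_mult_mat_vec[OF T cg]) (auto simp: W_def)
    also have "\<dots> = (\<rho> g * T) *\<^sub>v w" by (simp add: comm[OF g])
    also have "\<dots> = \<rho> g *\<^sub>v (T *\<^sub>v w)"
      using w by (subst assoc_mult_mat_vec[OF cg T]) (auto simp: W_def)
    also have "\<dots> = c \<cdot>\<^sub>v (\<rho> g *\<^sub>v w)" using w cg by (simp add: W_def mult_mat_vec)
    finally show "\<rho> g *\<^sub>v w \<in> W" using w cg by (simp add: W_def)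
  qed
  moreover have "v \<in> W" using v by (simp add: W_def)
  ultimately have W: "W = carrier_vec n" using v(2) by auto
  have "T = c \<cdot>\<^sub>m 1\<^sub>m n"
  proof (rule mat_eqI_vec[OF T])
    fix w :: "complex vec" assume w: "w \<in> carrier_vec n"
    then have "T *\<^sub>v w = c \<cdot>\<^sub>v w" using W by (auto simp: W_def)
    also have "\<dots> = (c \<cdot>\<^sub>m 1\<^sub>m n) *\<^sub>v w" using w by (intro eq_vecI) auto
    finally show "T *\<^sub>v w = (c \<cdot>\<^sub>m 1\<^sub>m n) *\<^sub>v w" .
  qed auto
  then show ?thesis by (rule that)
qed

text \<open>
  Kernel and range of \<open>T\<close> are invariant, so \<open>T\<close> is bijective. A one-sided inverse built from
  preimages of the unit vectors is then two-sided, and the two representations are similar.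
\<close>

lemma Schur_trace:
  assumes irr: "irreducible_rep G n \<rho>" "irreducible_rep G m \<sigma>" and T: "T \<in> carrier_mat n m"
    and comm: "\<And>g. g \<in> carrier G \<Longrightarrow> \<rho> g * T = T * \<sigma> g" and nz: "T \<noteq> 0\<^sub>m n m"
    and g: "g \<in> carrier G"
  shows "mat_trace n (\<rho> g) = mat_trace m (\<sigma> g)"
proof -
  note \<rho> = irreducible_repD[OF irr(1)] and \<sigma> = irreducible_repD[OF irr(2)]
  define K where "K = {v \<in> carrier_vec m. T *\<^sub>v v = 0\<^sub>v n}"
  define I where "I = (*\<^sub>v) T ` carrier_vec m"
  have zero: False if "\<And>v. v \<in> carrier_vec m \<Longrightarrow> T *\<^sub>v v = 0\<^sub>v n"
  proof -
    have "T = 0\<^sub>m n m" by (rule mat_eqI_vec[OF T]) (auto simp: that)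
    then show False using nz by simp
  qed
  have "K = {0\<^sub>v m} \<or> K = carrier_vec m"
  proof (rule \<sigma>(3))
    show "VectorSpace.subspace class_ring K (module_vec TYPE(complex) m)"
      by (rule subspace_vecI)
        (use T in \<open>auto simp: K_def mult_add_distrib_mat_vec[OF T] mult_mat_vec[OF T]\<close>)
    fix h w assume h: "h \<in> carrier G" and w: "w \<in> K"
    then have w: "w \<in> carrier_vec m" "T *\<^sub>v w = 0\<^sub>v n" by (auto simp: K_def)
    note ch = rep_carrier[OF \<rho>(1) h] rep_carrier[OF \<sigma>(1) h]
    have "T *\<^sub>v (\<sigma> h *\<^sub>v w) = (T * \<sigma> h) *\<^sub>v w" using w ch T by simp
    also have "\<dots> = (\<rho> h * T) *\<^sub>v w" by (simp add: comm[OF h])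
    also have "\<dots> = \<rho> h *\<^sub>v 0\<^sub>v n" using w by (simp add: assoc_mult_mat_vec[OF ch(1) T w(1)])
    also have "\<dots> = 0\<^sub>v n" using ch by auto
    finally show "\<sigma> h *\<^sub>v w \<in> K" using w ch by (simp add: K_def)
  qed
  with zero have K: "K = {0\<^sub>v m}" by (auto simp: K_def)
  have "I = {0\<^sub>v n} \<or> I = carrier_vec n"
  proof (rule \<rho>(3))
    show "VectorSpace.subspace class_ring I (module_vec TYPE(complex) n)"
      unfolding I_def by (rule subspace_range[OF T])
    fix h w assume h: "h \<in> carrier G" and w: "w \<in> I"
    then obtain v where v: "v \<in> carrier_vec m" "w = T *\<^sub>v v" by (auto simp: I_def)
    note ch = rep_carrier[OF \<rho>(1) h] rep_carrier[OF \<sigma>(1) h]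
    have "\<rho> h *\<^sub>v w = (\<rho> h * T) *\<^sub>v v" using v ch T by simp
    also have "\<dots> = (T * \<sigma> h) *\<^sub>v v" by (simp add: comm[OF h])
    also have "\<dots> = T *\<^sub>v (\<sigma> h *\<^sub>v v)" using v ch T by simp
    finally show "\<rho> h *\<^sub>v w \<in> I" using v ch by (auto simp: I_def)
  qed
  with zero have I: "I = carrier_vec n" unfolding I_def by blast
  have "\<exists>v. v \<in> carrier_vec m \<and> T *\<^sub>v v = unit_vec n j" for j
    using I unfolding I_def by (metis (no_types, lifting) imageE unit_vec_carrier)
  then obtain s where s: "\<And>j. s j \<in> carrier_vec m" "\<And>j. T *\<^sub>v s j = unit_vec n j" by metis
  define S where "S = mat m n (\<lambda>(i, j). s j $ i)"
  have S: "S \<in> carrier_mat m n" by (simp add: S_def)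
  have TS: "T * S = 1\<^sub>m n"
  proof (rule eq_matI)
    fix i j assume "i < dim_row (1\<^sub>m n :: complex mat)" "j < dim_col (1\<^sub>m n :: complex mat)"
    then have ij: "i < n" "j < n" by auto
    have "(T * S) $$ (i, j) = (\<Sum>l<m. T $$ (i, l) * s j $ l)"
      using ij by (subst mat_mult_index[OF T S]) (auto simp: S_def)
    also have "\<dots> = (T *\<^sub>v s j) $ i" by (rule mat_vec_index[OF T s(1) ij(1), symmetric])
    finally show "(T * S) $$ (i, j) = 1\<^sub>m n $$ (i, j)" using s(2) ij by simp
  qed (use T S in auto)
  have ST: "S * T = 1\<^sub>m m"
  proof (rule mat_eqI_vec[of _ m m])
    fix v :: "complex vec" assume v: "v \<in> carrier_vec m"
    have c: "(S * T) *\<^sub>v v \<in> carrier_vec m" using S T v by auto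
    have "T *\<^sub>v ((S * T) *\<^sub>v v) = ((T * S) * T) *\<^sub>v v" using S T v by (simp add: assoc_mult_mat[OF T S T] assoc_mult_mat_vec[OF T, of "S * T" m v])
    then have "T *\<^sub>v ((S * T) *\<^sub>v v - v) = 0\<^sub>v n"
      using T v c TS by (simp add: mult_minus_distrib_mat_vec[OF T c v])
    then have "(S * T) *\<^sub>v v - v \<in> K" using c v by (auto simp: K_def)
    then have "(S * T) *\<^sub>v v - v = 0\<^sub>v m" using K by simp
    then have "((S * T) *\<^sub>v v - v) $ i = 0" if "i < m" for i using that by (simp only: index_zero_vec)
    then have "((S * T) *\<^sub>v v) $ i = v $ i" if "i < m" for i
      using that v c index_minus_vec(1)[of i v "(S * T) *\<^sub>v v"] by (metis carrier_vecD right_minus_eq)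
    then have "(S * T) *\<^sub>v v = v" using v c by (metis carrier_vecD eq_vecI)
    then show "(S * T) *\<^sub>v v = 1\<^sub>m m *\<^sub>v v" using v by simp
  qed (use S T in auto)
  note cg = rep_carrier[OF \<rho>(1) g] rep_carrier[OF \<sigma>(1) g]
  have "\<rho> g = (\<rho> g * T) * S" using cg T S TS by (simp add: assoc_mult_mat[OF cg(1) T S])
  also have "\<dots> = T * (\<sigma> g * S)" using cg T S by (simp add: comm[OF g])
  finally have "mat_trace n (\<rho> g) = mat_trace n (T * (\<sigma> g * S))" by simp
  also have "\<dots> = mat_trace m (\<sigma> g * S * T)" using cg S by (intro mat_trace_mult_commute[OF T]) auto
  also have "\<sigma> g * S * T = \<sigma> g" using cg S T ST by simp
  finally show ?thesis .
qed

lemma bij_betw_mult_left: "h \<in> carrier G \<Longrightarrow> bij_betw ((\<otimes>) h) (carrier G) (carrier G)"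
  by (rule bij_betwI[of _ _ _ "(\<otimes>) (inv h)"]) (auto simp: m_assoc[symmetric])

text \<open>
  The source of all orthogonality relations: averaging any \<open>X\<close> over the group gives a matrix to which
  Schur's lemma applies.
\<close>

lemma average_intertwines:
  assumes \<rho>: "\<rho> \<in> hom G (GL n)" and \<sigma>: "\<sigma> \<in> hom G (GL m)" and X: "X \<in> carrier_mat n m"
    and h: "h \<in> carrier G"
  defines "T \<equiv> mat_sum n m (\<lambda>g. \<rho> g * X * \<sigma> (inv g)) (carrier G)"
  shows "\<rho> h * T = T * \<sigma> h"
proof -
  note c = rep_carrier[OF \<rho>] rep_carrier[OF \<sigma>]
  have cc: "\<rho> g * X * \<sigma> (inv g) \<in> carrier_mat n m" if "g \<in> carrier G" for g
    by (rule mult_carrier_mat[OF mult_carrier_mat[OF c(1)[OF that] X] c(2)[OF inv_closed[OF that]]])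
  have "T * \<sigma> h = mat_sum n m (\<lambda>g. \<rho> g * X * \<sigma> (inv g) * \<sigma> h) (carrier G)"
    unfolding T_def by (rule mat_sum_mult_mat) (use c h cc in auto)
  also have "\<dots> = mat_sum n m (\<lambda>g. \<rho> (h \<otimes> g) * X * \<sigma> (inv (h \<otimes> g)) * \<sigma> h) (carrier G)"
    by (rule mat_sum_reindex[OF bij_betw_mult_left[OF h], symmetric])
  also have "\<dots> = mat_sum n m (\<lambda>g. \<rho> h * (\<rho> g * X * \<sigma> (inv g))) (carrier G)"
  proof (rule mat_sum_cong)
    fix g assume g: "g \<in> carrier G"
    have i: "inv (h \<otimes> g) \<in> carrier G" using g h by auto
    have "\<sigma> (inv (h \<otimes> g)) * \<sigma> h = \<sigma> (inv g)"
      using g h by (simp add: rep_mult[OF \<sigma>, symmetric] inv_mult_cancel_right)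
    then have "\<rho> (h \<otimes> g) * X * \<sigma> (inv (h \<otimes> g)) * \<sigma> h = \<rho> (h \<otimes> g) * X * \<sigma> (inv g)"
      using assoc_mult_mat[OF mult_carrier_mat[OF c(1)[OF m_closed[OF h g]] X] c(2)[OF i] c(2)[OF h]] by simp
    also have "\<dots> = \<rho> h * (\<rho> g * X * \<sigma> (inv g))"
      using assoc_mult_mat[OF c(1)[OF h] c(1)[OF g] X]
        assoc_mult_mat[OF c(1)[OF h] mult_carrier_mat[OF c(1)[OF g] X] c(2)[OF inv_closed[OF g]]]
      by (simp add: rep_mult[OF \<rho> h g])
    finally show "\<rho> (h \<otimes> g) * X * \<sigma> (inv (h \<otimes> g)) * \<sigma> h = \<rho> h * (\<rho> g * X * \<sigma> (inv g))" .
  qed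
  also have "\<dots> = \<rho> h * T"
    unfolding T_def by (rule mat_mult_mat_sum[symmetric]) (use c h cc in auto)
  finally show ?thesis by simp
qed

section \<open>Orthogonality of irreducible characters\<close>

definition mat_unit :: "nat \<Rightarrow> nat \<Rightarrow> nat \<Rightarrow> nat \<Rightarrow> complex mat" where
  "mat_unit n m a b = mat n m (\<lambda>ij. if ij = (a, b) then 1 else 0)"

lemma mat_unit_sandwich:
  assumes "A \<in> carrier_mat n n" "B \<in> carrier_mat m m" "a < n" "b < m" "i < n" "j < m"
  shows "(A * mat_unit n m a b * B) $$ (i, j) = A $$ (i, a) * B $$ (b, j)"
proof -
  have E: "mat_unit n m a b \<in> carrier_mat n m" by (simp add: mat_unit_def)
  have 1: "(A * mat_unit n m a b) $$ (i, l) = (if l = b then A $$ (i, a) else 0)" if "l < m" for l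
  proof -
    have "(A * mat_unit n m a b) $$ (i, l) = (\<Sum>k<n. A $$ (i, k) * mat_unit n m a b $$ (k, l))"
      using assms that by (subst mat_mult_index[OF assms(1) E]) auto
    also have "\<dots> = (\<Sum>k<n. if k = a then (if l = b then A $$ (i, a) else 0) else 0)"
      using that by (intro sum.cong refl) (auto simp: mat_unit_def)
    finally have "(A * mat_unit n m a b) $$ (i, l) = (\<Sum>k<n. if k = a then (if l = b then A $$ (i, a) else 0) else 0)" .
    then show ?thesis using assms by simp
  qed
  have "(A * mat_unit n m a b * B) $$ (i, j) = (\<Sum>l<m. (A * mat_unit n m a b) $$ (i, l) * B $$ (l, j))"
    by (rule mat_mult_index[OF mult_carrier_mat[OF assms(1) E] assms(2,5,6)])
  also have "\<dots> = (\<Sum>l<m. if l = b then A $$ (i, a) * B $$ (b, j) else 0)"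
    by (rule sum.cong[OF refl], subst 1) auto
  finally have "(A * mat_unit n m a b * B) $$ (i, j) = (\<Sum>l<m. if l = b then A $$ (i, a) * B $$ (b, j) else 0)" .
  then show ?thesis using assms by simp
qed

text \<open>
  Applied to the matrix units, the averages contain every product of a coefficient of \<open>\<rho>\<close> and one of
  \<open>\<sigma>\<close>; the products of characters are sums of these.
\<close>

lemma trace_orthogonality_expand:
  assumes \<rho>: "\<rho> \<in> hom G (GL n)" and \<sigma>: "\<sigma> \<in> hom G (GL m)"
  shows "(\<Sum>g\<in>carrier G. mat_trace n (\<rho> g) * mat_trace m (\<sigma> (inv g))) =
    (\<Sum>a<n. \<Sum>b<m. mat_sum n m (\<lambda>g. \<rho> g * mat_unit n m a b * \<sigma> (inv g)) (carrier G) $$ (a, b))"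
proof -
  have "(\<Sum>a<n. \<Sum>b<m. mat_sum n m (\<lambda>g. \<rho> g * mat_unit n m a b * \<sigma> (inv g)) (carrier G) $$ (a, b))
      = (\<Sum>a<n. \<Sum>b<m. \<Sum>g\<in>carrier G. \<rho> g $$ (a, a) * \<sigma> (inv g) $$ (b, b))"
    by (intro sum.cong refl)
      (simp add: mat_unit_sandwich rep_carrier[OF \<rho>] rep_carrier[OF \<sigma>])
  also have "\<dots> = (\<Sum>g\<in>carrier G. \<Sum>a<n. \<Sum>b<m. \<rho> g $$ (a, a) * \<sigma> (inv g) $$ (b, b))"
    by (simp add: sum.swap[of _ "carrier G"])
  also have "\<dots> = (\<Sum>g\<in>carrier G. mat_trace n (\<rho> g) * mat_trace m (\<sigma> (inv g)))"
    by (simp add: mat_trace_def sum_product)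
  finally show ?thesis by simp
qed

lemma trace_orthogonality_distinct:
  assumes irr: "irreducible_rep G n \<rho>" "irreducible_rep G m \<sigma>"
    and neq: "\<exists>g\<in>carrier G. mat_trace n (\<rho> g) \<noteq> mat_trace m (\<sigma> g)"
  shows "(\<Sum>g\<in>carrier G. mat_trace n (\<rho> g) * mat_trace m (\<sigma> (inv g))) = 0"
proof -
  note \<rho> = irreducible_repD[OF irr(1)] and \<sigma> = irreducible_repD[OF irr(2)]
  have "mat_sum n m (\<lambda>g. \<rho> g * mat_unit n m a b * \<sigma> (inv g)) (carrier G) = 0\<^sub>m n m" for a b
  proof (rule ccontr)
    assume nz: "mat_sum n m (\<lambda>g. \<rho> g * mat_unit n m a b * \<sigma> (inv g)) (carrier G) \<noteq> 0\<^sub>m n m"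
    have "mat_unit n m a b \<in> carrier_mat n m" by (simp add: mat_unit_def)
    from Schur_trace[OF irr mat_sum_carrier average_intertwines[OF \<rho>(1) \<sigma>(1) this] nz]
    show False using neq by blast
  qed
  then show ?thesis by (simp add: trace_orthogonality_expand[OF \<rho>(1) \<sigma>(1)])
qed

lemma trace_orthogonality_same:
  assumes irr: "irreducible_rep G n \<rho>"
  shows "(\<Sum>g\<in>carrier G. mat_trace n (\<rho> g) * mat_trace n (\<rho> (inv g))) = of_nat (card (carrier G))"
proof -
  note \<rho> = irreducible_repD[OF irr]
  define T where "T a b = mat_sum n n (\<lambda>g. \<rho> g * mat_unit n n a b * \<rho> (inv g)) (carrier G)" for a b
  have entry: "T a b $$ (a, b) = (if a = b then of_nat (card (carrier G)) / of_nat n else 0)"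
    if ab: "a < n" "b < n" for a b
  proof -
    have E: "mat_unit n n a b \<in> carrier_mat n n" by (simp add: mat_unit_def)
    obtain c where c: "T a b = c \<cdot>\<^sub>m 1\<^sub>m n"
      by (rule Schur_scalar[OF irr mat_sum_carrier average_intertwines[OF \<rho>(1) \<rho>(1) E]])
        (auto simp: T_def)
    have "of_nat n * c = mat_trace n (T a b)" by (simp add: c mult.commute)
    also have "\<dots> = (\<Sum>g\<in>carrier G. mat_trace n (\<rho> g * mat_unit n n a b * \<rho> (inv g)))"
      by (simp add: T_def mat_trace_mat_sum)
    also have "\<dots> = (\<Sum>g\<in>carrier G. mat_trace n (mat_unit n n a b))"
    proof (intro sum.cong refl)
      fix g assume g: "g \<in> carrier G"
      note cg = rep_carrier[OF \<rho>(1) g] rep_carrier[OF \<rho>(1) inv_closed[OF g]]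
      have "mat_trace n (\<rho> g * mat_unit n n a b * \<rho> (inv g)) = mat_trace n (\<rho> g * (mat_unit n n a b * \<rho> (inv g)))"
        using assoc_mult_mat[OF cg(1) E cg(2)] by simp
      also have "\<dots> = mat_trace n (mat_unit n n a b * \<rho> (inv g) * \<rho> g)"
        using cg E by (intro mat_trace_mult_commute) auto
      also have "mat_unit n n a b * \<rho> (inv g) * \<rho> g = mat_unit n n a b"
        using assoc_mult_mat[OF E cg(2,1)] g E by (simp add: rep_mult[OF \<rho>(1), symmetric] rep_one[OF \<rho>(1)])
      finally show "mat_trace n (\<rho> g * mat_unit n n a b * \<rho> (inv g)) = mat_trace n (mat_unit n n a b)" .
    qed
    also have "mat_trace n (mat_unit n n a b) = (\<Sum>i<n. if i = a then (if a = b then 1 else 0) else 0)"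
      unfolding mat_trace_def by (intro sum.cong) (auto simp: mat_unit_def)
    also have "\<dots> = (if a = b then 1 else 0)" using ab by simp
    finally have nc: "of_nat n * c = of_nat (card (carrier G)) * (if a = b then 1 else 0)" by simp
    have "T a b $$ (a, b) = c * (if a = b then 1 else 0)" using ab by (simp add: c)
    moreover have "c = of_nat (card (carrier G)) * (if a = b then 1 else 0) / of_nat n"
      using \<rho>(2) by (simp only: nc[symmetric]) simp
    ultimately show ?thesis by simp
  qed
  have "(\<Sum>a<n. \<Sum>b<n. T a b $$ (a, b)) = (\<Sum>a<n. \<Sum>b<n. if b = a then of_nat (card (carrier G)) / of_nat n else 0)"
    by (intro sum.cong refl) (auto simp: entry)
  also have "\<dots> = of_nat (card (carrier G))" using \<rho>(2) by simp
  finally show ?thesis by (simp add: trace_orthogonality_expand[OF \<rho>(1) \<rho>(1)] T_def)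
qed

end

section \<open>Unitarity\<close>

definition mat_adj :: "nat \<Rightarrow> complex mat \<Rightarrow> complex mat" where
  "mat_adj n A = mat n n (\<lambda>(i, j). cnj (A $$ (j, i)))"

lemma mat_adj_carrier [simp]: "mat_adj n A \<in> carrier_mat n n"
  by (simp add: mat_adj_def)

lemma mat_adj_mult:
  assumes "A \<in> carrier_mat n n" "B \<in> carrier_mat n n"
  shows "mat_adj n (A * B) = mat_adj n B * mat_adj n A"
proof (rule eq_matI)
  fix i j assume "i < dim_row (mat_adj n B * mat_adj n A)" "j < dim_col (mat_adj n B * mat_adj n A)"
  then have ij: "i < n" "j < n" by (auto simp: mat_adj_def)
  have "mat_adj n (A * B) $$ (i, j) = cnj ((A * B) $$ (j, i))" using ij by (simp add: mat_adj_def)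
  also have "\<dots> = (\<Sum>l<n. cnj (A $$ (j, l)) * cnj (B $$ (l, i)))"
    by (subst mat_mult_index[OF assms ij(2,1)]) simp
  also have "\<dots> = (\<Sum>l<n. mat_adj n B $$ (i, l) * mat_adj n A $$ (l, j))"
    using ij by (intro sum.cong refl) (simp add: mat_adj_def)
  also have "\<dots> = (mat_adj n B * mat_adj n A) $$ (i, j)"
    by (rule mat_mult_index[symmetric]) (use ij in auto)
  finally show "mat_adj n (A * B) $$ (i, j) = (mat_adj n B * mat_adj n A) $$ (i, j)" .
qed (auto simp: mat_adj_def)

lemma mat_trace_adj: "mat_trace n (mat_adj n A) = cnj (mat_trace n A)"
  by (simp add: mat_trace_def mat_adj_def)

lemma mat_adj_mult_self_form:
  assumes A: "A \<in> carrier_mat n n" and v: "v \<in> carrier_vec n"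
  shows "(\<Sum>i<n. cnj (v $ i) * ((mat_adj n A * A) *\<^sub>v v) $ i) = of_real (\<Sum>k<n. (cmod ((A *\<^sub>v v) $ k))\<^sup>2)"
proof -
  have Av: "A *\<^sub>v v \<in> carrier_vec n" using A v by simp
  have "((mat_adj n A * A) *\<^sub>v v) $ i = (\<Sum>k<n. cnj (A $$ (k, i)) * (A *\<^sub>v v) $ k)" if i: "i < n" for i
  proof -
    have "((mat_adj n A * A) *\<^sub>v v) $ i = (mat_adj n A *\<^sub>v (A *\<^sub>v v)) $ i"
      by (subst assoc_mult_mat_vec[OF mat_adj_carrier A v]) simp
    also have "\<dots> = (\<Sum>k<n. mat_adj n A $$ (i, k) * (A *\<^sub>v v) $ k)"
      by (rule mat_vec_index[OF mat_adj_carrier Av i])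
    also have "\<dots> = (\<Sum>k<n. cnj (A $$ (k, i)) * (A *\<^sub>v v) $ k)"
      using i by (intro sum.cong refl) (simp add: mat_adj_def)
    finally show ?thesis .
  qed
  then have "(\<Sum>i<n. cnj (v $ i) * ((mat_adj n A * A) *\<^sub>v v) $ i) =
      (\<Sum>i<n. \<Sum>k<n. cnj (A $$ (k, i) * v $ i) * (A *\<^sub>v v) $ k)"
    by (intro sum.cong refl) (simp add: sum_distrib_left mult_ac)
  also have "\<dots> = (\<Sum>k<n. cnj (\<Sum>i<n. A $$ (k, i) * v $ i) * (A *\<^sub>v v) $ k)"
    by (subst sum.swap) (simp add: sum_distrib_right)
  also have "\<dots> = (\<Sum>k<n. cnj ((A *\<^sub>v v) $ k) * (A *\<^sub>v v) $ k)"
    by (intro sum.cong refl) (simp only: mat_vec_index[OF A v] lessThan_iff)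
  also have "\<dots> = of_real (\<Sum>k<n. (cmod ((A *\<^sub>v v) $ k))\<^sup>2)"
    by (simp add: complex_norm_square mult.commute del: of_real_power)
  finally show ?thesis .
qed

lemma mat_sum_mult_vec_index:
  assumes "\<And>g. g \<in> S \<Longrightarrow> f g \<in> carrier_mat n m" "v \<in> carrier_vec m" "i < n"
  shows "(mat_sum n m f S *\<^sub>v v) $ i = (\<Sum>g\<in>S. (f g *\<^sub>v v) $ i)"
proof -
  have "(mat_sum n m f S *\<^sub>v v) $ i = (\<Sum>l<m. (\<Sum>g\<in>S. f g $$ (i, l)) * v $ l)"
    using assms(3) by (subst mat_vec_index[OF mat_sum_carrier assms(2,3)]) simp
  also have "\<dots> = (\<Sum>g\<in>S. \<Sum>l<m. f g $$ (i, l) * v $ l)"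
    by (simp add: sum_distrib_right sum.swap[of _ S])
  also have "\<dots> = (\<Sum>g\<in>S. (f g *\<^sub>v v) $ i)"
    by (rule sum.cong[OF refl], rule mat_vec_index[OF assms(1,2,3), symmetric])
  finally show ?thesis .
qed

lemma complex_mat_inverse:
  fixes A :: "complex mat"
  assumes A: "A \<in> carrier_mat n n" and inj: "\<And>v. v \<in> carrier_vec n \<Longrightarrow> A *\<^sub>v v = 0\<^sub>v n \<Longrightarrow> v = 0\<^sub>v n"
  obtains B where "B \<in> carrier_mat n n" "A * B = 1\<^sub>m n" "B * A = 1\<^sub>m n"
proof -
  have "det A \<noteq> 0" using inj det_0_iff_vec_prod_zero[OF A] by blast
  from det_non_zero_imp_unit[OF A this, of "()"] show ?thesis
    using that by (auto simp: Units_def ring_mat_def)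
qed

context finite_group
begin

lemma bij_betw_mult_right: "h \<in> carrier G \<Longrightarrow> bij_betw (\<lambda>g. g \<otimes> h) (carrier G) (carrier G)"
  by (rule bij_betwI[of _ _ _ "\<lambda>g. g \<otimes> inv h"]) (auto simp: m_assoc)

text \<open>
  The matrix \<open>H = \<Sum>\<^sub>g \<rho>(g)\<^sup>* \<rho>(g)\<close> is positive definite and satisfies \<open>\<rho>(h)\<^sup>* H \<rho>(h) = H\<close>. Thus \<open>\<rho>(h\<inverse>)\<close>
  is similar to \<open>\<rho>(h)\<^sup>*\<close>.
\<close>

lemma trace_rep_inv:
  assumes \<rho>: "\<rho> \<in> hom G (GL n)" and h: "h \<in> carrier G"
  shows "mat_trace n (\<rho> (inv h)) = cnj (mat_trace n (\<rho> h))"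
proof -
  note c = rep_carrier[OF \<rho>]
  define H where "H = mat_sum n n (\<lambda>g. mat_adj n (\<rho> g) * \<rho> g) (carrier G)"
  have H: "H \<in> carrier_mat n n" by (simp add: H_def)
  have cc: "mat_adj n (\<rho> g) * \<rho> g \<in> carrier_mat n n" if "g \<in> carrier G" for g
    by (rule mult_carrier_mat[OF mat_adj_carrier c[OF that]])
  have "v = 0\<^sub>v n" if v: "v \<in> carrier_vec n" and z: "H *\<^sub>v v = 0\<^sub>v n" for v
  proof -
    define s where "s g = (\<Sum>k<n. (cmod ((\<rho> g *\<^sub>v v) $ k))\<^sup>2)" for g
    have "(0 :: complex) = (\<Sum>i<n. cnj (v $ i) * (H *\<^sub>v v) $ i)" by (simp add: z)
    also have "\<dots> = (\<Sum>i<n. \<Sum>g\<in>carrier G. cnj (v $ i) * ((mat_adj n (\<rho> g) * \<rho> g) *\<^sub>v v) $ i)"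
      unfolding H_def by (intro sum.cong refl) (simp only: mat_sum_mult_vec_index[OF cc v] lessThan_iff sum_distrib_left)
    also have "\<dots> = (\<Sum>g\<in>carrier G. \<Sum>i<n. cnj (v $ i) * ((mat_adj n (\<rho> g) * \<rho> g) *\<^sub>v v) $ i)"
      by (rule sum.swap)
    also have "\<dots> = (\<Sum>g\<in>carrier G. of_real (s g))"
      unfolding s_def by (intro sum.cong refl mat_adj_mult_self_form c v)
    finally have "(\<Sum>g\<in>carrier G. s g) = 0"
      by (metis of_real_0 of_real_eq_iff of_real_sum)
    moreover have "s g \<ge> 0" for g by (simp add: s_def sum_nonneg)
    ultimately have "s \<one> = 0" using fin by (simp add: sum_nonneg_eq_0_iff)
    then have "(\<rho> \<one> *\<^sub>v v) $ k = 0" if "k < n" for k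
      using that unfolding s_def by (simp add: sum_nonneg_eq_0_iff)
    then show ?thesis using v by (intro eq_vecI) (auto simp: rep_one[OF \<rho>])
  qed
  then obtain Hi where Hi: "Hi \<in> carrier_mat n n" "H * Hi = 1\<^sub>m n" "Hi * H = 1\<^sub>m n"
    using complex_mat_inverse[OF H] by blast
  note ch = c[OF h] c[OF inv_closed[OF h]]
  have "mat_adj n (\<rho> h) * H * \<rho> h = mat_adj n (\<rho> h) * (H * \<rho> h)"
    by (rule assoc_mult_mat[OF mat_adj_carrier H ch(1)])
  also have "H * \<rho> h = mat_sum n n (\<lambda>g. mat_adj n (\<rho> g) * \<rho> g * \<rho> h) (carrier G)"
    unfolding H_def by (rule mat_sum_mult_mat[OF ch(1) cc])
  also have "mat_adj n (\<rho> h) * \<dots> = mat_sum n n (\<lambda>g. mat_adj n (\<rho> h) * (mat_adj n (\<rho> g) * \<rho> g * \<rho> h)) (carrier G)"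
    by (rule mat_mult_mat_sum[OF mat_adj_carrier mult_carrier_mat[OF cc ch(1)]])
  also have "\<dots> = mat_sum n n (\<lambda>g. mat_adj n (\<rho> (g \<otimes> h)) * \<rho> (g \<otimes> h)) (carrier G)"
  proof (rule mat_sum_cong)
    fix g assume g: "g \<in> carrier G"
    have "mat_adj n (\<rho> (g \<otimes> h)) * \<rho> (g \<otimes> h) = mat_adj n (\<rho> h) * mat_adj n (\<rho> g) * (\<rho> g * \<rho> h)"
      using g h by (simp add: rep_mult[OF \<rho>] mat_adj_mult[OF c c])
    also have "\<dots> = mat_adj n (\<rho> h) * (mat_adj n (\<rho> g) * (\<rho> g * \<rho> h))"
      by (rule assoc_mult_mat[OF mat_adj_carrier mat_adj_carrier mult_carrier_mat[OF c[OF g] ch(1)]])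
    also have "mat_adj n (\<rho> g) * (\<rho> g * \<rho> h) = mat_adj n (\<rho> g) * \<rho> g * \<rho> h"
      by (rule assoc_mult_mat[OF mat_adj_carrier c[OF g] ch(1), symmetric])
    finally show "mat_adj n (\<rho> h) * (mat_adj n (\<rho> g) * \<rho> g * \<rho> h) = mat_adj n (\<rho> (g \<otimes> h)) * \<rho> (g \<otimes> h)" ..
  qed
  also have "\<dots> = H" unfolding H_def by (rule mat_sum_reindex[OF bij_betw_mult_right[OF h]])
  finally have inv: "mat_adj n (\<rho> h) * H * \<rho> h = H" .
  have "H * \<rho> (inv h) = mat_adj n (\<rho> h) * H * (\<rho> h * \<rho> (inv h))"
    using assoc_mult_mat[OF mult_carrier_mat[OF mat_adj_carrier H] ch, of "\<rho> h"] inv by simp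
  also have "\<rho> h * \<rho> (inv h) = 1\<^sub>m n"
    using h by (simp add: rep_mult[OF \<rho>, symmetric] rep_one[OF \<rho>])
  finally have eq: "H * \<rho> (inv h) = mat_adj n (\<rho> h) * H"
    using right_mult_one_mat[OF mult_carrier_mat[OF mat_adj_carrier H]] by simp
  have "mat_trace n (\<rho> (inv h)) = mat_trace n (Hi * (H * \<rho> (inv h)))"
    using assoc_mult_mat[OF Hi(1) H ch(2)] Hi(3) ch by simp
  also have "\<dots> = mat_trace n (mat_adj n (\<rho> h) * H * Hi)"
    unfolding eq by (rule mat_trace_mult_commute[OF Hi(1) mult_carrier_mat[OF mat_adj_carrier H]])
  also have "mat_adj n (\<rho> h) * H * Hi = mat_adj n (\<rho> h)"
    using assoc_mult_mat[OF mat_adj_carrier H Hi(1), of "\<rho> h"] Hi(2)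
      right_mult_one_mat[OF mat_adj_carrier[of n "\<rho> h"]] by simp
  finally show ?thesis by (simp add: mat_trace_adj)
qed

section \<open>Irreducible characters\<close>

lemma character_of_eq: "g \<in> carrier G \<Longrightarrow> character_of G n \<rho> g = mat_trace n (\<rho> g)"
  by (simp add: character_of_def mat_trace_def)

lemma IrrE:
  assumes "\<chi> \<in> Irr G"
  obtains n \<rho> where "irreducible_rep G n \<rho>" "\<And>g. g \<in> carrier G \<Longrightarrow> \<chi> g = mat_trace n (\<rho> g)"
  using assms character_of_eq unfolding Irr_def by blast

lemma Irr_outside: "\<chi> \<in> Irr G \<Longrightarrow> g \<notin> carrier G \<Longrightarrow> \<chi> g = 0"
  by (auto simp: Irr_def character_of_def)

lemma Irr_eqI:
  "\<chi> \<in> Irr G \<Longrightarrow> \<psi> \<in> Irr G \<Longrightarrow> (\<And>g. g \<in> carrier G \<Longrightarrow> \<chi> g = \<psi> g) \<Longrightarrow> \<chi> = \<psi>"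
  by (rule ext) (metis Irr_outside)

lemma Irr_one:
  assumes "\<chi> \<in> Irr G"
  obtains n where "n > 0" "\<chi> \<one> = of_nat n"
proof -
  from assms obtain n \<rho> where irr: "irreducible_rep G n \<rho>"
    and \<chi>: "\<And>g. g \<in> carrier G \<Longrightarrow> \<chi> g = mat_trace n (\<rho> g)" by (rule IrrE) blast
  show ?thesis
    by (rule that[OF irreducible_repD(2)[OF irr]]) (simp add: \<chi> rep_one[OF irreducible_repD(1)[OF irr]])
qed

lemma Irr_one_nz: "\<chi> \<in> Irr G \<Longrightarrow> \<chi> \<one> \<noteq> 0"
  by (elim Irr_one) simp

lemma Irr_mult_commute:
  assumes "\<chi> \<in> Irr G" "g \<in> carrier G" "h \<in> carrier G"
  shows "\<chi> (g \<otimes> h) = \<chi> (h \<otimes> g)"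
proof -
  from assms(1) obtain n \<rho> where irr: "irreducible_rep G n \<rho>"
    and \<chi>: "\<And>g. g \<in> carrier G \<Longrightarrow> \<chi> g = mat_trace n (\<rho> g)" by (rule IrrE) blast
  note \<rho> = irreducible_repD(1)[OF irr]
  show ?thesis
    using assms(2,3) mat_trace_mult_commute[OF rep_carrier[OF \<rho>] rep_carrier[OF \<rho>]]
    by (simp add: \<chi> rep_mult[OF \<rho>])
qed

lemma Irr_inv: "\<chi> \<in> Irr G \<Longrightarrow> g \<in> carrier G \<Longrightarrow> \<chi> (inv g) = cnj (\<chi> g)"
  by (elim IrrE) (simp add: trace_rep_inv[OF irreducible_repD(1)])

lemma Irr_orthogonal:
  assumes "\<chi> \<in> Irr G" "\<psi> \<in> Irr G"
  shows "(\<Sum>g\<in>carrier G. \<chi> g * cnj (\<psi> g)) = (if \<chi> = \<psi> then of_nat (card (carrier G)) else 0)"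
proof -
  from assms(1) obtain n \<rho> where irr: "irreducible_rep G n \<rho>"
    and \<chi>: "\<And>g. g \<in> carrier G \<Longrightarrow> \<chi> g = mat_trace n (\<rho> g)" by (rule IrrE) blast
  from assms(2) obtain m \<sigma> where irr': "irreducible_rep G m \<sigma>"
    and \<psi>: "\<And>g. g \<in> carrier G \<Longrightarrow> \<psi> g = mat_trace m (\<sigma> g)" by (rule IrrE) blast
  have "(\<Sum>g\<in>carrier G. \<chi> g * cnj (\<psi> g)) = (\<Sum>g\<in>carrier G. \<chi> g * \<psi> (inv g))"
    by (intro sum.cong refl) (simp add: Irr_inv[OF assms(2)])
  also have "\<dots> = (if \<chi> = \<psi> then of_nat (card (carrier G)) else 0)"
  proof (cases "\<chi> = \<psi>")
    case True
    then show ?thesis using trace_orthogonality_same[OF irr] by (simp add: \<chi>[symmetric] cong: sum.cong)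
  next
    case False
    then have "\<exists>g\<in>carrier G. \<chi> g \<noteq> \<psi> g" using Irr_eqI[OF assms] by blast
    then have "\<exists>g\<in>carrier G. mat_trace n (\<rho> g) \<noteq> mat_trace m (\<sigma> g)" by (simp add: \<chi> \<psi>)
    from trace_orthogonality_distinct[OF irr irr' this] show ?thesis
      using False by (simp add: \<chi> \<psi>)
  qed
  finally show ?thesis .
qed

text \<open>
  Bessel's inequality for the function that is \<open>|G|\<close> at the identity and zero elsewhere. It bounds the
  number of irreducible characters, as each degree is at least one.
\<close>

lemma sum_squares_degrees_le:
  assumes F: "finite F" "F \<subseteq> Irr G"
  shows "(\<Sum>\<chi>\<in>F. (cmod (\<chi> \<one>))\<^sup>2) \<le> card (carrier G)"
proof -
  define N where "N = card (carrier G)"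
  have N: "N > 0" using fin unfolding N_def by (auto simp: card_gt_0_iff)
  define d where "d g = (if g = \<one> then of_nat N else 0 :: complex)" for g
  define S where "S g = (\<Sum>\<chi>\<in>F. \<chi> \<one> * \<chi> g)" for g
  define q where "q = (\<Sum>\<chi>\<in>F. (cmod (\<chi> \<one>))\<^sup>2)"
  have real: "cnj (\<chi> \<one>) = \<chi> \<one>" if "\<chi> \<in> F" for \<chi>
    using that F(2) by (metis Irr_inv inv_one one_closed subset_iff)
  have sq: "\<chi> \<one> * \<chi> \<one> = of_real ((cmod (\<chi> \<one>))\<^sup>2)" if "\<chi> \<in> F" for \<chi>
    using real[OF that] by (metis complex_norm_square)
  have S1: "S \<one> = of_real q" unfolding S_def q_def by (simp add: sq del: of_real_power)
  have dX: "(\<Sum>g\<in>carrier G. d g * X g) = of_nat N * X \<one>" for X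
    using fin by (simp add: d_def if_distrib[of "\<lambda>z. z * _"] cong: if_cong)
  have dd: "(\<Sum>g\<in>carrier G. d g * cnj (d g)) = of_nat N * of_nat N" by (subst dX) (simp add: d_def)
  have dS: "(\<Sum>g\<in>carrier G. d g * cnj (S g)) = of_nat N * of_real q" by (subst dX) (simp add: S1)
  have Sd: "(\<Sum>g\<in>carrier G. S g * cnj (d g)) = of_nat N * of_real q"
  proof -
    have "(\<Sum>g\<in>carrier G. S g * cnj (d g)) = (\<Sum>g\<in>carrier G. d g * S g)"
      by (intro sum.cong refl) (simp add: d_def)
    then show ?thesis by (simp add: dX S1)
  qed
  have SS: "(\<Sum>g\<in>carrier G. S g * cnj (S g)) = of_nat N * of_real q"
  proof -
    have "(\<Sum>g\<in>carrier G. S g * cnj (S g))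
        = (\<Sum>g\<in>carrier G. \<Sum>\<chi>\<in>F. \<Sum>\<psi>\<in>F. \<chi> \<one> * cnj (\<psi> \<one>) * (\<chi> g * cnj (\<psi> g)))"
      unfolding S_def by (simp add: sum_product mult_ac)
    also have "\<dots> = (\<Sum>\<chi>\<in>F. \<Sum>\<psi>\<in>F. \<chi> \<one> * cnj (\<psi> \<one>) * (\<Sum>g\<in>carrier G. \<chi> g * cnj (\<psi> g)))"
      by (simp add: sum.swap[of _ _ "carrier G"] sum_distrib_left)
    also have "\<dots> = (\<Sum>\<chi>\<in>F. \<Sum>\<psi>\<in>F. if \<psi> = \<chi> then \<chi> \<one> * \<chi> \<one> * of_nat N else 0)"
      using F(2) by (intro sum.cong refl) (auto simp: Irr_orthogonal N_def real subset_iff)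
    also have "\<dots> = (\<Sum>\<chi>\<in>F. of_real ((cmod (\<chi> \<one>))\<^sup>2) * of_nat N)"
      using F(1) by (simp add: sq del: of_real_power)
    also have "\<dots> = of_nat N * of_real q" by (simp add: q_def sum_distrib_left mult.commute)
    finally show ?thesis .
  qed
  have "of_real (\<Sum>g\<in>carrier G. (cmod (d g - S g))\<^sup>2) = (\<Sum>g\<in>carrier G. (d g - S g) * cnj (d g - S g))"
    by (simp only: of_real_sum complex_norm_square)
  also have "\<dots> = (\<Sum>g\<in>carrier G. d g * cnj (d g)) - (\<Sum>g\<in>carrier G. d g * cnj (S g))
      - (\<Sum>g\<in>carrier G. S g * cnj (d g)) + (\<Sum>g\<in>carrier G. S g * cnj (S g))"
    by (simp add: algebra_simps sum.distrib sum_subtractf)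
  also have "\<dots> = of_real (real N * (real N - q))"
    by (simp add: dd dS Sd SS algebra_simps)
  finally have "real N * (real N - q) = (\<Sum>g\<in>carrier G. (cmod (d g - S g))\<^sup>2)"
    using of_real_eq_iff by metis
  also have "\<dots> \<ge> 0" by (rule sum_nonneg) simp
  finally show ?thesis using N by (simp add: zero_le_mult_iff q_def N_def)
qed

lemma finite_Irr: "finite (Irr G)"
proof -
  have "card F \<le> card (carrier G)" if F: "F \<subseteq> Irr G" "finite F" for F
  proof -
    have "1 \<le> (cmod (\<chi> \<one>))\<^sup>2" if "\<chi> \<in> F" for \<chi>
    proof -
      from that F obtain n where "n > 0" "\<chi> \<one> = of_nat n" using Irr_one by blast
      then show ?thesis by (simp add: one_le_power)
    qed
    then have "(\<Sum>\<chi>\<in>F. 1) \<le> (\<Sum>\<chi>\<in>F. (cmod (\<chi> \<one>))\<^sup>2)" by (intro sum_mono) auto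
    also have "\<dots> \<le> card (carrier G)" by (rule sum_squares_degrees_le[OF F(2,1)])
    finally show ?thesis by simp
  qed
  then show ?thesis using finite_if_finite_subsets_card_bdd by blast
qed

section \<open>Class functions act by scalars\<close>

definition class_fun :: "('a \<Rightarrow> complex) \<Rightarrow> bool" where
  "class_fun a \<longleftrightarrow> (\<forall>g\<in>carrier G. \<forall>h\<in>carrier G. a (g \<otimes> h) = a (h \<otimes> g))"

text \<open>
  The scalar \<open>\<omega>\<^sub>\<chi>(a)\<close> by which the element \<open>\<Sum>\<^sub>g a(g) g\<close> of the group algebra acts, provided that \<open>a\<close> is
  a class function.
\<close>

definition central_value :: "('a \<Rightarrow> complex) \<Rightarrow> ('a \<Rightarrow> complex) \<Rightarrow> complex" where
  "central_value \<chi> a = (\<Sum>g\<in>carrier G. a g * \<chi> g) / \<chi> \<one>"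

lemma mat_sum_class_fun_commute:
  assumes \<rho>: "\<rho> \<in> hom G (GL n)" and a: "class_fun a" and h: "h \<in> carrier G"
  shows "\<rho> h * mat_sum n n (\<lambda>g. a g \<cdot>\<^sub>m \<rho> g) (carrier G) = mat_sum n n (\<lambda>g. a g \<cdot>\<^sub>m \<rho> g) (carrier G) * \<rho> h"
proof -
  note c = rep_carrier[OF \<rho>]
  have "\<rho> h * mat_sum n n (\<lambda>g. a g \<cdot>\<^sub>m \<rho> g) (carrier G) = mat_sum n n (\<lambda>g. \<rho> h * (a g \<cdot>\<^sub>m \<rho> g)) (carrier G)"
    by (rule mat_mult_mat_sum[OF c[OF h]]) (use c in auto)
  also have "\<dots> = mat_sum n n (\<lambda>g. a (inv h \<otimes> (h \<otimes> g)) \<cdot>\<^sub>m \<rho> (h \<otimes> g)) (carrier G)"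
  proof (rule mat_sum_cong)
    fix g assume g: "g \<in> carrier G"
    then show "\<rho> h * (a g \<cdot>\<^sub>m \<rho> g) = a (inv h \<otimes> (h \<otimes> g)) \<cdot>\<^sub>m \<rho> (h \<otimes> g)"
      using mult_smult_distrib[OF c[OF h] c[OF g]] h by (simp add: rep_mult[OF \<rho>] m_assoc[symmetric])
  qed
  also have "\<dots> = mat_sum n n (\<lambda>g. a (inv h \<otimes> g) \<cdot>\<^sub>m \<rho> g) (carrier G)"
    by (rule mat_sum_reindex[OF bij_betw_mult_left[OF h]])
  also have "\<dots> = mat_sum n n (\<lambda>g. a (g \<otimes> inv h) \<cdot>\<^sub>m \<rho> g) (carrier G)"
    using a h by (intro mat_sum_cong) (simp add: class_fun_def)
  also have "\<dots> = mat_sum n n (\<lambda>g. a (g \<otimes> h \<otimes> inv h) \<cdot>\<^sub>m \<rho> (g \<otimes> h)) (carrier G)"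
    by (rule mat_sum_reindex[OF bij_betw_mult_right[OF h], symmetric])
  also have "\<dots> = mat_sum n n (\<lambda>g. (a g \<cdot>\<^sub>m \<rho> g) * \<rho> h) (carrier G)"
  proof (rule mat_sum_cong)
    fix g assume g: "g \<in> carrier G"
    then show "a (g \<otimes> h \<otimes> inv h) \<cdot>\<^sub>m \<rho> (g \<otimes> h) = (a g \<cdot>\<^sub>m \<rho> g) * \<rho> h"
      using mult_smult_assoc_mat[OF c[OF g] c[OF h]] h by (simp add: rep_mult[OF \<rho>] m_assoc)
  qed
  also have "\<dots> = mat_sum n n (\<lambda>g. a g \<cdot>\<^sub>m \<rho> g) (carrier G) * \<rho> h"
    by (rule mat_sum_mult_mat[OF c[OF h], symmetric]) (use c in auto)
  finally show ?thesis .
qed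

lemma mat_sum_class_fun_scalar:
  assumes irr: "irreducible_rep G n \<rho>" and a: "class_fun a"
  shows "mat_sum n n (\<lambda>g. a g \<cdot>\<^sub>m \<rho> g) (carrier G) =
    ((\<Sum>g\<in>carrier G. a g * mat_trace n (\<rho> g)) / of_nat n) \<cdot>\<^sub>m 1\<^sub>m n"
proof -
  note \<rho> = irreducible_repD[OF irr]
  let ?Z = "mat_sum n n (\<lambda>g. a g \<cdot>\<^sub>m \<rho> g) (carrier G)"
  obtain c where c: "?Z = c \<cdot>\<^sub>m 1\<^sub>m n"
    by (rule Schur_scalar[OF irr mat_sum_carrier mat_sum_class_fun_commute[OF \<rho>(1) a]])
  have "c * of_nat n = mat_trace n ?Z" by (simp add: c)
  also have "\<dots> = (\<Sum>g\<in>carrier G. a g * mat_trace n (\<rho> g))"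
    by (simp add: mat_trace_mat_sum rep_carrier[OF \<rho>(1)])
  finally have "c = (\<Sum>g\<in>carrier G. a g * mat_trace n (\<rho> g)) / of_nat n"
    using \<rho>(2) by (simp add: field_simps)
  with c show ?thesis by simp
qed

text \<open>
  Read as a statement on the vector \<open>(\<chi>(x))\<^sub>x\<close>, this says that \<open>\<chi>\<close> is an eigenvector of the
  multiplication by \<open>a\<close>. Both the multiplicativity and the integrality of central characters follow
  from it.
\<close>

lemma class_fun_times_character:
  assumes \<chi>: "\<chi> \<in> Irr G" and a: "class_fun a" and x: "x \<in> carrier G"
  shows "(\<Sum>y\<in>carrier G. a y * \<chi> (x \<otimes> y)) = central_value \<chi> a * \<chi> x"
proof -
  from \<chi> obtain n \<rho> where irr: "irreducible_rep G n \<rho>"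
    and \<chi>t: "\<And>g. g \<in> carrier G \<Longrightarrow> \<chi> g = mat_trace n (\<rho> g)" by (rule IrrE) blast
  note \<rho> = irreducible_repD(1)[OF irr]
  note c = rep_carrier[OF \<rho>]
  have cv: "central_value \<chi> a = (\<Sum>g\<in>carrier G. a g * mat_trace n (\<rho> g)) / of_nat n"
    unfolding central_value_def by (simp add: \<chi>t rep_one[OF \<rho>])
  have "(\<Sum>y\<in>carrier G. a y * \<chi> (x \<otimes> y)) = (\<Sum>y\<in>carrier G. mat_trace n (\<rho> x * (a y \<cdot>\<^sub>m \<rho> y)))"
    using x mult_smult_distrib[OF c c] mat_trace_smult[OF mult_carrier_mat[OF c c]]
    by (intro sum.cong refl) (simp add: \<chi>t rep_mult[OF \<rho>])
  also have "\<dots> = mat_trace n (\<rho> x * mat_sum n n (\<lambda>g. a g \<cdot>\<^sub>m \<rho> g) (carrier G))"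
    using c x by (subst mat_mult_mat_sum[of _ n n]) (auto simp: mat_trace_mat_sum)
  also have "\<dots> = mat_trace n (central_value \<chi> a \<cdot>\<^sub>m \<rho> x)"
    using mult_smult_distrib[OF c[OF x] one_carrier_mat] c[OF x]
    by (simp add: mat_sum_class_fun_scalar[OF irr a] cv)
  also have "\<dots> = central_value \<chi> a * \<chi> x" using x c by (simp add: \<chi>t)
  finally show ?thesis .
qed

definition convolution :: "('a \<Rightarrow> complex) \<Rightarrow> ('a \<Rightarrow> complex) \<Rightarrow> 'a \<Rightarrow> complex" where
  "convolution a b g = (\<Sum>x\<in>carrier G. a x * b (inv x \<otimes> g))"

lemma central_value_convolution:
  assumes \<chi>: "\<chi> \<in> Irr G" and b: "class_fun b"
  shows "central_value \<chi> (convolution a b) = central_value \<chi> a * central_value \<chi> b"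
proof -
  have "(\<Sum>g\<in>carrier G. convolution a b g * \<chi> g)
      = (\<Sum>x\<in>carrier G. \<Sum>g\<in>carrier G. a x * (b (inv x \<otimes> g) * \<chi> g))"
    unfolding convolution_def by (subst sum.swap) (simp add: sum_distrib_right mult.assoc)
  also have "\<dots> = (\<Sum>x\<in>carrier G. a x * (\<Sum>y\<in>carrier G. b y * \<chi> (x \<otimes> y)))"
  proof (intro sum.cong refl)
    fix x assume x: "x \<in> carrier G"
    have "(\<Sum>g\<in>carrier G. b (inv x \<otimes> g) * \<chi> g) = (\<Sum>y\<in>carrier G. b (inv x \<otimes> (x \<otimes> y)) * \<chi> (x \<otimes> y))"
      by (rule sum.reindex_bij_betw[OF bij_betw_mult_left[OF x], symmetric])
    also have "\<dots> = (\<Sum>y\<in>carrier G. b y * \<chi> (x \<otimes> y))"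
      using x by (intro sum.cong refl) (simp add: m_assoc[symmetric])
    finally show "(\<Sum>g\<in>carrier G. a x * (b (inv x \<otimes> g) * \<chi> g)) = a x * (\<Sum>y\<in>carrier G. b y * \<chi> (x \<otimes> y))"
      by (simp only: sum_distrib_left[symmetric])
  qed
  also have "\<dots> = (\<Sum>x\<in>carrier G. a x * (central_value \<chi> b * \<chi> x))"
    by (intro sum.cong refl) (simp add: class_fun_times_character[OF \<chi> b])
  also have "\<dots> = central_value \<chi> b * (\<Sum>x\<in>carrier G. a x * \<chi> x)"
    by (simp add: sum_distrib_left mult_ac)
  finally show ?thesis by (simp add: central_value_def)
qed

lemma class_fun_convolution:
  assumes a: "class_fun a" and b: "class_fun b"
  shows "class_fun (convolution a b)"
  unfolding class_fun_def
proof (intro ballI)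
  fix g h assume gh: "g \<in> carrier G" "h \<in> carrier G"
  have bij: "bij_betw (\<lambda>x. h \<otimes> x \<otimes> inv h) (carrier G) (carrier G)"
    using gh by (intro bij_betwI[of _ _ _ "\<lambda>x. inv h \<otimes> x \<otimes> h"]) (auto simp: m_assoc, (simp add: m_assoc[symmetric])+)
  have "convolution a b (h \<otimes> g) = (\<Sum>x\<in>carrier G. a (h \<otimes> x \<otimes> inv h) * b (inv (h \<otimes> x \<otimes> inv h) \<otimes> (h \<otimes> g)))"
    unfolding convolution_def by (rule sum.reindex_bij_betw[OF bij, symmetric])
  also have "\<dots> = (\<Sum>x\<in>carrier G. a x * b (inv x \<otimes> (g \<otimes> h)))"
  proof (intro sum.cong refl)
    fix x assume x: "x \<in> carrier G"
    have "a (h \<otimes> x \<otimes> inv h) = a (inv h \<otimes> (h \<otimes> x))"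
      using a x gh by (simp add: class_fun_def)
    moreover have "inv (h \<otimes> x \<otimes> inv h) \<otimes> (h \<otimes> g) = h \<otimes> (inv x \<otimes> g)"
      using x gh by (simp add: inv_mult_group m_assoc) (simp add: m_assoc[symmetric])
    moreover have "b (h \<otimes> (inv x \<otimes> g)) = b (inv x \<otimes> g \<otimes> h)"
      using b x gh by (simp add: class_fun_def)
    ultimately show "a (h \<otimes> x \<otimes> inv h) * b (inv (h \<otimes> x \<otimes> inv h) \<otimes> (h \<otimes> g)) = a x * b (inv x \<otimes> (g \<otimes> h))"
      using x gh by (simp add: m_assoc[symmetric])
  qed
  finally show "convolution a b (g \<otimes> h) = convolution a b (h \<otimes> g)" by (simp add: convolution_def)
qed

end

section \<open>Irreducible subrepresentations\<close>

lemma factor_through_range: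
  fixes Q X :: "complex mat"
  assumes Q: "Q \<in> carrier_mat n d" and X: "X \<in> carrier_mat n k"
    and sub: "\<And>v. v \<in> carrier_vec k \<Longrightarrow> X *\<^sub>v v \<in> (*\<^sub>v) Q ` carrier_vec d"
  obtains S where "S \<in> carrier_mat d k" "X = Q * S"
proof -
  have "\<exists>s. s \<in> carrier_vec d \<and> X *\<^sub>v unit_vec k j = Q *\<^sub>v s" for j
    using sub[OF unit_vec_carrier] by blast
  then obtain s where s: "\<And>j. s j \<in> carrier_vec d" "\<And>j. X *\<^sub>v unit_vec k j = Q *\<^sub>v s j" by metis
  define S where "S = mat d k (\<lambda>(i, j). s j $ i)"
  have S: "S \<in> carrier_mat d k" by (simp add: S_def)
  have "X = Q * S"
  proof (rule eq_matI)
    fix i j assume "i < dim_row (Q * S)" "j < dim_col (Q * S)"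
    then have ij: "i < n" "j < k" using Q S by auto
    have "X $$ (i, j) = (X *\<^sub>v unit_vec k j) $ i" using ij X by simp
    also have "\<dots> = (\<Sum>l<d. Q $$ (i, l) * s j $ l)"
      unfolding s(2) by (rule mat_vec_index[OF Q s(1) ij(1)])
    also have "\<dots> = (\<Sum>l<d. Q $$ (i, l) * S $$ (l, j))"
      using ij by (intro sum.cong refl) (simp add: S_def)
    also have "\<dots> = (Q * S) $$ (i, j)" by (rule mat_mult_index[OF Q S ij, symmetric])
    finally show "X $$ (i, j) = (Q * S) $$ (i, j)" .
  qed (use Q X S in auto)
  with S show ?thesis by (rule that)
qed

lemma injective_mat_cancel:
  assumes Q: "Q \<in> carrier_mat n d" and inj: "injective_mat Q"
    and X: "X \<in> carrier_mat d k" and Y: "Y \<in> carrier_mat d k" and eq: "Q * X = Q * Y"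
  shows "X = Y"
proof -
  have XY: "X - Y \<in> carrier_mat d k" using X Y by auto
  have "Q * (X - Y) = 0\<^sub>m n k"
    using mult_minus_distrib_mat[OF Q X Y] eq minus_r_inv_mat[OF mult_carrier_mat[OF Q Y]] by simp
  then have z: "Q *\<^sub>v ((X - Y) *\<^sub>v v) = 0\<^sub>v n" if "v \<in> carrier_vec k" for v
  proof -
    have "0\<^sub>m n k *\<^sub>v v = (0\<^sub>v n :: complex vec)" using that by (intro eq_vecI) auto
    moreover have "Q *\<^sub>v ((X - Y) *\<^sub>v v) = Q * (X - Y) *\<^sub>v v"
      by (rule assoc_mult_mat_vec[OF Q XY that, symmetric])
    ultimately show ?thesis using \<open>Q * (X - Y) = 0\<^sub>m n k\<close> by simp
  qed
  have "X - Y = 0\<^sub>m d k"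
  proof (rule mat_eqI_vec[OF XY])
    fix v :: "complex vec" assume v: "v \<in> carrier_vec k"
    have "(X - Y) *\<^sub>v v = 0\<^sub>v d"
      by (rule injective_matD[OF inj Q mult_mat_vec_carrier[OF XY v] z[OF v]])
    moreover have "0\<^sub>m d k *\<^sub>v v = (0\<^sub>v d :: complex vec)" using v by (intro eq_vecI) auto
    ultimately show "(X - Y) *\<^sub>v v = 0\<^sub>m d k *\<^sub>v v" by simp
  qed simp
  then have "X $$ (i, j) = Y $$ (i, j)" if "i < d" "j < k" for i j
    using that X Y index_minus_mat(1)[of i Y j X] by simp
  then show ?thesis using X Y by (intro eq_matI) auto
qed

lemma injective_mat_mult:
  assumes Q: "Q \<in> carrier_mat n d" "injective_mat Q" and P: "P \<in> carrier_mat d k" "injective_mat P"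
  shows "injective_mat (Q * P)"
  unfolding injective_mat_def
proof (intro ballI impI)
  fix v assume v: "v \<in> carrier_vec (dim_col (Q * P))" and z: "Q * P *\<^sub>v v = 0\<^sub>v (dim_row (Q * P))"
  from v P have v: "v \<in> carrier_vec k" by simp
  have "Q *\<^sub>v (P *\<^sub>v v) = 0\<^sub>v n" using z Q P v by simp
  then have "P *\<^sub>v v = 0\<^sub>v d" using injective_matD[OF Q(2,1)] P v by simp
  then show "v = 0\<^sub>v (dim_col (Q * P))" using injective_matD[OF P(2,1) v] P by simp
qed

context finite_group
begin

text \<open>
  An irreducible subrepresentation sits on an invariant subspace of least positive dimension. It is
  returned as a matrix representation \<open>\<sigma>\<close> together with an embedding \<open>Q\<close> of its space.
\<close>

lemma irreducible_subrep:
  assumes R: "R \<in> hom G (GL n)" and W: "VectorSpace.subspace class_ring W (module_vec TYPE(complex) n)"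
    and inv: "\<And>g w. g \<in> carrier G \<Longrightarrow> w \<in> W \<Longrightarrow> R g *\<^sub>v w \<in> W" and nz: "W \<noteq> {0\<^sub>v n}"
  obtains d \<sigma> Q where "irreducible_rep G d \<sigma>" "Q \<in> carrier_mat n d" "injective_mat Q"
    "(*\<^sub>v) Q ` carrier_vec d \<subseteq> W" "\<And>g. g \<in> carrier G \<Longrightarrow> R g * Q = Q * \<sigma> g"
proof -
  note c = rep_carrier[OF R]
  define P where "P d Q \<longleftrightarrow> d > 0 \<and> Q \<in> carrier_mat n d \<and> injective_mat Q \<and> (*\<^sub>v) Q ` carrier_vec d \<subseteq> W \<and>
      (\<forall>g\<in>carrier G. \<exists>S. S \<in> carrier_mat d d \<and> R g * Q = Q * S)" for d Q
  have "\<exists>d Q. P d Q"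
  proof -
    obtain d Q where Q: "Q \<in> carrier_mat n d" "injective_mat Q" "(*\<^sub>v) Q ` carrier_vec d = W"
      using subspace_mat_basis[OF W] by metis
    have "d > 0"
    proof (rule ccontr)
      assume "\<not> d > 0"
      then have "Q *\<^sub>v v = 0\<^sub>v n" if "v \<in> carrier_vec d" for v
        using that Q(1) by (intro eq_vecI) (auto simp: scalar_prod_def)
      then have "W \<subseteq> {0\<^sub>v n}" using Q(3) by blast
      then have "W = {0\<^sub>v n}" using subspace_vecD(2)[OF W] by blast
      then show False using nz by simp
    qed
    moreover have "\<exists>S. S \<in> carrier_mat d d \<and> R g * Q = Q * S" if g: "g \<in> carrier G" for g
    proof -
      have "R g * Q *\<^sub>v v \<in> (*\<^sub>v) Q ` carrier_vec d" if v: "v \<in> carrier_vec d" for v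
        using inv[OF g, of "Q *\<^sub>v v"] assoc_mult_mat_vec[OF c[OF g] Q(1) v] v Q(3) by auto
      then show ?thesis
        using factor_through_range[OF Q(1) mult_carrier_mat[OF c[OF g] Q(1)]] by blast
    qed
    ultimately show ?thesis unfolding P_def using Q by blast
  qed
  \<comment> \<open>minimality of the dimension is what makes the subrepresentation irreducible\<close>
  define d where "d = (LEAST d. \<exists>Q. P d Q)"
  have "\<exists>Q. P d Q" unfolding d_def by (rule LeastI_ex) fact
  then obtain Q where PQ: "P d Q" by blast
  have least: "d \<le> d'" if "P d' Q'" for d' Q'
    unfolding d_def by (rule Least_le) (use that in blast)
  from PQ have d: "d > 0" and Q: "Q \<in> carrier_mat n d" "injective_mat Q" "(*\<^sub>v) Q ` carrier_vec d \<subseteq> W"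
    and ex: "\<forall>g\<in>carrier G. \<exists>S. S \<in> carrier_mat d d \<and> R g * Q = Q * S"
    unfolding P_def by auto
  from ex obtain \<sigma> where \<sigma>: "\<And>g. g \<in> carrier G \<Longrightarrow> \<sigma> g \<in> carrier_mat d d"
      "\<And>g. g \<in> carrier G \<Longrightarrow> R g * Q = Q * \<sigma> g" by metis
  have hom: "\<sigma> \<in> hom G (GL d)"
  proof (rule rep_homI)
    show "\<sigma> g \<in> carrier_mat d d" if "g \<in> carrier G" for g using \<sigma>(1) that .
    show "\<sigma> \<one> = 1\<^sub>m d"
    proof (rule injective_mat_cancel[OF Q(1,2) \<sigma>(1)])
      show "Q * \<sigma> \<one> = Q * 1\<^sub>m d" using \<sigma>(2)[of \<one>] Q(1) by (simp add: rep_one[OF R])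
    qed auto
    fix g h assume gh: "g \<in> carrier G" "h \<in> carrier G"
    show "\<sigma> (g \<otimes> h) = \<sigma> g * \<sigma> h"
    proof (rule injective_mat_cancel[OF Q(1,2) \<sigma>(1)])
      have "Q * \<sigma> (g \<otimes> h) = R g * R h * Q" using \<sigma>(2)[of "g \<otimes> h"] gh by (simp add: rep_mult[OF R])
      also have "\<dots> = R g * (Q * \<sigma> h)" using assoc_mult_mat[OF c[OF gh(1)] c[OF gh(2)] Q(1)] \<sigma>(2) gh by simp
      also have "\<dots> = Q * \<sigma> g * \<sigma> h" using assoc_mult_mat[OF c[OF gh(1)] Q(1) \<sigma>(1)[OF gh(2)]] \<sigma>(2) gh by simp
      also have "\<dots> = Q * (\<sigma> g * \<sigma> h)" by (rule assoc_mult_mat[OF Q(1) \<sigma>(1) \<sigma>(1)]) (use gh in auto)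
      finally show "Q * \<sigma> (g \<otimes> h) = Q * (\<sigma> g * \<sigma> h)" .
    qed (use gh \<sigma>(1) mult_carrier_mat in blast)+
  qed
  have "irreducible_rep G d \<sigma>"
    unfolding irreducible_rep_def
  proof (intro conjI allI impI)
    fix U assume U: "VectorSpace.subspace class_ring U (module_vec TYPE(complex) d)"
      and Uinv: "\<forall>g\<in>carrier G. \<forall>w\<in>U. \<sigma> g *\<^sub>v w \<in> U"
    show "U = {0\<^sub>v d} \<or> U = carrier_vec d"
    proof (rule ccontr)
      assume no: "\<not> (U = {0\<^sub>v d} \<or> U = carrier_vec d)"
      obtain k P' where P': "P' \<in> carrier_mat d k" "injective_mat P'" "(*\<^sub>v) P' ` carrier_vec k = U"
        "U \<noteq> carrier_vec d \<Longrightarrow> k < d" using subspace_mat_basis[OF U] by metis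
      have "k > 0"
      proof (rule ccontr)
        assume "\<not> k > 0"
        then have "P' *\<^sub>v v = 0\<^sub>v d" if "v \<in> carrier_vec k" for v
          using that P'(1) by (intro eq_vecI) (auto simp: scalar_prod_def)
        then have "U \<subseteq> {0\<^sub>v d}" using P'(3) by blast
        then have "U = {0\<^sub>v d}" using subspace_vecD(2)[OF U] by blast
        then show False using no by simp
      qed
      have "\<exists>S. S \<in> carrier_mat k k \<and> R g * (Q * P') = Q * P' * S" if g: "g \<in> carrier G" for g
      proof -
        have "\<sigma> g * P' *\<^sub>v v \<in> (*\<^sub>v) P' ` carrier_vec k" if v: "v \<in> carrier_vec k" for v
          using Uinv g assoc_mult_mat_vec[OF \<sigma>(1)[OF g] P'(1) v] v P'(3) by auto
        then obtain S where S: "S \<in> carrier_mat k k" "\<sigma> g * P' = P' * S"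
          using factor_through_range[OF P'(1) mult_carrier_mat[OF \<sigma>(1)[OF g] P'(1)]] by blast
        have "R g * (Q * P') = Q * \<sigma> g * P'"
          using assoc_mult_mat[OF c[OF g] Q(1) P'(1)] \<sigma>(2)[OF g] by simp
        also have "\<dots> = Q * P' * S"
          using assoc_mult_mat[OF Q(1) \<sigma>(1)[OF g] P'(1)] assoc_mult_mat[OF Q(1) P'(1) S(1)] S(2) by simp
        finally show ?thesis using S by blast
      qed
      moreover have "(*\<^sub>v) (Q * P') ` carrier_vec k \<subseteq> W"
      proof
        fix x assume "x \<in> (*\<^sub>v) (Q * P') ` carrier_vec k"
        then obtain v where v: "v \<in> carrier_vec k" "x = Q * P' *\<^sub>v v" by blast
        then have "x = Q *\<^sub>v (P' *\<^sub>v v)" using assoc_mult_mat_vec[OF Q(1) P'(1) v(1)] by simp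
        then show "x \<in> W" using Q(3) mult_mat_vec_carrier[OF P'(1) v(1)] by blast
      qed
      ultimately have "P k (Q * P')"
        unfolding P_def using \<open>k > 0\<close> mult_carrier_mat[OF Q(1) P'(1)] injective_mat_mult[OF Q(1,2) P'(1,2)] by blast
      from least[OF this] P'(4) no show False by simp
    qed
  qed (use hom d in auto)
  with Q \<sigma>(2) show ?thesis by (intro that)
qed

section \<open>Column orthogonality\<close>

lemma hermitian_mat_square_kernel:
  assumes A: "A \<in> carrier_mat n n" "mat_adj n A = A" and v: "v \<in> carrier_vec n"
    and z: "A *\<^sub>v (A *\<^sub>v v) = 0\<^sub>v n"
  shows "A *\<^sub>v v = 0\<^sub>v n"
proof -
  have "of_real (\<Sum>k<n. (cmod ((A *\<^sub>v v) $ k))\<^sup>2) = (0 :: complex)"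
    unfolding mat_adj_mult_self_form[OF A(1) v, symmetric] A(2)
    using z assoc_mult_mat_vec[OF A(1) A(1) v] by simp
  then have "(\<Sum>k<n. (cmod ((A *\<^sub>v v) $ k))\<^sup>2) = 0" by (simp only: of_real_eq_0_iff)
  then have "(A *\<^sub>v v) $ k = 0" if "k < n" for k
    using that by (simp add: sum_nonneg_eq_0_iff)
  then show ?thesis using A v by (intro eq_vecI) auto
qed

text \<open>
  Let \<open>A\<close> be the matrix of \<open>\<Sum>\<^sub>x f(x) x\<close> in the regular representation. It is Hermitian, and it commutes
  with the group, so that its range is invariant and contains an irreducible subrepresentation unless
  \<open>A = 0\<close>. There \<open>A\<close> acts by a scalar, which vanishes since \<open>f\<close> is orthogonal to the characters. But
  a Hermitian matrix is injective on its range. The argument replaces complete reducibility of the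
  regular representation.
\<close>

lemma class_fun_zeroI:
  assumes f: "class_fun f" and herm: "\<And>g. g \<in> carrier G \<Longrightarrow> f (inv g) = cnj (f g)"
    and orth: "\<And>\<chi>. \<chi> \<in> Irr G \<Longrightarrow> (\<Sum>g\<in>carrier G. f g * \<chi> g) = 0"
    and g: "g \<in> carrier G"
  shows "f g = 0"
proof (rule ccontr)
  assume fg: "f g \<noteq> 0"
  define N where "N = card (carrier G)"
  obtain e where e: "bij_betw e {..<N} (carrier G)"
    using ex_bij_betw_nat_finite[OF fin] unfolding N_def atLeast0LessThan by blast
  have ec: "e i \<in> carrier G" if "i < N" for i using e that by (auto dest: bij_betwE)
  have esum: "(\<Sum>i<N. h (e i)) = (\<Sum>x\<in>carrier G. h x)" for h :: "'a \<Rightarrow> complex"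
    by (rule sum.reindex_bij_betw[OF e])
  have einj: "e i = e j \<longleftrightarrow> i = j" if "i < N" "j < N" for i j
    using e that by (auto simp: bij_betw_def inj_on_def)
  \<comment> \<open>the regular representation, with the group elements listed by \<open>e\<close>\<close>
  define R where "R x = mat N N (\<lambda>(i, j). if e i = x \<otimes> e j then 1 else 0 :: complex)" for x
  define A where "A = mat N N (\<lambda>(i, j). f (e i \<otimes> inv (e j)))"
  have A: "A \<in> carrier_mat N N" and Rc: "R x \<in> carrier_mat N N" for x by (simp_all add: A_def R_def)
  have delta: "(\<Sum>y\<in>carrier G. (if y = x then h y else 0)) = h x" if "x \<in> carrier G"
    for x and h :: "'a \<Rightarrow> complex" using fin that by simp
  have hom: "R \<in> hom G (GL N)"
  proof (rule rep_homI)
    show "R \<one> = 1\<^sub>m N" by (rule eq_matI) (auto simp: R_def einj ec)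
    fix x y assume xy: "x \<in> carrier G" "y \<in> carrier G"
    show "R (x \<otimes> y) = R x * R y"
    proof (rule eq_matI)
      fix i j assume "i < dim_row (R x * R y)" "j < dim_col (R x * R y)"
      then have ij: "i < N" "j < N" using Rc by (auto simp: R_def)
      have "(R x * R y) $$ (i, j) = (\<Sum>l<N. R x $$ (i, l) * R y $$ (l, j))"
        by (rule mat_mult_index[OF Rc Rc ij])
      also have "\<dots> = (\<Sum>l<N. if e l = y \<otimes> e j then (if e i = x \<otimes> e l then 1 else 0) else 0)"
        using ij by (intro sum.cong refl) (auto simp: R_def)
      also have "\<dots> = (if e i = x \<otimes> (y \<otimes> e j) then 1 else 0)"
        using xy ij ec by (subst esum[of "\<lambda>z. if z = y \<otimes> e j then (if e i = x \<otimes> z then 1 else 0) else 0"])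
          (simp add: delta)
      finally show "R (x \<otimes> y) $$ (i, j) = (R x * R y) $$ (i, j)"
        using ij xy ec by (simp add: R_def m_assoc)
    qed (auto simp: R_def)
  qed (rule Rc)
  have A_sum: "A = mat_sum N N (\<lambda>x. f x \<cdot>\<^sub>m R x) (carrier G)"
  proof (rule eq_matI)
    fix i j assume "i < dim_row (mat_sum N N (\<lambda>x. f x \<cdot>\<^sub>m R x) (carrier G))"
      "j < dim_col (mat_sum N N (\<lambda>x. f x \<cdot>\<^sub>m R x) (carrier G))"
    then have ij: "i < N" "j < N" by (auto simp: mat_sum_def)
    have "mat_sum N N (\<lambda>x. f x \<cdot>\<^sub>m R x) (carrier G) $$ (i, j) =
        (\<Sum>x\<in>carrier G. if x = e i \<otimes> inv (e j) then f x else 0)"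
      using ij ec[OF ij(1)] ec[OF ij(2)]
      by (simp, intro sum.cong refl) (auto simp: R_def inv_solve_right m_assoc)
    also have "\<dots> = f (e i \<otimes> inv (e j))" using ij ec by (simp add: delta)
    finally show "A $$ (i, j) = mat_sum N N (\<lambda>x. f x \<cdot>\<^sub>m R x) (carrier G) $$ (i, j)"
      using ij by (simp add: A_def)
  qed (auto simp: A_def mat_sum_def)
  have adj: "mat_adj N A = A"
  proof (rule eq_matI)
    fix i j assume "i < dim_row A" "j < dim_col A"
    then have ij: "i < N" "j < N" by (auto simp: A_def)
    have "cnj (f (e j \<otimes> inv (e i))) = f (inv (e j \<otimes> inv (e i)))" using ij ec by (simp add: herm)
    also have "inv (e j \<otimes> inv (e i)) = e i \<otimes> inv (e j)" using ij ec by (simp add: inv_mult_group)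
    finally show "mat_adj N A $$ (i, j) = A $$ (i, j)" using ij by (simp add: mat_adj_def A_def)
  qed (auto simp: mat_adj_def A_def)
  define W where "W = (*\<^sub>v) A ` carrier_vec N"
  have Wsub: "VectorSpace.subspace class_ring W (module_vec TYPE(complex) N)"
  proof (rule subspace_vecI)
    show "W \<subseteq> carrier_vec N" using A by (auto simp: W_def)
    have "A *\<^sub>v 0\<^sub>v N = 0\<^sub>v N" using A by auto
    then show "0\<^sub>v N \<in> W" unfolding W_def by (metis image_eqI zero_carrier_vec)
    show "v + w \<in> W" if "v \<in> W" "w \<in> W" for v w
      using that unfolding W_def by (auto simp: mult_add_distrib_mat_vec[OF A, symmetric])
    show "k \<cdot>\<^sub>v w \<in> W" if "w \<in> W" for k w
      using that unfolding W_def by (auto simp: mult_mat_vec[OF A, symmetric])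
  qed
  have Winv: "R x *\<^sub>v w \<in> W" if x: "x \<in> carrier G" and w: "w \<in> W" for x w
  proof -
    obtain v where v: "v \<in> carrier_vec N" "w = A *\<^sub>v v" using w by (auto simp: W_def)
    have "R x *\<^sub>v w = R x * A *\<^sub>v v" using v assoc_mult_mat_vec[OF Rc A v(1)] by simp
    also have "R x * A = A * R x" unfolding A_sum by (rule mat_sum_class_fun_commute[OF hom f x])
    also have "A * R x *\<^sub>v v = A *\<^sub>v (R x *\<^sub>v v)" by (rule assoc_mult_mat_vec[OF A Rc v(1)])
    finally show ?thesis using mult_mat_vec_carrier[OF Rc v(1)] by (simp add: W_def)
  qed
  have Wnz: "W \<noteq> {0\<^sub>v N}"
  proof
    assume "W = {0\<^sub>v N}"
    have surj: "\<exists>i<N. e i = x" if "x \<in> carrier G" for x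
      using that bij_betw_imp_surj_on[OF e] by (metis imageE lessThan_iff)
    obtain i where i: "i < N" "e i = g" using surj[OF g] by blast
    obtain j where j: "j < N" "e j = \<one>" using surj[OF one_closed] by blast
    have "A *\<^sub>v unit_vec N j = 0\<^sub>v N" using \<open>W = {0\<^sub>v N}\<close> unfolding W_def by auto
    then have "(A *\<^sub>v unit_vec N j) $ i = 0" using i by simp
    then have "A $$ (i, j) = 0" using i j A by simp
    then show False using fg i j g by (simp add: A_def)
  qed
  obtain d \<sigma> Q where irr: "irreducible_rep G d \<sigma>" and Q: "Q \<in> carrier_mat N d" "injective_mat Q"
    "(*\<^sub>v) Q ` carrier_vec d \<subseteq> W" "\<And>x. x \<in> carrier G \<Longrightarrow> R x * Q = Q * \<sigma> x"
    using irreducible_subrep[OF hom Wsub Winv Wnz] by metis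
  note \<sigma> = irreducible_repD(1,2)[OF irr]
  have "character_of G d \<sigma> \<in> Irr G" using irr unfolding Irr_def by blast
  from orth[OF this] have "(\<Sum>x\<in>carrier G. f x * mat_trace d (\<sigma> x)) = 0"
    by (simp add: character_of_eq)
  with mat_sum_class_fun_scalar[OF irr f]
  have Z: "mat_sum d d (\<lambda>x. f x \<cdot>\<^sub>m \<sigma> x) (carrier G) = 0 \<cdot>\<^sub>m 1\<^sub>m d" by simp
  have "A * Q = mat_sum N d (\<lambda>x. (f x \<cdot>\<^sub>m R x) * Q) (carrier G)"
    unfolding A_sum by (rule mat_sum_mult_mat[OF Q(1)]) (simp add: Rc)
  also have "\<dots> = mat_sum N d (\<lambda>x. Q * (f x \<cdot>\<^sub>m \<sigma> x)) (carrier G)"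
    using mult_smult_assoc_mat[OF Rc Q(1)] mult_smult_distrib[OF Q(1) rep_carrier[OF \<sigma>(1)]] Q(4)
    by (intro mat_sum_cong) simp
  also have "\<dots> = Q * mat_sum d d (\<lambda>x. f x \<cdot>\<^sub>m \<sigma> x) (carrier G)"
    by (rule mat_mult_mat_sum[OF Q(1), symmetric]) (simp add: rep_carrier[OF \<sigma>(1)])
  finally have AQ: "A * Q = Q * (0 \<cdot>\<^sub>m 1\<^sub>m d)" by (simp add: Z)
  let ?u = "unit_vec d 0 :: complex vec"
  have u: "?u \<in> carrier_vec d" "?u \<noteq> 0\<^sub>v d" using \<sigma>(2) unit_vec_nonzero by auto
  then have Qu: "Q *\<^sub>v ?u \<noteq> 0\<^sub>v N" using injective_matD[OF Q(2,1)] by blast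
  obtain b where b: "b \<in> carrier_vec N" "Q *\<^sub>v ?u = A *\<^sub>v b"
    using Q(3) u(1) unfolding W_def by blast
  have "A *\<^sub>v (A *\<^sub>v b) = A * Q *\<^sub>v ?u" using assoc_mult_mat_vec[OF A Q(1) u(1)] b(2) by simp
  also have "\<dots> = Q *\<^sub>v ((0 \<cdot>\<^sub>m 1\<^sub>m d) *\<^sub>v ?u)"
    unfolding AQ by (rule assoc_mult_mat_vec[OF Q(1) _ u(1)]) simp
  also have "(0 \<cdot>\<^sub>m 1\<^sub>m d) *\<^sub>v ?u = 0\<^sub>v d" by (intro eq_vecI) auto
  also have "Q *\<^sub>v 0\<^sub>v d = 0\<^sub>v N" using Q(1) by auto
  finally have "A *\<^sub>v b = 0\<^sub>v N" by (rule hermitian_mat_square_kernel[OF A adj b(1)])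
  then show False using Qu b(2) by simp
qed

lemma Irr_one_real: "\<chi> \<in> Irr G \<Longrightarrow> cnj (\<chi> \<one>) = \<chi> \<one>"
  by (metis Irr_inv inv_one one_closed)

text \<open>
  The difference of the two sides, up to conjugation, is a class function orthogonal to all
  irreducible characters.
\<close>

lemma column_orthogonality:
  assumes g: "g \<in> carrier G"
  shows "(\<Sum>\<chi>\<in>Irr G. \<chi> \<one> * \<chi> g) = (if g = \<one> then of_nat (card (carrier G)) else 0)"
proof -
  define f where "f g = (if g = \<one> then of_nat (card (carrier G)) else 0) - (\<Sum>\<psi>\<in>Irr G. \<psi> \<one> * cnj (\<psi> g))" for g
  have "f g = 0"
  proof (rule class_fun_zeroI[OF _ _ _ g])
    show "class_fun f" unfolding class_fun_def
    proof (intro ballI)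
      fix x y assume xy: "x \<in> carrier G" "y \<in> carrier G"
      then have "x \<otimes> y = \<one> \<longleftrightarrow> y \<otimes> x = \<one>" using inv_comm by blast
      then show "f (x \<otimes> y) = f (y \<otimes> x)"
        using xy by (simp add: f_def Irr_mult_commute[of _ x y] cong: sum.cong)
    qed
    show "f (inv x) = cnj (f x)" if x: "x \<in> carrier G" for x
    proof -
      have "inv x = \<one> \<longleftrightarrow> x = \<one>" using x by (metis inv_inv inv_one)
      then show ?thesis using x by (simp add: f_def Irr_inv Irr_one_real cong: sum.cong)
    qed
    show "(\<Sum>x\<in>carrier G. f x * \<chi> x) = 0" if \<chi>: "\<chi> \<in> Irr G" for \<chi>
    proof -
      have "(\<Sum>x\<in>carrier G. (\<Sum>\<psi>\<in>Irr G. \<psi> \<one> * cnj (\<psi> x)) * \<chi> x)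
          = (\<Sum>\<psi>\<in>Irr G. \<psi> \<one> * (\<Sum>x\<in>carrier G. \<chi> x * cnj (\<psi> x)))"
        by (simp add: sum_distrib_right sum_distrib_left mult_ac) (rule sum.swap)
      also have "\<dots> = (\<Sum>\<psi>\<in>Irr G. if \<psi> = \<chi> then \<chi> \<one> * of_nat (card (carrier G)) else 0)"
        by (intro sum.cong refl) (simp add: Irr_orthogonal[OF \<chi>])
      also have "\<dots> = \<chi> \<one> * of_nat (card (carrier G))" using finite_Irr \<chi> by simp
      moreover have "(\<Sum>x\<in>carrier G. (if x = \<one> then of_nat (card (carrier G)) else 0) * \<chi> x)
          = \<chi> \<one> * of_nat (card (carrier G))"
      proof -
        have "(\<Sum>x\<in>carrier G. (if x = \<one> then of_nat (card (carrier G)) else 0) * \<chi> x)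
          = (\<Sum>x\<in>carrier G. if x = \<one> then \<chi> \<one> * of_nat (card (carrier G)) else 0)"
          by (intro sum.cong refl) auto
        then show ?thesis using fin by simp
      qed
      ultimately show ?thesis by (simp add: f_def left_diff_distrib sum_subtractf)
    qed
  qed
  then have "cnj (f g) = 0" by simp
  then have "(\<Sum>\<psi>\<in>Irr G. cnj (\<psi> \<one>) * \<psi> g) = (if g = \<one> then of_nat (card (carrier G)) else 0)"
    by (auto simp: f_def split: if_splits)
  then show ?thesis by (simp add: Irr_one_real cong: sum.cong)
qed

end

section \<open>Integrality of central characters\<close>

text \<open>
  The characteristic polynomial is monic with integer coefficients.
\<close>

lemma eigenvalue_int_mat_algebraic_int:
  fixes A :: "int mat" and c :: complex
  assumes A: "A \<in> carrier_mat n n" and v: "v \<in> carrier_vec n" "v \<noteq> 0\<^sub>v n"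
    and ev: "map_mat of_int A *\<^sub>v v = c \<cdot>\<^sub>v v"
  shows "algebraic_int c"
proof -
  have cA: "(map_mat of_int A :: complex mat) \<in> carrier_mat n n" using A by simp
  have "eigenvalue (map_mat of_int A) c"
    unfolding eigenvalue_def eigenvector_def using cA A v ev by auto
  then have "poly (map_poly of_int (char_poly A)) c = 0"
    using eigenvalue_root_char_poly[OF cA] by (simp add: of_int_hom.char_poly_hom[OF A])
  moreover have "lead_coeff (char_poly A) = 1" using degree_monic_char_poly[OF A] by simp
  ultimately show ?thesis unfolding algebraic_int_altdef_ipoly by blast
qed

context finite_group
begin

definition delta :: "'a \<Rightarrow> complex" where
  "delta g = (if g = \<one> then 1 else 0)"

definition class_indicator :: "'a \<Rightarrow> 'a \<Rightarrow> complex" where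
  "class_indicator g h = (if h \<in> conj_class G g then 1 else 0)"

lemma conj_class_subset: "g \<in> carrier G \<Longrightarrow> conj_class G g \<subseteq> carrier G"
  by (auto simp: conj_class_def)

lemma conj_class_conj:
  assumes "g \<in> carrier G" "h \<in> conj_class G g" "y \<in> carrier G"
  shows "y \<otimes> h \<otimes> inv y \<in> conj_class G g"
proof -
  obtain z where z: "z \<in> carrier G" "h = z \<otimes> g \<otimes> inv z" using assms(2) by (auto simp: conj_class_def)
  then have "y \<otimes> h \<otimes> inv y = (y \<otimes> z) \<otimes> g \<otimes> inv (y \<otimes> z)"
    using assms by (simp add: inv_mult_group m_assoc)
  then show ?thesis using z assms by (auto simp: conj_class_def)
qed

lemma class_fun_delta: "class_fun delta"
  unfolding class_fun_def delta_def using inv_comm by auto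

lemma class_fun_indicator:
  assumes g: "g \<in> carrier G"
  shows "class_fun (class_indicator g)"
proof -
  have "y \<otimes> x \<in> conj_class G g"
    if xy: "x \<in> carrier G" "y \<in> carrier G" "x \<otimes> y \<in> conj_class G g" for x y
    using conj_class_conj[OF g xy(3,2)] xy by (simp add: m_assoc)
  then show ?thesis unfolding class_fun_def class_indicator_def by metis
qed

lemma central_value_indicator:
  assumes \<chi>: "\<chi> \<in> Irr G" and g: "g \<in> carrier G"
  shows "central_value \<chi> (class_indicator g) = central_char G \<chi> g"
proof -
  have "\<chi> h = \<chi> g" if h: "h \<in> conj_class G g" for h
  proof -
    obtain z where z: "z \<in> carrier G" "h = z \<otimes> g \<otimes> inv z" using h by (auto simp: conj_class_def)
    then have "\<chi> h = \<chi> (inv z \<otimes> (z \<otimes> g))" using g \<chi> by (simp add: Irr_mult_commute)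
    then show ?thesis using z g by (simp add: m_assoc[symmetric])
  qed
  then have "(\<Sum>h\<in>conj_class G g. \<chi> h) = of_nat (card (conj_class G g)) * \<chi> g" by simp
  moreover have "(\<Sum>h\<in>carrier G. class_indicator g h * \<chi> h) = (\<Sum>h\<in>conj_class G g. \<chi> h)"
  proof -
    have "(\<Sum>h\<in>carrier G. class_indicator g h * \<chi> h) = (\<Sum>h\<in>carrier G. if h \<in> conj_class G g then \<chi> h else 0)"
      by (intro sum.cong refl) (simp add: class_indicator_def)
    also have "\<dots> = (\<Sum>h\<in>carrier G \<inter> conj_class G g. \<chi> h)" by (rule sum.inter_restrict[OF fin, symmetric])
    also have "carrier G \<inter> conj_class G g = conj_class G g" using conj_class_subset[OF g] by blast
    finally show ?thesis .
  qed
  ultimately show ?thesis by (simp add: central_value_def central_char_def)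
qed

lemma central_value_delta:
  assumes \<chi>: "\<chi> \<in> Irr G"
  shows "central_value \<chi> delta = 1"
proof -
  have "(\<Sum>h\<in>carrier G. delta h * \<chi> h) = (\<Sum>h\<in>carrier G. if h = \<one> then \<chi> \<one> else 0)"
    by (intro sum.cong refl) (simp add: delta_def)
  then show ?thesis using fin Irr_one_nz[OF \<chi>] by (simp add: central_value_def)
qed

text \<open>
  The values of \<open>\<chi>\<close> form an eigenvector of the multiplication by a class sum, which is given by a
  matrix with entries \<open>0\<close> and \<open>1\<close> with respect to the basis of group elements.
\<close>

lemma algebraic_int_central_char:
  assumes \<chi>: "\<chi> \<in> Irr G" and g: "g \<in> carrier G"
  shows "algebraic_int (central_char G \<chi> g)"
proof -
  define N where "N = card (carrier G)"
  obtain e where e: "bij_betw e {..<N} (carrier G)"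
    using ex_bij_betw_nat_finite[OF fin] unfolding N_def atLeast0LessThan by blast
  have ec: "e i \<in> carrier G" if "i < N" for i using e that by (auto dest: bij_betwE)
  define A where "A = mat N N (\<lambda>(i, j). if inv (e i) \<otimes> e j \<in> conj_class G g then 1 else 0 :: int)"
  define v where "v = vec N (\<lambda>i. \<chi> (e i))"
  have A: "A \<in> carrier_mat N N" and v: "v \<in> carrier_vec N" by (simp_all add: A_def v_def)
  obtain i where i: "i < N" "e i = \<one>"
    using bij_betw_imp_surj_on[OF e] one_closed by (metis imageE lessThan_iff)
  have "v $ i \<noteq> 0" using i Irr_one_nz[OF \<chi>] by (simp add: v_def)
  then have nz: "v \<noteq> 0\<^sub>v N" using i by auto
  have "map_mat of_int A *\<^sub>v v = central_char G \<chi> g \<cdot>\<^sub>v v"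
  proof (rule eq_vecI)
    fix i assume "i < dim_vec (central_char G \<chi> g \<cdot>\<^sub>v v)"
    then have i: "i < N" by (simp add: v_def)
    have "(map_mat of_int A *\<^sub>v v) $ i = (\<Sum>j<N. map_mat of_int A $$ (i, j) * v $ j)"
      by (rule mat_vec_index[OF _ v i]) (simp add: A)
    also have "\<dots> = (\<Sum>j<N. class_indicator g (inv (e i) \<otimes> e j) * \<chi> (e j))"
      using i by (intro sum.cong refl) (simp add: A_def v_def class_indicator_def)
    also have "\<dots> = (\<Sum>x\<in>carrier G. class_indicator g (inv (e i) \<otimes> x) * \<chi> x)"
      by (rule sum.reindex_bij_betw[OF e])
    also have "\<dots> = (\<Sum>y\<in>carrier G. class_indicator g (inv (e i) \<otimes> (e i \<otimes> y)) * \<chi> (e i \<otimes> y))"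
      by (rule sum.reindex_bij_betw[OF bij_betw_mult_left[OF ec[OF i]], symmetric])
    also have "\<dots> = (\<Sum>y\<in>carrier G. class_indicator g y * \<chi> (e i \<otimes> y))"
      using ec[OF i] by (intro sum.cong refl) (simp add: m_assoc[symmetric])
    also have "\<dots> = central_value \<chi> (class_indicator g) * \<chi> (e i)"
      by (rule class_fun_times_character[OF \<chi> class_fun_indicator[OF g] ec[OF i]])
    finally show "(map_mat of_int A *\<^sub>v v) $ i = (central_char G \<chi> g \<cdot>\<^sub>v v) $ i"
      using i by (simp add: v_def central_value_indicator[OF \<chi> g])
  qed (simp add: A_def v_def)
  then show ?thesis by (rule eigenvalue_int_mat_algebraic_int[OF A v nz])
qed

section \<open>The trivial character\<close>

lemma trivial_char_Irr: "trivial_char G \<in> Irr G"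
proof -
  have "irreducible_rep G 1 (\<lambda>_. 1\<^sub>m 1)"
    unfolding irreducible_rep_def
  proof (intro conjI allI impI)
    show "(\<lambda>_. 1\<^sub>m 1) \<in> hom G (GL 1)" by (rule rep_homI) auto
    fix W assume W: "VectorSpace.subspace class_ring W (module_vec TYPE(complex) 1)"
    show "W = {0\<^sub>v 1} \<or> W = carrier_vec 1"
    proof (cases "W \<subseteq> {0\<^sub>v 1}")
      case True
      then show ?thesis using subspace_vecD(2)[OF W] by blast
    next
      case False
      then obtain w where w: "w \<in> W" "w \<noteq> 0\<^sub>v 1" by blast
      then have wc: "w \<in> carrier_vec 1" using subspace_vecD(1)[OF W] by blast
      have w0: "w $ 0 \<noteq> 0"
      proof
        assume "w $ 0 = 0"
        then have "w = 0\<^sub>v 1" using wc by (intro eq_vecI) auto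
        then show False using w by simp
      qed
      have "v \<in> W" if v: "v \<in> carrier_vec 1" for v
      proof -
        have "v = (v $ 0 / w $ 0) \<cdot>\<^sub>v w" using v wc w0 by (intro eq_vecI) auto
        then show ?thesis using subspace_vecD(4)[OF W w(1)] by metis
      qed
      then show ?thesis using subspace_vecD(1)[OF W] by blast
    qed
  qed simp
  moreover have "character_of G 1 (\<lambda>_. 1\<^sub>m 1) = trivial_char G"
    by (rule ext) (simp add: character_of_def trivial_char_def)
  ultimately show ?thesis unfolding Irr_def by force
qed

end

section \<open>Reduction modulo a maximal ideal\<close>

lemma algebraic_int_of_int [simp]: "algebraic_int (of_int k :: complex)"
  by (rule int_imp_algebraic_int) simp

lemma algebraic_int_of_nat [simp]: "algebraic_int (of_nat k :: complex)"
  by (rule int_imp_algebraic_int) simp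

locale maximal_ideal_over_prime =
  fixes p :: nat and M :: "complex set"
  assumes prime: "prime p" and over: "maximal_ideal_over p M"
begin

lemma maxideal: "maximalideal M algebraic_int_ring"
  using over by (simp add: maximal_ideal_over_def)

lemma p_in: "of_nat p \<in> M"
  using over by (simp add: maximal_ideal_over_def)

sublocale R: ring algebraic_int_ring
  using maximalideal.axioms(1)[OF maxideal] ideal.axioms(2) by blast

lemma ring_simps [simp]:
  "carrier algebraic_int_ring = {z. algebraic_int z}" "(\<otimes>\<^bsub>algebraic_int_ring\<^esub>) = (*)"
  "(\<oplus>\<^bsub>algebraic_int_ring\<^esub>) = (+)" "\<one>\<^bsub>algebraic_int_ring\<^esub> = 1" "\<zero>\<^bsub>algebraic_int_ring\<^esub> = 0"
  by (simp_all add: algebraic_int_ring_def)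

text \<open>
  Sums and products of algebraic integers are algebraic integers because a maximal ideal is, by
  definition, an ideal of a ring.
\<close>

lemma algebraic_int_add: "algebraic_int a \<Longrightarrow> algebraic_int b \<Longrightarrow> algebraic_int (a + b :: complex)"
  using R.add.m_closed[of a b] by simp

lemma algebraic_int_mult: "algebraic_int a \<Longrightarrow> algebraic_int b \<Longrightarrow> algebraic_int (a * b :: complex)"
  using R.m_closed[of a b] by simp

lemma algebraic_int_diff: "algebraic_int a \<Longrightarrow> algebraic_int b \<Longrightarrow> algebraic_int (a - b :: complex)"
  using algebraic_int_add[of a "- b"] by simp

lemma algebraic_int_sum:
  "(\<And>x. x \<in> S \<Longrightarrow> algebraic_int (f x)) \<Longrightarrow> algebraic_int (sum f S :: complex)"
  by (induction S rule: infinite_finite_induct) (auto intro: algebraic_int_add)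

lemma M_algebraic_int: "m \<in> M \<Longrightarrow> algebraic_int m"
  using ideal.Icarr[OF maximalideal.axioms(1)[OF maxideal], of m] by simp

lemma M_add: "m \<in> M \<Longrightarrow> n \<in> M \<Longrightarrow> m + n \<in> M"
  using additive_subgroup.a_closed[OF ideal.axioms(1)[OF maximalideal.axioms(1)[OF maxideal]], of m n] by simp

lemma M_zero: "0 \<in> M"
  using additive_subgroup.zero_closed[OF ideal.axioms(1)[OF maximalideal.axioms(1)[OF maxideal]]] by simp

lemma M_mult_left: "algebraic_int a \<Longrightarrow> m \<in> M \<Longrightarrow> a * m \<in> M"
  using ideal.I_l_closed[OF maximalideal.axioms(1)[OF maxideal], of m a] by simp

lemma M_mult_right: "algebraic_int a \<Longrightarrow> m \<in> M \<Longrightarrow> m * a \<in> M"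
  using M_mult_left by (simp add: mult.commute)

lemma M_minus: "m \<in> M \<Longrightarrow> - m \<in> M"
  using M_mult_left[of "- 1" m] by simp

lemma M_diff: "m \<in> M \<Longrightarrow> n \<in> M \<Longrightarrow> m - n \<in> M"
  using M_add[OF _ M_minus, of m n] by simp

lemma M_sum: "(\<And>x. x \<in> S \<Longrightarrow> f x \<in> M) \<Longrightarrow> sum f S \<in> M"
  by (induction S rule: infinite_finite_induct) (auto intro: M_add M_zero)

lemma M_prime:
  assumes "algebraic_int a" "algebraic_int b" "a * b \<in> M"
  shows "a \<in> M \<or> b \<in> M"
proof -
  have "cring algebraic_int_ring"
    by (intro cring.intro R.ring_axioms comm_monoid.intro R.monoid_axioms comm_monoid_axioms.intro)
      (simp add: mult.commute)
  from cring.maximalideal_prime[OF this maxideal] have "primeideal M algebraic_int_ring" .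
  from primeideal.I_prime[OF this, of a b] assms show ?thesis by simp
qed

lemma one_not_in_M: "1 \<notin> M"
proof
  assume "1 \<in> M"
  then have "M = carrier algebraic_int_ring"
    using M_mult_left[of _ 1] M_algebraic_int by auto
  then show False using maximalideal.I_notcarr[OF maxideal] by simp
qed

lemma of_nat_in_M_iff: "of_nat k \<in> M \<longleftrightarrow> p dvd k"
proof
  assume k: "of_nat k \<in> M"
  show "p dvd k"
  proof (rule ccontr)
    assume "\<not> p dvd k"
    then have "coprime (int p) (int k)" using prime by (simp add: prime_imp_coprime)
    then obtain u v where "u * int p + v * int k = 1"
      by (metis bezout_int coprime_iff_gcd_eq_1)
    then have "of_int (u * int p + v * int k) = (1 :: complex)" by simp
    then have "of_int u * of_nat p + of_int v * of_nat k = (1 :: complex)" by simp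
    then have "1 \<in> M" using M_add[OF M_mult_left[OF algebraic_int_of_int p_in] M_mult_left[OF algebraic_int_of_int k], of u v]
      by simp
    then show False using one_not_in_M by simp
  qed
next
  assume "p dvd k"
  then obtain l where "k = l * p" by (auto simp: dvd_def mult.commute)
  then show "of_nat k \<in> M" using M_mult_left[OF algebraic_int_of_nat p_in, of l] by simp
qed

end

section \<open>The degrees in the principal block\<close>

definition char_degree :: "('a, 'b) monoid_scheme \<Rightarrow> ('a \<Rightarrow> complex) \<Rightarrow> nat" where
  "char_degree G \<chi> = (THE n. \<chi> \<one>\<^bsub>G\<^esub> = of_nat n)"

locale finite_group_mod = finite_group G + maximal_ideal_over_prime p M
  for G (structure) and p M
begin

text \<open>
  Central elements of the group algebra with algebraic integer coefficients and central values. Both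
  kinds of integrality are preserved by products.
\<close>

definition integral_class_fun :: "('a \<Rightarrow> complex) \<Rightarrow> bool" where
  "integral_class_fun a \<longleftrightarrow> class_fun a \<and> (\<forall>g\<in>carrier G. algebraic_int (a g)) \<and>
     (\<forall>\<chi>\<in>Irr G. algebraic_int (central_value \<chi> a))"

lemma integral_class_fun_convolution:
  assumes a: "integral_class_fun a" and b: "integral_class_fun b"
  shows "integral_class_fun (convolution a b)"
  unfolding integral_class_fun_def
proof (intro conjI ballI)
  show "class_fun (convolution a b)"
    using a b class_fun_convolution by (simp add: integral_class_fun_def)
  show "algebraic_int (convolution a b g)" if "g \<in> carrier G" for g
    unfolding convolution_def
    by (intro algebraic_int_sum algebraic_int_mult) (use a b that in \<open>auto simp: integral_class_fun_def\<close>)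
  show "algebraic_int (central_value \<chi> (convolution a b))" if "\<chi> \<in> Irr G" for \<chi>
    using a b that by (simp add: central_value_convolution integral_class_fun_def algebraic_int_mult)
qed

text \<open>
  The class sum of \<open>g\<close>, shifted so that \<open>\<psi>\<close> annihilates it.
\<close>

lemma separating_class_fun:
  assumes \<psi>: "\<psi> \<in> Irr G" and g: "g \<in> carrier G"
  defines "a \<equiv> (\<lambda>h. class_indicator g h - central_char G \<psi> g * delta h)"
  shows "integral_class_fun a"
    and "\<chi> \<in> Irr G \<Longrightarrow> central_value \<chi> a = central_char G \<chi> g - central_char G \<psi> g"
proof -
  show cv: "central_value \<chi> a = central_char G \<chi> g - central_char G \<psi> g" if \<chi>: "\<chi> \<in> Irr G" for \<chi>
  proof -
    have "central_value \<chi> a = central_value \<chi> (class_indicator g) - central_char G \<psi> g * central_value \<chi> delta"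
      unfolding central_value_def a_def
      by (simp add: left_diff_distrib sum_subtractf diff_divide_distrib sum_distrib_left mult.assoc)
    then show ?thesis using \<chi> g by (simp add: central_value_indicator central_value_delta)
  qed
  show "integral_class_fun a"
    unfolding integral_class_fun_def
  proof (intro conjI ballI)
    show "class_fun a"
      using class_fun_indicator[OF g] class_fun_delta unfolding class_fun_def a_def by simp
    show "algebraic_int (a h)" for h
      unfolding a_def class_indicator_def delta_def
      using algebraic_int_central_char[OF \<psi> g] by (auto intro!: algebraic_int_diff)
    show "algebraic_int (central_value \<chi> a)" if "\<chi> \<in> Irr G" for \<chi>
      using that by (simp add: cv algebraic_int_diff algebraic_int_central_char \<psi> g)
  qed
qed

lemma principal_block_subset: "principal_block G M \<subseteq> Irr G"
  by (auto simp: principal_block_def block_rel_def)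

lemma trivial_in_principal_block: "trivial_char G \<in> principal_block G M"
  using trivial_char_Irr M_zero by (simp add: principal_block_def block_rel_def)

lemma principal_blockD:
  "\<chi> \<in> principal_block G M \<Longrightarrow> g \<in> carrier G \<Longrightarrow> central_char G (trivial_char G) g - central_char G \<chi> g \<in> M"
  by (simp add: principal_block_def block_rel_def)

text \<open>
  One factor \<open>separating_class_fun\<close> for each \<open>\<psi>\<close> in \<open>F\<close>, with \<open>g\<close> chosen to distinguish \<open>\<psi>\<close> from the
  trivial character modulo \<open>M\<close>. As \<open>M\<close> is prime, the product remains nonzero modulo \<open>M\<close> at the
  trivial character. Modulo \<open>M\<close> its values do not vary within the principal block.
\<close>

lemma block_separating_class_fun:
  assumes "finite F" "F \<subseteq> Irr G - principal_block G M"
  shows "\<exists>a. integral_class_fun a \<and> (\<forall>\<psi>\<in>F. central_value \<psi> a = 0) \<and>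
    central_value (trivial_char G) a \<notin> M \<and>
    (\<forall>\<chi>\<in>principal_block G M. central_value \<chi> a - central_value (trivial_char G) a \<in> M)"
  using assms
proof (induction F rule: finite_induct)
  case empty
  show ?case
  proof (intro exI[of _ delta] conjI)
    show "integral_class_fun delta"
      unfolding integral_class_fun_def using class_fun_delta by (auto simp: central_value_delta delta_def)
    show "\<forall>\<chi>\<in>principal_block G M. central_value \<chi> delta - central_value (trivial_char G) delta \<in> M"
      using principal_block_subset trivial_char_Irr M_zero by (auto simp: central_value_delta subset_iff)
  qed (use one_not_in_M trivial_char_Irr in \<open>auto simp: central_value_delta\<close>)
next
  case (insert \<psi> F)
  then obtain a where a: "integral_class_fun a" "\<forall>\<psi>\<in>F. central_value \<psi> a = 0"
    "central_value (trivial_char G) a \<notin> M"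
    "\<forall>\<chi>\<in>principal_block G M. central_value \<chi> a - central_value (trivial_char G) a \<in> M" by blast
  from insert.prems have \<psi>: "\<psi> \<in> Irr G" "\<psi> \<notin> principal_block G M" and F: "F \<subseteq> Irr G" by auto
  then obtain g where g: "g \<in> carrier G" "central_char G (trivial_char G) g - central_char G \<psi> g \<notin> M"
    using trivial_char_Irr unfolding principal_block_def block_rel_def by blast
  define b where "b = (\<lambda>h. class_indicator g h - central_char G \<psi> g * delta h)"
  note b = separating_class_fun[OF \<psi>(1) g(1), folded b_def]
  have cv: "central_value \<chi> (convolution a b) =
      central_value \<chi> a * (central_char G \<chi> g - central_char G \<psi> g)" if "\<chi> \<in> Irr G" for \<chi>
    using central_value_convolution[OF that, of b a] b that by (simp add: integral_class_fun_def)
  have ai: "algebraic_int (central_value \<chi> a)" "algebraic_int (central_char G \<chi> g - central_char G \<psi> g)"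
    if "\<chi> \<in> Irr G" for \<chi>
    using that a(1) \<psi> g by (auto simp: integral_class_fun_def intro!: algebraic_int_diff algebraic_int_central_char)
  show ?case
  proof (intro exI[of _ "convolution a b"] conjI ballI)
    show "integral_class_fun (convolution a b)" by (rule integral_class_fun_convolution[OF a(1) b(1)])
    show "central_value \<phi> (convolution a b) = 0" if "\<phi> \<in> insert \<psi> F" for \<phi>
      using that a(2) \<psi>(1) F cv by auto
    show "central_value (trivial_char G) (convolution a b) \<notin> M"
      using M_prime[OF ai(1,2)[OF trivial_char_Irr]] a(3) g(2) by (auto simp: cv[OF trivial_char_Irr])
    fix \<chi> assume \<chi>b: "\<chi> \<in> principal_block G M"
    then have \<chi>: "\<chi> \<in> Irr G" using principal_block_subset by blast
    let ?t = "trivial_char G"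
    have "central_value \<chi> a * (central_char G ?t g - central_char G \<chi> g) \<in> M"
      by (rule M_mult_left[OF ai(1)[OF \<chi>] principal_blockD[OF \<chi>b g(1)]])
    moreover have "(central_value \<chi> a - central_value ?t a) * (central_char G ?t g - central_char G \<psi> g) \<in> M"
      using M_mult_right[OF ai(2)[OF trivial_char_Irr]] a(4) \<chi>b by blast
    ultimately have "(central_value \<chi> a - central_value ?t a) * (central_char G ?t g - central_char G \<psi> g)
        - central_value \<chi> a * (central_char G ?t g - central_char G \<chi> g) \<in> M" by (intro M_diff)
    then show "central_value \<chi> (convolution a b) - central_value ?t (convolution a b) \<in> M"
      by (simp add: cv[OF \<chi>] cv[OF trivial_char_Irr] algebra_simps)
  qed
qed

lemma char_degree: "\<chi> \<in> Irr G \<Longrightarrow> \<chi> \<one> = of_nat (char_degree G \<chi>)"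
  unfolding char_degree_def by (rule Irr_one, assumption) simp

text \<open>
  Both sides compute the trace of \<open>a\<close> on the regular representation.
\<close>

lemma sum_central_value:
  "(\<Sum>\<chi>\<in>Irr G. (\<chi> \<one>)\<^sup>2 * central_value \<chi> a) = of_nat (card (carrier G)) * a \<one>"
proof -
  have "(\<Sum>\<chi>\<in>Irr G. (\<chi> \<one>)\<^sup>2 * central_value \<chi> a) = (\<Sum>\<chi>\<in>Irr G. \<Sum>g\<in>carrier G. a g * (\<chi> \<one> * \<chi> g))"
  proof (intro sum.cong refl)
    fix \<chi> assume "\<chi> \<in> Irr G"
    then have "(\<chi> \<one>)\<^sup>2 * central_value \<chi> a = \<chi> \<one> * (\<Sum>g\<in>carrier G. a g * \<chi> g)"
      using Irr_one_nz by (simp add: central_value_def power2_eq_square)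
    then show "(\<chi> \<one>)\<^sup>2 * central_value \<chi> a = (\<Sum>g\<in>carrier G. a g * (\<chi> \<one> * \<chi> g))"
      by (simp add: sum_distrib_left mult_ac)
  qed
  also have "\<dots> = (\<Sum>g\<in>carrier G. a g * (\<Sum>\<chi>\<in>Irr G. \<chi> \<one> * \<chi> g))"
    by (subst sum.swap) (simp add: sum_distrib_left)
  also have "\<dots> = (\<Sum>g\<in>carrier G. if g = \<one> then of_nat (card (carrier G)) * a \<one> else 0)"
    by (intro sum.cong refl) (simp add: column_orthogonality)
  also have "\<dots> = of_nat (card (carrier G)) * a \<one>" using fin by simp
  finally show ?thesis .
qed

text \<open>
  For a separating class function \<open>a\<close>, the formula \<open>sum_central_value\<close> has a multiple of the group
  order on one side. On the other side it is, modulo \<open>M\<close>, the sum of squared degrees times a number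
  outside \<open>M\<close>.
\<close>

theorem principal_block_degree_squares:
  assumes p: "p dvd card (carrier G)"
  shows "p dvd (\<Sum>\<chi>\<in>principal_block G M. (char_degree G \<chi>)\<^sup>2)"
proof -
  let ?B = "principal_block G M" and ?t = "trivial_char G"
  obtain a where a: "integral_class_fun a" "\<forall>\<psi>\<in>Irr G - ?B. central_value \<psi> a = 0"
    "central_value ?t a \<notin> M" "\<forall>\<chi>\<in>?B. central_value \<chi> a - central_value ?t a \<in> M"
    using block_separating_class_fun[of "Irr G - ?B"] finite_Irr by blast
  have sq: "algebraic_int ((\<chi> \<one>)\<^sup>2)" if "\<chi> \<in> Irr G" for \<chi>
    using algebraic_int_of_nat[of "(char_degree G \<chi>)\<^sup>2"] char_degree[OF that] by simp
  have "of_nat (card (carrier G)) * a \<one> \<in> M"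
    using a(1) p by (intro M_mult_right) (auto simp: integral_class_fun_def of_nat_in_M_iff)
  also have "of_nat (card (carrier G)) * a \<one> = (\<Sum>\<chi>\<in>?B. (\<chi> \<one>)\<^sup>2 * central_value \<chi> a)"
    unfolding sum_central_value[symmetric]
    by (rule sum.mono_neutral_right) (use finite_Irr principal_block_subset a(2) in auto)
  also have "\<dots> = (\<Sum>\<chi>\<in>?B. (\<chi> \<one>)\<^sup>2) * central_value ?t a
      + (\<Sum>\<chi>\<in>?B. (\<chi> \<one>)\<^sup>2 * (central_value \<chi> a - central_value ?t a))"
    by (simp add: algebra_simps sum_subtractf sum_distrib_left)
  finally have "(\<Sum>\<chi>\<in>?B. (\<chi> \<one>)\<^sup>2) * central_value ?t a
      + (\<Sum>\<chi>\<in>?B. (\<chi> \<one>)\<^sup>2 * (central_value \<chi> a - central_value ?t a)) \<in> M" .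
  moreover have "(\<Sum>\<chi>\<in>?B. (\<chi> \<one>)\<^sup>2 * (central_value \<chi> a - central_value ?t a)) \<in> M"
    using a(4) sq principal_block_subset by (intro M_sum M_mult_left) auto
  ultimately have "(\<Sum>\<chi>\<in>?B. (\<chi> \<one>)\<^sup>2) * central_value ?t a \<in> M"
    using M_diff by fastforce
  moreover have "(\<Sum>\<chi>\<in>?B. (\<chi> \<one>)\<^sup>2) = of_nat (\<Sum>\<chi>\<in>?B. (char_degree G \<chi>)\<^sup>2)"
    using principal_block_subset by (simp add: char_degree subset_iff cong: sum.cong)
  moreover have "algebraic_int (central_value ?t a)"
    using a(1) trivial_char_Irr by (simp add: integral_class_fun_def)
  ultimately have "of_nat (\<Sum>\<chi>\<in>?B. (char_degree G \<chi>)\<^sup>2) \<in> M"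
    using a(3) by (metis M_prime algebraic_int_of_nat)
  then show ?thesis by (simp only: of_nat_in_M_iff)
qed

end

section \<open>Actions of groups of prime power order\<close>

context group
begin

lemma group_action_restrict:
  assumes closed: "\<And>g e. g \<in> carrier G \<Longrightarrow> e \<in> E \<Longrightarrow> act g e \<in> E"
    and one: "\<And>e. e \<in> E \<Longrightarrow> act \<one> e = e"
    and mult: "\<And>g h e. g \<in> carrier G \<Longrightarrow> h \<in> carrier G \<Longrightarrow> e \<in> E \<Longrightarrow> act (g \<otimes> h) e = act g (act h e)"
  shows "group_action G E (\<lambda>g. restrict (act g) E)"
proof -
  have Bij: "restrict (act g) E \<in> Bij E" if g: "g \<in> carrier G" for g
  proof -
    have "bij_betw (act g) E E"
      by (rule bij_betwI[of _ _ _ "act (inv g)"])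
        (use g closed in \<open>auto simp: mult[symmetric] one\<close>)
    then show ?thesis unfolding Bij_def by (simp cong: bij_betw_cong)
  qed
  show ?thesis
    unfolding group_action_def group_hom_def group_hom_axioms_def
  proof (intro conjI is_group group_BijGroup homI)
    show "restrict (act g) E \<in> carrier (BijGroup E)" if "g \<in> carrier G" for g
      using Bij[OF that] by (simp add: BijGroup_def)
    fix g h assume gh: "g \<in> carrier G" "h \<in> carrier G"
    have "restrict (act (g \<otimes> h)) E = compose E (restrict (act g) E) (restrict (act h) E)"
      by (rule ext) (use gh closed in \<open>auto simp: compose_def mult\<close>)
    then show "restrict (act (g \<otimes> h)) E = restrict (act g) E \<otimes>\<^bsub>BijGroup E\<^esub> restrict (act h) E"
      using Bij gh by (simp add: BijGroup_def)
  qed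
qed

text \<open>
  Orbits have \<open>p\<close>-power length, so if none is a singleton then \<open>p\<close> divides the number of points.
\<close>

lemma prime_power_group_fixed_point:
  assumes p: "prime p" and card: "card (carrier G) = p ^ k"
    and closed: "\<And>g e. g \<in> carrier G \<Longrightarrow> e \<in> E \<Longrightarrow> act g e \<in> E"
    and one: "\<And>e. e \<in> E \<Longrightarrow> act \<one> e = e"
    and mult: "\<And>g h e. g \<in> carrier G \<Longrightarrow> h \<in> carrier G \<Longrightarrow> e \<in> E \<Longrightarrow> act (g \<otimes> h) e = act g (act h e)"
    and E: "finite E" "\<not> p dvd card E"
  shows "\<exists>e\<in>E. \<forall>g\<in>carrier G. act g e = e"
proof (rule ccontr)
  assume no: "\<not> ?thesis"
  interpret act: group_action G E "\<lambda>g. restrict (act g) E"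
    by (rule group_action_restrict) fact+
  define orb where "orb x = (\<lambda>g. act g x) ` carrier G" for x
  have orb_dvd: "p dvd card (orb x)" if x: "x \<in> E" for x
  proof -
    have eq: "orbit G (\<lambda>g. restrict (act g) E) x = orb x"
      using x by (auto simp: orbit_def orb_def)
    have "card (orb x) * card (stabilizer G (\<lambda>g. restrict (act g) E) x) = p ^ k"
      using act.orbit_stabilizer_theorem[OF x] card by (simp add: eq Coset.order_def)
    then have "card (orb x) dvd p ^ k" by (metis dvd_triv_left)
    then obtain j where j: "card (orb x) = p ^ j" using p by (auto simp: divides_primepow_nat)
    have xo: "x \<in> orb x" using one[OF x] by (force simp: orb_def)
    obtain g where g: "g \<in> carrier G" "act g x \<noteq> x" using no x by blast
    then have "act g x \<in> orb x" by (auto simp: orb_def)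
    then have "j \<noteq> 0" using j xo g by (metis card_1_singletonE power_0 singletonD)
    then show ?thesis using j by simp
  qed
  define r where "r = {(x, y). x \<in> E \<and> y \<in> orb x}"
  have sub: "orb x \<subseteq> E" if "x \<in> E" for x using that closed by (auto simp: orb_def)
  have "equiv E r"
  proof (rule equivI)
    show "r \<subseteq> E \<times> E" using sub by (auto simp: r_def)
    show "refl_on E r" using one by (force simp: refl_on_def r_def orb_def)
    show "sym r"
    proof (rule symI)
      fix x y assume "(x, y) \<in> r"
      then obtain g where g: "g \<in> carrier G" "x \<in> E" "y = act g x" by (auto simp: r_def orb_def)
      then have "act (inv g) y = x" using mult[of "inv g" g x] one by simp
      then show "(y, x) \<in> r" using g closed by (force simp: r_def orb_def)
    qed
    show "trans r"
    proof (rule transI)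
      fix x y z assume "(x, y) \<in> r" "(y, z) \<in> r"
      then obtain g h where gh: "g \<in> carrier G" "x \<in> E" "y = act g x" "h \<in> carrier G" "z = act h y"
        by (auto simp: r_def orb_def)
      then have "z = act (h \<otimes> g) x" using mult by simp
      then show "(x, z) \<in> r" using gh by (auto simp: r_def orb_def)
    qed
  qed
  moreover have "p dvd card X" if Xr: "X \<in> E // r" for X
  proof -
    obtain x where x: "x \<in> E" "X = r `` {x}" using Xr unfolding quotient_def by blast
    then have "X = orb x" by (auto simp: r_def)
    then show ?thesis using orb_dvd[OF x(1)] by simp
  qed
  ultimately have "p dvd card E" by (rule equiv_imp_dvd_card[OF E(1)])
  then show False using E(2) by simp
qed

section \<open>Sylow subgroups\<close>

lemma rcos_eq_iff:
  assumes H: "subgroup H G" and ab: "a \<in> carrier G" "b \<in> carrier G"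
  shows "H #> a = H #> b \<longleftrightarrow> a \<otimes> inv b \<in> H"
  using subgroup.rcos_module[OF H is_group ab(2,1)] repr_independence[OF _ ab(2) H] rcos_self[OF ab(1) H] by metis

lemma lagrange_card: "subgroup H G \<Longrightarrow> card (rcosets H) * card H = card (carrier G)"
  using lagrange by (simp add: Coset.order_def)

lemma rcosetsE:
  assumes "c \<in> rcosets H"
  obtains x where "x \<in> carrier G" "c = H #> x"
  using assms by (auto simp: RCOSETS_def)

text \<open>
  \<open>Q\<close> acts on the right cosets of \<open>P\<close>; a fixed coset \<open>P x\<close> yields the conjugating element.
\<close>

lemma prime_power_subgroup_conjugate_into:
  assumes fin: "finite (carrier G)" and p: "prime p" and P: "subgroup P G" and idx: "\<not> p dvd card (rcosets P)"
    and Q: "subgroup Q G" and cQ: "card Q = p ^ k"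
  shows "\<exists>x\<in>carrier G. \<forall>q\<in>Q. x \<otimes> q \<otimes> inv x \<in> P"
proof -
  interpret Q: group "G\<lparr>carrier := Q\<rparr>" by (rule subgroup_imp_group[OF Q])
  note Qc = subgroup.mem_carrier[OF Q]
  note Pc = subgroup.subset[OF P]
  have invQ: "inv\<^bsub>G\<lparr>carrier := Q\<rparr>\<^esub> q = inv q" if "q \<in> Q" for q using m_inv_consistent[OF Q that] .
  have "\<exists>c\<in>rcosets P. \<forall>q\<in>carrier (G\<lparr>carrier := Q\<rparr>). c #> inv q = c"
  proof (rule Q.prime_power_group_fixed_point[OF p, of k])
    show "card (carrier (G\<lparr>carrier := Q\<rparr>)) = p ^ k" using cQ by simp
    show "c #> inv q \<in> rcosets P" if "q \<in> carrier (G\<lparr>carrier := Q\<rparr>)" "c \<in> rcosets P" for q c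
      using that Qc Pc by (auto elim!: rcosetsE simp: coset_mult_assoc intro!: rcosetsI)
    show "c #> inv \<one>\<^bsub>G\<lparr>carrier := Q\<rparr>\<^esub> = c" if "c \<in> rcosets P" for c
      using that Pc by (auto elim!: rcosetsE simp: coset_mult_assoc)
    show "c #> inv (g \<otimes>\<^bsub>G\<lparr>carrier := Q\<rparr>\<^esub> h) = c #> inv h #> inv g"
      if "g \<in> carrier (G\<lparr>carrier := Q\<rparr>)" "h \<in> carrier (G\<lparr>carrier := Q\<rparr>)" "c \<in> rcosets P" for g h c
      using that Qc Pc by (auto elim!: rcosetsE simp: coset_mult_assoc inv_mult_group m_assoc)
    show "finite (rcosets P)" using fin Pc rcosets_subset_PowG[OF P] by (meson finite_Pow_iff finite_subset)
  qed (rule idx)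
  then obtain x where x: "x \<in> carrier G" "\<And>q. q \<in> Q \<Longrightarrow> P #> x #> inv q = P #> x"
    by (auto elim!: rcosetsE)
  have "x \<otimes> q \<otimes> inv x \<in> P" if q: "q \<in> Q" for q
  proof -
    have "P #> (x \<otimes> inv (inv q)) = P #> x"
      using x(2)[of "inv q"] subgroup.m_inv_closed[OF Q q] x(1) Qc[OF q] Pc by (simp add: coset_mult_assoc)
    then show ?thesis using rcos_eq_iff[OF P] x(1) Qc[OF q] by simp
  qed
  then show ?thesis using x(1) by blast
qed

lemma sylow_subgroup_exists:
  assumes fin: "finite (carrier G)" and p: "prime p"
  obtains P k where "subgroup P G" "card P = p ^ k" "\<not> p dvd card (rcosets P)"
proof -
  have "card (carrier G) > 0" using fin one_closed by (auto simp: card_gt_0_iff)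
  then obtain k m where km: "card (carrier G) = p ^ k * m" "\<not> p dvd m"
    using p prime_power_canonical[of p "card (carrier G)"] by (metis mult.commute)
  obtain P where P: "subgroup P G" "card P = p ^ k" using sylow_thm[OF p is_group km(1)[folded Coset.order_def] fin] by blast
  have "card (rcosets P) * p ^ k = p ^ k * m" using lagrange_card[OF P(1)] P(2) km(1) by simp
  then have "card (rcosets P) = m" using p prime_gt_0_nat[OF p] by simp
  with P km(2) that show ?thesis by blast
qed

lemma subgroup_prime_index_maximal:
  assumes fin: "finite (carrier G)" and p: "prime p" and card: "card (carrier G) = p ^ Suc k"
    and S: "subgroup S G" "card S = p ^ k" and T: "subgroup T G" "S \<subseteq> T" "T \<noteq> S"
  shows "T = carrier G"
proof -
  have fT: "finite T" using fin subgroup.subset[OF T(1)] by (rule finite_subset[rotated])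
  have "card T dvd p ^ Suc k" using lagrange_card[OF T(1)] card by (metis dvd_triv_right)
  then obtain j where j: "j \<le> Suc k" "card T = p ^ j"
    using divides_primepow_nat[OF p] by blast
  have "card S < card T" using T fT by (simp add: psubset_card_mono psubset_eq)
  then have "k < j" using j S(2) p by (metis power_increasing_iff prime_gt_1_nat linorder_not_le)
  then have "card T = card (carrier G)" using j card by (simp add: order_def le_Suc_eq)
  then show ?thesis using card_subset_eq[OF fin subgroup.subset[OF T(1)]] by simp
qed

lemma subgroup_of_finiteI:
  assumes fin: "finite (carrier G)" and H: "H \<subseteq> carrier G" "\<one> \<in> H" "\<And>x y. x \<in> H \<Longrightarrow> y \<in> H \<Longrightarrow> x \<otimes> y \<in> H"
  shows "subgroup H G"
proof (rule subgroupI)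
  show "H \<subseteq> carrier G" "H \<noteq> {}" "\<And>x y. x \<in> H \<Longrightarrow> y \<in> H \<Longrightarrow> x \<otimes> y \<in> H" using H by auto
  fix x assume x: "x \<in> H"
  then have xc: "x \<in> carrier G" using H(1) by blast
  have pow: "x [^] n \<in> H" for n :: nat by (induction n) (use x H in auto)
  have "card (carrier G) > 0" using fin one_closed by (auto simp: card_gt_0_iff)
  then have "x \<otimes> x [^] (card (carrier G) - 1) = \<one>"
    using pow_order_eq_1[OF xc] xc unfolding Coset.order_def by (metis Suc_diff_1 nat_pow_Suc2)
  then have "inv x = x [^] (card (carrier G) - 1)" using xc by (simp add: inv_equality inv_comm)
  then show "inv x \<in> H" using pow by simp
qed

text \<open>
  A subgroup \<open>S\<close> of index \<open>p\<close> permutes the \<open>p - 1\<close> cosets other than itself and therefore fixes one of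
  them; hence its normalizer is larger than \<open>S\<close>, and \<open>S\<close> is normal. Modulo \<open>S\<close> each element outside
  \<open>S\<close> is central, again because there is no subgroup strictly between \<open>S\<close> and the group. So \<open>S\<close>
  contains all commutators.
\<close>

lemma derived_prime_power_group_proper:
  assumes fin: "finite (carrier G)" and p: "prime p" and card: "card (carrier G) = p ^ Suc k"
  shows "derived G (carrier G) \<noteq> carrier G"
proof -
  obtain S where S: "subgroup S G" "card S = p ^ k"
    using sylow_thm[OF p is_group, of k p] card fin by (auto simp: Coset.order_def mult.commute)
  note Sc = subgroup.mem_carrier[OF S(1)] and Ss = subgroup.subset[OF S(1)]
  have idx: "card (rcosets S) = p"
  proof -
    have "card (rcosets S) * p ^ k = p * p ^ k" using lagrange_card[OF S(1)] S(2) card by simp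
    then show ?thesis using prime_gt_0_nat[OF p] by simp
  qed
  have finr: "finite (rcosets S)" using idx prime_gt_0_nat[OF p] by (metis card.infinite less_irrefl)
  have SR: "S \<in> rcosets S" using subgroup.subgroup_in_rcosets[OF S(1) is_group] .
  interpret S: group "G\<lparr>carrier := S\<rparr>" by (rule subgroup_imp_group[OF S(1)])
  have "\<exists>c\<in>rcosets S - {S}. \<forall>q\<in>carrier (G\<lparr>carrier := S\<rparr>). c #> inv q = c"
  proof (rule S.prime_power_group_fixed_point[OF p, of k])
    show "card (carrier (G\<lparr>carrier := S\<rparr>)) = p ^ k" using S by simp
    show "c #> inv q \<in> rcosets S - {S}" if "q \<in> carrier (G\<lparr>carrier := S\<rparr>)" "c \<in> rcosets S - {S}" for q c
    proof -
      from that have q: "q \<in> S" by simp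
      from that obtain x where x: "x \<in> carrier G" "c = S #> x" "c \<noteq> S" by (auto elim!: rcosetsE)
      have "c #> inv q \<noteq> S"
      proof
        assume "c #> inv q = S"
        then have "c #> inv q #> q = S" using coset_join2[OF Sc[OF q] S(1) q] by simp
        then show False using x Sc[OF q] Ss by (simp add: coset_mult_assoc m_assoc)
      qed
      then show ?thesis using x Sc[OF q] Ss by (auto simp: coset_mult_assoc intro!: rcosetsI)
    qed
    show "c #> inv \<one>\<^bsub>G\<lparr>carrier := S\<rparr>\<^esub> = c" if "c \<in> rcosets S - {S}" for c
      using that Ss by (auto elim!: rcosetsE simp: coset_mult_assoc)
    show "c #> inv (g \<otimes>\<^bsub>G\<lparr>carrier := S\<rparr>\<^esub> h) = c #> inv h #> inv g"
      if "g \<in> carrier (G\<lparr>carrier := S\<rparr>)" "h \<in> carrier (G\<lparr>carrier := S\<rparr>)" "c \<in> rcosets S - {S}" for g h c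
      using that Sc Ss by (auto elim!: rcosetsE simp: coset_mult_assoc inv_mult_group m_assoc)
    show "finite (rcosets S - {S})" using finr by simp
    have "card (rcosets S - {S}) = p - 1" using idx SR by (simp add: card_Diff_singleton)
    then show "\<not> p dvd card (rcosets S - {S})"
      using prime_gt_1_nat[OF p] by (auto dest: dvd_imp_le)
  qed
  then obtain x where x: "x \<in> carrier G" "S #> x \<noteq> S" "\<And>q. q \<in> S \<Longrightarrow> S #> x #> inv q = S #> x"
    by (auto elim!: rcosetsE)
  have xS: "x \<notin> S" using x(1,2) coset_join2[OF x(1) S(1)] by blast
  have conj: "x \<otimes> q \<otimes> inv x \<in> S" if q: "q \<in> S" for q
  proof -
    have "S #> (x \<otimes> inv (inv q)) = S #> x"
      using x(3)[of "inv q"] subgroup.m_inv_closed[OF S(1) q] x(1) Sc[OF q] Ss by (simp add: coset_mult_assoc)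
    then show ?thesis using rcos_eq_iff[OF S(1)] x(1) Sc[OF q] by simp
  qed
  define T where "T = {g \<in> carrier G. \<forall>q\<in>S. g \<otimes> q \<otimes> inv g \<in> S}"
  have "T = carrier G"
  proof (rule subgroup_prime_index_maximal[OF fin p card S])
    show "subgroup T G"
    proof (rule subgroup_of_finiteI[OF fin])
      show "\<one> \<in> T" using Sc by (simp add: T_def)
      fix g h assume gh: "g \<in> T" "h \<in> T"
      have "g \<otimes> h \<otimes> q \<otimes> inv (g \<otimes> h) = g \<otimes> (h \<otimes> q \<otimes> inv h) \<otimes> inv g" if "q \<in> S" for q
        using gh Sc[OF that] by (simp add: T_def inv_mult_group m_assoc)
      then show "g \<otimes> h \<in> T" using gh by (simp add: T_def)
    qed (auto simp: T_def)
    show "S \<subseteq> T" using S(1) Sc by (auto simp: T_def subgroup.m_closed subgroup.m_inv_closed)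
    show "T \<noteq> S" using x(1) conj xS by (auto simp: T_def)
  qed
  then have nS: "S \<lhd> G" using S(1) by (auto simp: normal_inv_iff T_def)
  interpret N: normal S G by (rule nS)
  have comm: "g \<otimes> y \<otimes> inv g \<otimes> inv y \<in> S" if g: "g \<in> carrier G" and y: "y \<in> carrier G" for g y
  proof (cases "y \<in> S")
    case True
    then show ?thesis using N.inv_op_closed2[OF g True] by simp
  next
    case False
    \<comment> \<open>the centralizer of \<open>y\<close> modulo \<open>S\<close> contains \<open>S\<close> and \<open>y\<close>\<close>
    define C where "C = {g \<in> carrier G. S #> (g \<otimes> y) = S #> (y \<otimes> g)}"
    have "C = carrier G"
    proof (rule subgroup_prime_index_maximal[OF fin p card S])
      show "subgroup C G"
      proof (rule subgroup_of_finiteI[OF fin])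
        show "\<one> \<in> C" using y by (simp add: C_def)
        fix a b assume "a \<in> C" "b \<in> C"
        then have a: "a \<in> carrier G" "S #> (a \<otimes> y) = S #> (y \<otimes> a)"
          and b: "b \<in> carrier G" "S #> (b \<otimes> y) = S #> (y \<otimes> b)" by (auto simp: C_def)
        have "S #> (a \<otimes> b \<otimes> y) = (S #> a) <#> (S #> (b \<otimes> y))"
          using a(1) b(1) y by (simp add: N.rcos_sum m_assoc)
        also have "\<dots> = (S #> (a \<otimes> y)) <#> (S #> b)"
          unfolding b(2) using a(1) b(1) y by (simp add: N.rcos_sum m_assoc)
        also have "\<dots> = S #> (y \<otimes> (a \<otimes> b))"
          unfolding a(2) using a(1) b(1) y by (simp add: N.rcos_sum m_assoc)
        finally show "a \<otimes> b \<in> C" using a b by (simp add: C_def)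
      qed (auto simp: C_def)
      show "S \<subseteq> C"
      proof
        fix s assume s: "s \<in> S"
        have "S #> (s \<otimes> y) = S #> y" using s y coset_mult_assoc[OF Ss Sc[OF s] y] coset_join2[OF Sc[OF s] S(1) s] by simp
        moreover have "S #> (y \<otimes> s) = S #> y"
          using N.inv_op_closed2[OF y s] rcos_eq_iff[OF S(1)] s y Sc[OF s] by (simp add: m_assoc)
        ultimately show "s \<in> C" using Sc[OF s] by (simp add: C_def)
      qed
      show "C \<noteq> S" using y False by (auto simp: C_def)
    qed
    then have "S #> (g \<otimes> y) = S #> (y \<otimes> g)" using g by (auto simp: C_def)
    then have "g \<otimes> y \<otimes> inv (y \<otimes> g) \<in> S" using rcos_eq_iff[OF S(1)] g y by simp
    then show ?thesis using g y by (simp add: inv_mult_group m_assoc)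
  qed
  have "derived G (carrier G) \<subseteq> S"
    unfolding derived_def by (rule generate_subgroup_incl[OF _ S(1)]) (use comm in auto)
  then show ?thesis using x(1) xS by blast
qed

section \<open>Proper supplements and the Schur--Zassenhaus theorem\<close>

lemma coprime_pow_eq_one:
  assumes x: "x \<in> carrier G" and m: "x [^] (m :: nat) = \<one>" and n: "x [^] (n :: nat) = \<one>" and mn: "coprime m n"
  shows "x = \<one>"
proof (cases "m = 0")
  case True
  then show ?thesis using mn n x by simp
next
  case False
  obtain u v where uv: "m * u = n * v + 1" using bezout_nat[OF False, of n] mn by (auto simp: coprime_iff_gcd_eq_1)
  have "x [^] (m * u) = \<one>" using x m by (simp add: nat_pow_pow[symmetric])
  moreover have "x [^] (n * v + 1) = x" using x n by (simp add: nat_pow_mult[symmetric] nat_pow_pow[symmetric])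
  ultimately show ?thesis using uv by simp
qed

text \<open>
  The classical averaging for an abelian normal subgroup of coprime index, carried out modulo the
  kernel of \<open>\<pi>\<close>. Choose representatives \<open>t\<close> of the cosets of \<open>P\<close>. For \<open>g\<close> in \<open>G\<close>, the elements
  \<open>g t(g\<inverse>c)\<close> and \<open>t(c)\<close> lie in the same coset \<open>c\<close> and differ by \<open>e(g, c)\<close> in \<open>P\<close>. The product \<open>E(g)\<close> of
  all \<open>\<pi>(e(g, c))\<close> satisfies \<open>E(g h) = E(h)\<^sup>g E(g)\<close>, where \<open>g\<close> acts on \<open>Q\<close> by conjugation of
  preimages. Therefore \<open>L = {g. E(g) = 1}\<close> is a subgroup. On \<open>P\<close> the map \<open>E\<close> is \<open>\<pi>\<close> followed by the
  \<open>|G : P|\<close>-th power map, a bijection of \<open>Q\<close>: its injectivity describes \<open>P \<inter> L\<close>, and its surjectivity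
  shows that \<open>L\<close> meets every coset of \<open>P\<close>.
\<close>

lemma abelian_quotient_supplement:
  assumes fin: "finite (carrier G)" and P: "P \<lhd> G" and Q: "comm_group Q"
    and \<pi>: "\<pi> \<in> hom (G\<lparr>carrier := P\<rparr>) Q" and surj: "\<pi> ` P = carrier Q"
    and ker: "\<And>x g. x \<in> P \<Longrightarrow> g \<in> carrier G \<Longrightarrow> \<pi> x = \<one>\<^bsub>Q\<^esub> \<Longrightarrow> \<pi> (g \<otimes> x \<otimes> inv g) = \<one>\<^bsub>Q\<^esub>"
    and cop: "coprime (card (rcosets P)) (card (carrier Q))"
  shows "\<exists>L. subgroup L G \<and> P <#> L = carrier G \<and> (\<forall>x\<in>P \<inter> L. \<pi> x = \<one>\<^bsub>Q\<^esub>)"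
proof -
  interpret P: normal P G by (rule P)
  interpret Q: comm_group Q by (rule Q)
  have \<pi>c: "\<pi> x \<in> carrier Q" if "x \<in> P" for x using surj that by blast
  have \<pi>m: "\<pi> (x \<otimes> y) = \<pi> x \<otimes>\<^bsub>Q\<^esub> \<pi> y" if "x \<in> P" "y \<in> P" for x y
    using hom_mult[OF \<pi>, of x y] that by simp
  have \<pi>1: "\<pi> \<one> = \<one>\<^bsub>Q\<^esub>"
    using hom_one[OF \<pi> subgroup_imp_group[OF P.subgroup_axioms] Q.is_group] by simp
  note conj = P.inv_op_closed2
  have \<pi>inv: "\<pi> (inv x) = inv\<^bsub>Q\<^esub> \<pi> x" if x: "x \<in> P" for x
    using \<pi>m[of "inv x" x] x \<pi>c \<pi>1 by (simp add: Q.inv_equality)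
  have \<pi>conj: "\<pi> (x \<otimes> y \<otimes> inv x) = \<pi> y" if x: "x \<in> P" "y \<in> P" for x y
    using x \<pi>c by (simp add: \<pi>m \<pi>inv Q.m_comm[of "\<pi> x" "\<pi> y"] Q.m_assoc)
  define C where "C = rcosets P"
  have finC: "finite C" unfolding C_def
    using fin rcosets_subset_PowG[OF P.subgroup_axioms] by (meson finite_Pow_iff finite_subset)
  have "\<forall>c\<in>C. \<exists>x. x \<in> carrier G \<and> c = P #> x" unfolding C_def by (auto elim: rcosetsE)
  then obtain t where t: "\<And>c. c \<in> C \<Longrightarrow> t c \<in> carrier G" "\<And>c. c \<in> C \<Longrightarrow> P #> t c = c" by metis
  note eq_iff = rcos_eq_iff[OF P.subgroup_axioms]
  \<comment> \<open>the permutation of the cosets induced by left multiplication with \<open>g\<inverse>\<close>\<close>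
  define \<beta> where "\<beta> g c = P #> (inv g \<otimes> t c)" for g c
  have \<beta>C: "\<beta> g c \<in> C" if "g \<in> carrier G" "c \<in> C" for g c
    using that t(1) P.subset unfolding \<beta>_def C_def by (auto intro: rcosetsI)
  have \<beta>_rep: "\<beta> g (P #> y) = P #> (inv g \<otimes> y)" if g: "g \<in> carrier G" and y: "y \<in> carrier G" for g y
  proof -
    have c: "P #> y \<in> C" unfolding C_def using y P.subset by (auto intro: rcosetsI)
    have "t (P #> y) \<otimes> inv y \<in> P" using eq_iff[OF t(1)[OF c] y] t(2)[OF c] by simp
    from P.inv_op_closed1[OF g this] have "inv g \<otimes> (t (P #> y) \<otimes> inv y) \<otimes> g \<in> P" .
    then have "(inv g \<otimes> t (P #> y)) \<otimes> inv (inv g \<otimes> y) \<in> P"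
      using g y t(1)[OF c] by (simp add: inv_mult_group m_assoc)
    then show ?thesis unfolding \<beta>_def using eq_iff g y t(1)[OF c] by simp
  qed
  have \<beta>_mult: "\<beta> (g \<otimes> h) c = \<beta> h (\<beta> g c)" if "g \<in> carrier G" "h \<in> carrier G" "c \<in> C" for g h c
  proof -
    have "\<beta> h (\<beta> g c) = P #> (inv h \<otimes> (inv g \<otimes> t c))"
      using that t(1) \<beta>_rep[of h "inv g \<otimes> t c"] unfolding \<beta>_def[of g] by simp
    then show ?thesis using that t(1) by (simp add: \<beta>_def inv_mult_group m_assoc)
  qed
  have \<beta>_P: "\<beta> x c = c" if "x \<in> P" "c \<in> C" for x c
  proof -
    have x: "x \<in> carrier G" using that(1) P.subset by blast
    have "(inv x \<otimes> t c) \<otimes> inv (t c) \<in> P" using that x t(1) by (simp add: m_assoc)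
    then show ?thesis unfolding \<beta>_def using eq_iff[of "inv x \<otimes> t c" "t c"] x t that by simp
  qed
  have \<beta>_bij: "bij_betw (\<beta> g) C C" if g: "g \<in> carrier G" for g
    by (rule bij_betwI[of _ _ _ "\<beta> (inv g)"])
      (use g \<beta>C \<beta>_P[OF P.one_closed] in \<open>auto simp: \<beta>_mult[symmetric]\<close>)
  define e where "e g c = g \<otimes> t (\<beta> g c) \<otimes> inv (t c)" for g c
  have eP: "e g c \<in> P" if g: "g \<in> carrier G" and c: "c \<in> C" for g c
  proof -
    note tc = t(1)[OF c] and tb = t(1)[OF \<beta>C[OF g c]]
    have "P #> t (\<beta> g c) = P #> (inv g \<otimes> t c)" using t(2)[OF \<beta>C[OF g c]] by (simp add: \<beta>_def)
    then have "t (\<beta> g c) \<otimes> inv (inv g \<otimes> t c) \<in> P" using eq_iff g tc tb by simp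
    from conj[OF g this] have "g \<otimes> (t (\<beta> g c) \<otimes> inv (inv g \<otimes> t c)) \<otimes> inv g \<in> P" .
    then show ?thesis using g tc tb by (simp add: e_def inv_mult_group m_assoc)
  qed
  have e_mult: "e (g \<otimes> h) c = (g \<otimes> e h (\<beta> g c) \<otimes> inv g) \<otimes> e g c"
    if "g \<in> carrier G" "h \<in> carrier G" "c \<in> C" for g h c
  proof -
    have cancel: "inv g \<otimes> (g \<otimes> z) = z" "inv (t (\<beta> g c)) \<otimes> (t (\<beta> g c) \<otimes> z) = z" if "z \<in> carrier G" for z
      using that \<open>g \<in> carrier G\<close> t(1)[OF \<beta>C[OF \<open>g \<in> carrier G\<close> \<open>c \<in> C\<close>]] by (simp_all add: m_assoc[symmetric])
    show ?thesis
      using that t(1) \<beta>C by (simp add: e_def \<beta>_mult m_assoc cancel)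
  qed
  define E where "E g = finprod Q (\<lambda>c. \<pi> (e g c)) C" for g
  have Ec: "E g \<in> carrier Q" if "g \<in> carrier G" for g
    unfolding E_def using that eP \<pi>c by (intro Q.finprod_closed) auto
  have prod_conj: "\<exists>z\<in>P. finprod Q (\<lambda>c. \<pi> (f c)) S = \<pi> z \<and>
      finprod Q (\<lambda>c. \<pi> (g \<otimes> f c \<otimes> inv g)) S = \<pi> (g \<otimes> z \<otimes> inv g)"
    if "finite S" "\<And>c. c \<in> S \<Longrightarrow> f c \<in> P" and g: "g \<in> carrier G" for S :: "'a set set" and f g
    using that(1,2)
  proof (induction S rule: finite_induct)
    case empty
    then show ?case using g by (intro bexI[of _ \<one>]) (auto simp: \<pi>1)
  next
    case (insert c S)
    then obtain z where z: "z \<in> P" "finprod Q (\<lambda>c. \<pi> (f c)) S = \<pi> z"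
      "finprod Q (\<lambda>c. \<pi> (g \<otimes> f c \<otimes> inv g)) S = \<pi> (g \<otimes> z \<otimes> inv g)" by auto
    have fc: "f c \<in> P" using insert by simp
    have 1: "finprod Q (\<lambda>c. \<pi> (f c)) (insert c S) = \<pi> (f c \<otimes> z)"
      using insert z(1) fc \<pi>c by (subst Q.finprod_insert) (auto simp: z(2) \<pi>m)
    have "finprod Q (\<lambda>c. \<pi> (g \<otimes> f c \<otimes> inv g)) (insert c S) = \<pi> ((g \<otimes> f c \<otimes> inv g) \<otimes> (g \<otimes> z \<otimes> inv g))"
      using insert z(1) fc \<pi>c conj[OF g] by (subst Q.finprod_insert) (auto simp: z(3) \<pi>m)
    also have "(g \<otimes> f c \<otimes> inv g) \<otimes> (g \<otimes> z \<otimes> inv g) = g \<otimes> (f c \<otimes> z) \<otimes> inv g"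
    proof -
      have zc: "z \<in> carrier G" "f c \<in> carrier G" using z(1) fc P.subset by auto
      have "inv g \<otimes> (g \<otimes> (z \<otimes> inv g)) = z \<otimes> inv g" using g zc by (simp add: m_assoc[symmetric])
      then show ?thesis using g zc by (simp add: m_assoc)
    qed
    finally show ?case using 1 z(1) fc by (intro bexI[of _ "f c \<otimes> z"]) auto
  qed
  have E_mult: "E (g \<otimes> h) = finprod Q (\<lambda>c. \<pi> (g \<otimes> e h c \<otimes> inv g)) C \<otimes>\<^bsub>Q\<^esub> E g"
    if g: "g \<in> carrier G" and h: "h \<in> carrier G" for g h
  proof -
    have "E (g \<otimes> h) = finprod Q (\<lambda>c. \<pi> (g \<otimes> e h (\<beta> g c) \<otimes> inv g) \<otimes>\<^bsub>Q\<^esub> \<pi> (e g c)) C"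
      unfolding E_def
      by (rule Q.finprod_cong') (use g h eP \<beta>C conj \<pi>c in \<open>auto simp: e_mult \<pi>m\<close>)
    also have "\<dots> = finprod Q (\<lambda>c. \<pi> (g \<otimes> e h (\<beta> g c) \<otimes> inv g)) C \<otimes>\<^bsub>Q\<^esub> E g"
      unfolding E_def by (rule Q.finprod_multf) (use g h eP \<beta>C conj \<pi>c in auto)
    also have "finprod Q (\<lambda>c. \<pi> (g \<otimes> e h (\<beta> g c) \<otimes> inv g)) C = finprod Q (\<lambda>c. \<pi> (g \<otimes> e h c \<otimes> inv g)) (\<beta> g ` C)"
      by (rule Q.finprod_reindex[symmetric])
        (use g h eP \<beta>C conj \<pi>c \<beta>_bij[OF g] in \<open>auto simp: bij_betw_def\<close>)
    also have "\<beta> g ` C = C" using \<beta>_bij[OF g] by (simp add: bij_betw_def)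
    finally show ?thesis .
  qed
  have E_mult_ker: "E (g \<otimes> h) = E g" if g: "g \<in> carrier G" and h: "h \<in> carrier G" "E h = \<one>\<^bsub>Q\<^esub>" for g h
  proof -
    obtain z where z: "z \<in> P" "E h = \<pi> z"
        "finprod Q (\<lambda>c. \<pi> (g \<otimes> e h c \<otimes> inv g)) C = \<pi> (g \<otimes> z \<otimes> inv g)"
      using prod_conj[of C "e h" g, OF finC eP[OF h(1)] g] unfolding E_def by auto
    then have "\<pi> (g \<otimes> z \<otimes> inv g) = \<one>\<^bsub>Q\<^esub>" using ker[OF z(1) g] h(2) by simp
    then show ?thesis using E_mult[OF g h(1)] z(3) Ec[OF g] by simp
  qed
  have E_P: "E x = \<pi> x [^]\<^bsub>Q\<^esub> card C" if x: "x \<in> P" for x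
  proof -
    have "e x c = x" if "c \<in> C" for c
      using x that t(1) P.subset unfolding e_def \<beta>_P[OF x that] by (metis m_assoc inv_closed r_inv r_one subsetD)
    then have "E x = finprod Q (\<lambda>c. \<pi> x) C" unfolding E_def using x \<pi>c by (intro Q.finprod_cong') auto
    then show ?thesis using x \<pi>c by (simp add: Q.finprod_const)
  qed
  have E_P_mult: "E (x \<otimes> g) = E g \<otimes>\<^bsub>Q\<^esub> \<pi> x [^]\<^bsub>Q\<^esub> card C" if x: "x \<in> P" and g: "g \<in> carrier G" for x g
  proof -
    have xc: "x \<in> carrier G" using x P.subset by blast
    have "finprod Q (\<lambda>c. \<pi> (x \<otimes> e g c \<otimes> inv x)) C = E g"
      unfolding E_def by (rule Q.finprod_cong') (use x g eP \<pi>c in \<open>auto simp: \<pi>conj\<close>)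
    then show ?thesis using E_mult[OF xc g] E_P[OF x] by simp
  qed
  have ordQ: "q [^]\<^bsub>Q\<^esub> card (carrier Q) = \<one>\<^bsub>Q\<^esub>" if "q \<in> carrier Q" for q
    using Q.pow_order_eq_1[OF that] by (simp add: Coset.order_def)
  have C0: "card C \<noteq> 0" using finC one_closed P.subset by (auto simp: C_def RCOSETS_def)
  define L where "L = {g \<in> carrier G. E g = \<one>\<^bsub>Q\<^esub>}"
  show ?thesis
  proof (intro exI[of _ L] conjI ballI)
    show "subgroup L G"
    proof (rule subgroup_of_finiteI[OF fin])
      show "\<one> \<in> L" using E_P[OF P.one_closed] by (simp add: L_def \<pi>1)
    qed (auto simp: L_def E_mult_ker)
    show "P <#> L = carrier G"
    proof
      show "P <#> L \<subseteq> carrier G" using P.subset by (auto simp: set_mult_def L_def)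
      show "carrier G \<subseteq> P <#> L"
      proof
        fix g assume g: "g \<in> carrier G"
        \<comment> \<open>\<open>x\<close> is chosen with \<open>\<pi>(x)\<close> the root of \<open>E(g)\<inverse>\<close> of exponent \<open>|G : P|\<close>\<close>
        obtain u v where uv: "card C * u = card (carrier Q) * v + 1"
          using bezout_nat[OF C0, of "card (carrier Q)"] cop by (auto simp: coprime_iff_gcd_eq_1 C_def)
        define q where "q = inv\<^bsub>Q\<^esub> E g"
        have q: "q \<in> carrier Q" using Ec[OF g] by (simp add: q_def)
        obtain x where x: "x \<in> P" "\<pi> x = q [^]\<^bsub>Q\<^esub> u" using surj q by (metis Q.nat_pow_closed imageE)
        have "\<pi> x [^]\<^bsub>Q\<^esub> card C = q [^]\<^bsub>Q\<^esub> (card (carrier Q) * v + 1)"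
          using q uv by (simp add: x(2) Q.nat_pow_pow mult.commute)
        also have "\<dots> = q" using q ordQ by (simp add: Q.nat_pow_mult[symmetric] Q.nat_pow_pow[symmetric])
        finally have "E (x \<otimes> g) = \<one>\<^bsub>Q\<^esub>" using E_P_mult[OF x(1) g] Ec[OF g] by (simp add: q_def)
        moreover have xc: "x \<in> carrier G" using x(1) P.subset by blast
        ultimately have "x \<otimes> g \<in> L" using g by (simp add: L_def)
        moreover have "g = inv x \<otimes> (x \<otimes> g)" using xc g by (simp add: m_assoc[symmetric])
        ultimately show "g \<in> P <#> L" using x(1) by (auto simp: set_mult_def)
      qed
    qed
    fix x assume x: "x \<in> P \<inter> L"
    then have "\<pi> x [^]\<^bsub>Q\<^esub> card C = \<one>\<^bsub>Q\<^esub>" using E_P[of x] by (simp add: L_def)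
    then show "\<pi> x = \<one>\<^bsub>Q\<^esub>"
      using Q.coprime_pow_eq_one[OF \<pi>c _ ordQ[OF \<pi>c]] x cop by (simp add: C_def)
  qed
qed

text \<open>
  A complement of \<open>P / P'\<close> in \<open>G / P'\<close>, taken back to \<open>G\<close>. It is proper because \<open>P' \<noteq> P\<close>.
\<close>

lemma normal_sylow_supplement:
  assumes fin: "finite (carrier G)" and p: "prime p" and P: "P \<lhd> G" and cP: "card P = p ^ Suc k"
    and idx: "\<not> p dvd card (rcosets P)"
  shows "\<exists>L. subgroup L G \<and> L \<noteq> carrier G \<and> P <#> L = carrier G"
proof -
  interpret P: normal P G by (rule P)
  let ?P = "G\<lparr>carrier := P\<rparr>"
  interpret PG: group ?P by (rule subgroup_imp_group[OF P.subgroup_axioms])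
  define D where "D = derived G P"
  have DP: "D = derived ?P (carrier ?P)"
    unfolding D_def using derived_consistent[OF subset_refl P.subgroup_axioms] by simp
  have finP: "finite P" using fin P.subset by (rule finite_subset[rotated])
  have proper: "D \<noteq> P"
    using PG.derived_prime_power_group_proper[of p k] p cP finP unfolding DP by simp
  have Dsub: "D \<subseteq> P" unfolding D_def by (rule derived_incl[OF subset_refl P.subgroup_axioms])
  have nD: "D \<lhd> G" unfolding D_def by (rule derived_is_normal[OF P])
  interpret D: normal D G by (rule nD)
  have nDP: "D \<lhd> ?P" unfolding D_def by (rule derived_subgroup_is_normal[OF P.subgroup_axioms])
  interpret DP: normal D ?P by (rule nDP)
  let ?Q = "?P Mod D"
  define \<pi> where "\<pi> x = D #>\<^bsub>?P\<^esub> x" for x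
  have \<pi>eq: "\<pi> x = D #> x" for x by (simp add: \<pi>_def r_coset_def)
  have one: "\<one>\<^bsub>?Q\<^esub> = D" by (simp add: FactGroup_def)
  have \<pi>_one: "\<pi> x = D \<longleftrightarrow> x \<in> D" if "x \<in> carrier G" for x
    using that coset_join1[OF _ that D.subgroup_axioms] coset_join2[OF that D.subgroup_axioms]
    by (auto simp: \<pi>eq)
  have cQ: "card (carrier ?Q) * card D = p ^ Suc k"
    using PG.lagrange_card[OF DP.subgroup_axioms] cP by (simp add: FactGroup_def)
  have "coprime (card (rcosets P)) (p ^ Suc k)"
    using p idx by (simp add: coprime_commute prime_imp_coprime)
  then have cop: "coprime (card (rcosets P)) (card (carrier ?Q))"
    using cQ by (metis coprime_mult_right_iff)
  have "\<exists>L. subgroup L G \<and> P <#> L = carrier G \<and> (\<forall>x\<in>P \<inter> L. \<pi> x = \<one>\<^bsub>?Q\<^esub>)"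
  proof (rule abelian_quotient_supplement[OF fin P])
    show "comm_group ?Q" unfolding D_def by (rule derived_quot_of_subgroup_is_comm_group[OF P.subgroup_axioms])
    show "\<pi> \<in> hom ?P ?Q" unfolding \<pi>_def by (rule DP.r_coset_hom_Mod)
    show "\<pi> ` P = carrier ?Q" by (auto simp: \<pi>_def FactGroup_def RCOSETS_def)
    show "\<pi> (g \<otimes> x \<otimes> inv g) = \<one>\<^bsub>?Q\<^esub>" if "x \<in> P" "g \<in> carrier G" "\<pi> x = \<one>\<^bsub>?Q\<^esub>" for x g
      using that \<pi>_one[of x] \<pi>_one[of "g \<otimes> x \<otimes> inv g"] D.inv_op_closed2[of g x] P.subset
      by (auto simp: one subset_iff)
  qed (rule cop)
  then obtain L where L: "subgroup L G" "P <#> L = carrier G" "\<And>x. x \<in> P \<inter> L \<Longrightarrow> \<pi> x = D"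
    by (auto simp: one)
  have "L \<noteq> carrier G"
  proof
    assume "L = carrier G"
    then have "P \<subseteq> D" using L(3) \<pi>_one P.subset by blast
    then show False using proper Dsub by blast
  qed
  with L show ?thesis by blast
qed

text \<open>
  Let \<open>P\<close> be a Sylow \<open>p\<close>-subgroup of \<open>K\<close>. By the Frattini argument its normalizer supplements \<open>K\<close>. If
  this normalizer is the whole group, then \<open>P\<close> is a normal Sylow subgroup of \<open>G\<close>, and a proper
  supplement of \<open>P\<close> is one of \<open>K\<close>.
\<close>

lemma proper_supplement:
  assumes fin: "finite (carrier G)" and p: "prime p" and K: "K \<lhd> G"
    and pK: "p dvd card K" and idx: "\<not> p dvd card (rcosets K)"
  shows "\<exists>L. subgroup L G \<and> L \<noteq> carrier G \<and> K <#> L = carrier G"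
proof -
  interpret K: normal K G by (rule K)
  let ?K = "G\<lparr>carrier := K\<rparr>"
  interpret KG: group ?K by (rule subgroup_imp_group[OF K.subgroup_axioms])
  have finK: "finite K" using fin K.subset by (rule finite_subset[rotated])
  obtain P k where PK: "subgroup P ?K" and cP: "card P = p ^ k" and idxP: "\<not> p dvd card (rcosets\<^bsub>?K\<^esub> P)"
    using KG.sylow_subgroup_exists[OF _ p] finK by auto
  have PsK: "P \<subseteq> K" using subgroup.subset[OF PK] by simp
  have P: "subgroup P G" by (rule incl_subgroup[OF K.subgroup_axioms PK])
  note Pc = subgroup.mem_carrier[OF P]
  have cK: "card (rcosets\<^bsub>?K\<^esub> P) * card P = card K" using KG.lagrange_card[OF PK] by simp
  have "k \<noteq> 0"
  proof
    assume "k = 0"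
    then show False using cK cP pK idxP by simp
  qed
  then obtain k' where k': "k = Suc k'" by (cases k) auto
  define L where "L = {g \<in> carrier G. \<forall>x\<in>P. g \<otimes> x \<otimes> inv g \<in> P}"
  have L: "subgroup L G"
  proof (rule subgroup_of_finiteI[OF fin])
    show "\<one> \<in> L" using Pc by (simp add: L_def)
    fix g h assume gh: "g \<in> L" "h \<in> L"
    have "g \<otimes> h \<otimes> x \<otimes> inv (g \<otimes> h) = g \<otimes> (h \<otimes> x \<otimes> inv h) \<otimes> inv g" if "x \<in> P" for x
      using gh Pc[OF that] by (simp add: L_def inv_mult_group m_assoc)
    then show "g \<otimes> h \<in> L" using gh by (simp add: L_def)
  qed (auto simp: L_def)
  \<comment> \<open>some \<open>y\<close> in \<open>K\<close> conjugates \<open>R = g P g\<inverse>\<close> back into \<open>P\<close>, so that \<open>y g\<close> normalizes \<open>P\<close>\<close>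
  have KL: "K <#> L = carrier G"
  proof
    show "K <#> L \<subseteq> carrier G" using K.subset by (auto simp: set_mult_def L_def)
    show "carrier G \<subseteq> K <#> L"
    proof
      fix g assume g: "g \<in> carrier G"
      define R where "R = (\<lambda>x. g \<otimes> x \<otimes> inv g) ` P"
      have RK: "R \<subseteq> K" using K.inv_op_closed2[OF g] PsK by (auto simp: R_def)
      have RG: "subgroup R ?K"
      proof (rule KG.subgroup_of_finiteI)
        show "\<one>\<^bsub>?K\<^esub> \<in> R" using g subgroup.one_closed[OF P] by (force simp: R_def)
        fix x y assume "x \<in> R" "y \<in> R"
        then obtain a b where ab: "a \<in> P" "b \<in> P" "x = g \<otimes> a \<otimes> inv g" "y = g \<otimes> b \<otimes> inv g"
          by (auto simp: R_def)
        have "inv g \<otimes> (g \<otimes> (b \<otimes> inv g)) = b \<otimes> inv g" using g Pc[OF ab(2)] by (simp add: m_assoc[symmetric])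
        then have "x \<otimes> y = g \<otimes> (a \<otimes> b) \<otimes> inv g" using g Pc ab by (simp add: m_assoc)
        then show "x \<otimes>\<^bsub>?K\<^esub> y \<in> R" using ab subgroup.m_closed[OF P] by (auto simp: R_def)
      qed (use finK RK in auto)
      have "inj_on (\<lambda>x. g \<otimes> x \<otimes> inv g) P" using g Pc by (auto simp: inj_on_def)
      then have "card R = p ^ k" using cP by (simp add: R_def card_image)
      from KG.prime_power_subgroup_conjugate_into[OF _ p PK idxP RG this]
      obtain y where y: "y \<in> K" "\<And>r. r \<in> R \<Longrightarrow> y \<otimes>\<^bsub>?K\<^esub> r \<otimes>\<^bsub>?K\<^esub> inv\<^bsub>?K\<^esub> y \<in> P"
        using finK by auto
      have yc: "y \<in> carrier G" using y(1) K.subset by blast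
      have "y \<otimes> g \<in> L"
        unfolding L_def
      proof (intro CollectI conjI ballI)
        fix x assume x: "x \<in> P"
        have "y \<otimes> (g \<otimes> x \<otimes> inv g) \<otimes> inv y \<in> P"
          using y(2)[of "g \<otimes> x \<otimes> inv g"] x m_inv_consistent[OF K.subgroup_axioms y(1)] by (simp add: R_def)
        then show "y \<otimes> g \<otimes> x \<otimes> inv (y \<otimes> g) \<in> P" using yc g Pc[OF x] by (simp add: inv_mult_group m_assoc)
      qed (use yc g in auto)
      moreover have "g = inv y \<otimes> (y \<otimes> g)" using yc g by (simp add: m_assoc[symmetric])
      ultimately show "g \<in> K <#> L" using y(1) by (auto simp: set_mult_def)
    qed
  qed
  show ?thesis
  proof (cases "L = carrier G")
    case False
    then show ?thesis using L KL by blast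
  next
    case True
    then have nP: "P \<lhd> G" using P by (auto simp: normal_inv_iff L_def)
    have "card (rcosets P) * card P = card (rcosets K) * card (rcosets\<^bsub>?K\<^esub> P) * card P"
      using lagrange_card[OF P] lagrange_card[OF K.subgroup_axioms] cK by (simp add: mult.assoc)
    then have "card (rcosets P) = card (rcosets K) * card (rcosets\<^bsub>?K\<^esub> P)"
      using cP prime_gt_0_nat[OF p] by simp
    then have "\<not> p dvd card (rcosets P)" using idx idxP p by (simp add: prime_dvd_mult_iff)
    from normal_sylow_supplement[OF fin p nP cP[unfolded k'] this] obtain L'
      where L': "subgroup L' G" "L' \<noteq> carrier G" "P <#> L' = carrier G" by blast
    have "K <#> L' = carrier G"
      using L'(3) PsK K.subset subgroup.subset[OF L'(1)] by (fastforce simp: set_mult_def)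
    with L' show ?thesis by blast
  qed
qed

text \<open>
  A supplement \<open>H\<close> of least order meets \<open>N\<close> trivially: \<open>|H : N \<inter> H| = |G : N|\<close> is coprime to
  \<open>|N \<inter> H|\<close>, and a proper supplement of \<open>N \<inter> H\<close> in \<open>H\<close> would be a smaller supplement of \<open>N\<close>.
\<close>

theorem Schur_Zassenhaus:
  assumes fin: "finite (carrier G)" and N: "N \<lhd> G" and cop: "coprime (card N) (card (rcosets N))"
  shows "\<exists>H. subgroup H G \<and> N <#> H = carrier G \<and> N \<inter> H = {\<one>}"
proof -
  interpret N: normal N G by (rule N)
  define suppl where "suppl H \<longleftrightarrow> subgroup H G \<and> N <#> H = carrier G" for H
  have "carrier G \<subseteq> N <#> carrier G"
  proof
    fix g assume g: "g \<in> carrier G"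
    then have "g = \<one> \<otimes> g" by simp
    then show "g \<in> N <#> carrier G" using N.one_closed g unfolding set_mult_def by blast
  qed
  then have "suppl (carrier G)"
    unfolding suppl_def using subgroup_self N.subset by (auto simp: set_mult_def)
  then obtain H where H: "suppl H" and least: "\<And>H'. suppl H' \<Longrightarrow> card H \<le> card H'"
    using arg_min_nat_lemma[of suppl "carrier G" card] by metis
  have HG: "subgroup H G" and NH: "N <#> H = carrier G" using H by (auto simp: suppl_def)
  have NHE: "\<exists>n h. n \<in> N \<and> h \<in> H \<and> g = n \<otimes> h" if "g \<in> carrier G" for g
  proof -
    have "g \<in> N <#> H" using that NH by simp
    then show ?thesis by (auto simp: set_mult_def)
  qed
  have HsG: "H \<subseteq> carrier G" by (rule subgroup.subset[OF HG])
  have finH: "finite H" using fin HsG by (rule finite_subset[rotated])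
  let ?H = "G\<lparr>carrier := H\<rparr>"
  interpret HG: group ?H by (rule subgroup_imp_group[OF HG])
  define K where "K = N \<inter> H"
  have K: "K \<lhd> ?H"
    unfolding K_def using normal_Int_subgroup[OF HG N] by (simp add: Int_commute)
  have idx: "card (rcosets\<^bsub>?H\<^esub> K) = card (rcosets N)"
    using iso_same_card[OF weak_snd_iso_thme[OF HG N]] by (simp add: NH K_def FactGroup_def)
  have Ksub: "subgroup K G"
    unfolding K_def by (rule subgroups_Inter_pair[OF N.subgroup_axioms HG])
  have "K = {\<one>}"
  proof (rule ccontr)
    assume nt: "K \<noteq> {\<one>}"
    have finK: "finite K" using finH by (simp add: K_def)
    have "card K \<noteq> 1"
    proof
      assume "card K = 1"
      then obtain x where "K = {x}" by (auto simp: card_1_singleton_iff)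
      then show False using nt subgroup.one_closed[OF Ksub] by simp
    qed
    then obtain p where p: "prime p" "p dvd card K" using prime_factor_nat by blast
    have "subgroup K (G\<lparr>carrier := N\<rparr>)"
      using subgroup_incl[OF Ksub N.subgroup_axioms] by (simp add: K_def)
    from group.lagrange_card[OF subgroup_imp_group[OF N.subgroup_axioms] this]
    have "card N = card (rcosets\<^bsub>G\<lparr>carrier := N\<rparr>\<^esub> K) * card K" by simp
    then have "card K dvd card N" by simp
    then have "p dvd card N" using p(2) by (rule dvd_trans[rotated])
    then have "\<not> p dvd card (rcosets N)"
      using cop p(1) by (metis coprime_common_divisor_nat not_prime_1 prime_nat_iff)
    then have "\<not> p dvd card (rcosets\<^bsub>?H\<^esub> K)" using idx by simp
    from HG.proper_supplement[OF _ p(1) K p(2) this] obtain L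
      where L: "subgroup L ?H" "L \<noteq> H" "K <#>\<^bsub>?H\<^esub> L = H" using finH by auto
    have LG: "subgroup L G" by (rule incl_subgroup[OF HG L(1)])
    have LsH: "L \<subseteq> H" using subgroup.subset[OF L(1)] by simp
    have "N <#> L = carrier G"
    proof
      show "N <#> L \<subseteq> carrier G" using N.subset subgroup.subset[OF LG] by (auto simp: set_mult_def)
      show "carrier G \<subseteq> N <#> L"
      proof
        fix g assume "g \<in> carrier G"
        then obtain n h where nh: "n \<in> N" "h \<in> H" "g = n \<otimes> h" using NHE by blast
        then have "h \<in> K <#>\<^bsub>?H\<^esub> L" using L(3) by simp
        then obtain k l where kl: "k \<in> K" "l \<in> L" "h = k \<otimes> l" by (auto simp: set_mult_def)
        then have "g = (n \<otimes> k) \<otimes> l"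
          using nh N.subset HsG LsH by (auto simp: K_def m_assoc subset_iff)
        then show "g \<in> N <#> L" using nh kl by (auto simp: set_mult_def K_def)
      qed
    qed
    then have "card H \<le> card L" using least LG by (simp add: suppl_def)
    then show False using L(2) LsH finH card_seteq by blast
  qed
  then show ?thesis using HG NH by (auto simp: K_def)
qed

end

section \<open>Conjugate characters and inertia\<close>

locale finite_normal_subgroup = finite_group G + N: normal N G for G (structure) and N
begin

abbreviation GN :: "('a, 'b) monoid_scheme" where
  "GN \<equiv> G\<lparr>carrier := N\<rparr>"

sublocale GN: finite_group GN
  by (intro finite_group.intro finite_group_axioms.intro subgroup_imp_group[OF N.subgroup_axioms])
    (use fin N.subset in \<open>auto intro: finite_subset\<close>)

lemma card_N_pos: "card N > 0"
proof -
  have "N \<noteq> {}" using N.one_closed by blast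
  then show ?thesis using GN.fin by (simp add: card_gt_0_iff)
qed

text \<open>
  Vanishing outside \<open>N\<close> is built in, so that equality of conjugates is equality of functions.
  Conjugation composes in reverse order; as a left action it is used with inverses.
\<close>

definition conj_char :: "'a \<Rightarrow> ('a \<Rightarrow> complex) \<Rightarrow> 'a \<Rightarrow> complex" where
  "conj_char x \<chi> = (\<lambda>g. if g \<in> N then \<chi> (x \<otimes> g \<otimes> inv x) else 0)"

lemma N_carrier: "g \<in> N \<Longrightarrow> g \<in> carrier G"
  by (rule N.mem_carrier)

lemma conj_N: "x \<in> carrier G \<Longrightarrow> g \<in> N \<Longrightarrow> x \<otimes> g \<otimes> inv x \<in> N"
  by (rule N.inv_op_closed2)

lemma GN_inv: "g \<in> N \<Longrightarrow> inv\<^bsub>GN\<^esub> g = inv g"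
  by (rule m_inv_consistent[OF N.subgroup_axioms])

lemma conj_mult:
  "x \<in> carrier G \<Longrightarrow> g \<in> carrier G \<Longrightarrow> h \<in> carrier G \<Longrightarrow>
    (x \<otimes> g \<otimes> inv x) \<otimes> (x \<otimes> h \<otimes> inv x) = x \<otimes> (g \<otimes> h) \<otimes> inv x"
proof -
  assume "x \<in> carrier G" "g \<in> carrier G" "h \<in> carrier G"
  moreover from this have "inv x \<otimes> (x \<otimes> (h \<otimes> inv x)) = h \<otimes> inv x" by (simp add: m_assoc[symmetric])
  ultimately show ?thesis by (simp add: m_assoc)
qed

lemma conj_char_Irr:
  assumes x: "x \<in> carrier G" and \<chi>: "\<chi> \<in> Irr GN"
  shows "conj_char x \<chi> \<in> Irr GN"
proof -
  obtain n \<rho> where irr: "irreducible_rep GN n \<rho>" and \<chi>eq: "\<chi> = character_of GN n \<rho>"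
    using \<chi> unfolding Irr_def by blast
  note \<rho> = GN.irreducible_repD[OF irr]
  let ?\<rho> = "\<lambda>g. \<rho> (x \<otimes> g \<otimes> inv x)"
  have "irreducible_rep GN n ?\<rho>"
    unfolding irreducible_rep_def
  proof (intro conjI allI impI)
    show "?\<rho> \<in> hom GN (GL n)"
    proof (rule GN.rep_homI)
      show "?\<rho> g \<in> carrier_mat n n" if "g \<in> carrier GN" for g
        using that x conj_N GN.rep_carrier[OF \<rho>(1)] by simp
      show "?\<rho> \<one>\<^bsub>GN\<^esub> = 1\<^sub>m n" using GN.rep_one[OF \<rho>(1)] x by simp
      show "?\<rho> (g \<otimes>\<^bsub>GN\<^esub> h) = ?\<rho> g * ?\<rho> h" if "g \<in> carrier GN" "h \<in> carrier GN" for g h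
        using that x conj_N GN.rep_mult[OF \<rho>(1), of "x \<otimes> g \<otimes> inv x" "x \<otimes> h \<otimes> inv x"]
        by (simp add: conj_mult N_carrier)
    qed
    fix W assume W: "VectorSpace.subspace class_ring W (module_vec TYPE(complex) n)"
      and inv: "\<forall>g\<in>carrier GN. \<forall>w\<in>W. ?\<rho> g *\<^sub>v w \<in> W"
    show "W = {0\<^sub>v n} \<or> W = carrier_vec n"
    proof (rule \<rho>(3)[OF W])
      fix g w assume g: "g \<in> carrier GN" and w: "w \<in> W"
      have "inv x \<otimes> g \<otimes> inv (inv x) \<in> carrier GN" using g x conj_N[of "inv x" g] by simp
      moreover have "x \<otimes> (inv x \<otimes> g \<otimes> inv (inv x)) \<otimes> inv x = g"
      proof -
        have "x \<otimes> (inv x \<otimes> g) = g" using x g N_carrier by (simp add: m_assoc[symmetric])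
        then show ?thesis using x g N_carrier by (simp add: m_assoc)
      qed
      ultimately show "\<rho> g *\<^sub>v w \<in> W" using inv w by metis
    qed
  qed (rule \<rho>(2))
  moreover have "conj_char x \<chi> = character_of GN n ?\<rho>"
    using x conj_N by (intro ext) (simp add: conj_char_def \<chi>eq character_of_def)
  ultimately show ?thesis unfolding Irr_def by blast
qed

lemma conj_char_mult:
  assumes x: "x \<in> carrier G" and y: "y \<in> carrier G"
  shows "conj_char (x \<otimes> y) \<chi> = conj_char y (conj_char x \<chi>)"
proof
  fix g
  show "conj_char (x \<otimes> y) \<chi> g = conj_char y (conj_char x \<chi>) g"
    using x y conj_N[OF y, of g] N_carrier by (simp add: conj_char_def inv_mult_group m_assoc)
qed

lemma conj_char_N:
  assumes n: "n \<in> N" and \<chi>: "\<chi> \<in> Irr GN"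
  shows "conj_char n \<chi> = \<chi>"
proof
  fix g
  show "conj_char n \<chi> g = \<chi> g"
  proof (cases "g \<in> N")
    case True
    have "\<chi> (n \<otimes> g \<otimes> inv n) = \<chi> (inv n \<otimes> (n \<otimes> g))"
      using GN.Irr_mult_commute[OF \<chi>, of "n \<otimes> g" "inv n"] n True by simp
    then show ?thesis using True n N_carrier by (simp add: conj_char_def m_assoc[symmetric])
  next
    case False
    then show ?thesis using GN.Irr_outside[OF \<chi>] by (simp add: conj_char_def)
  qed
qed

lemma conj_char_one: "\<chi> \<in> Irr GN \<Longrightarrow> conj_char \<one> \<chi> = \<chi>"
  by (rule conj_char_N) (rule N.one_closed)

lemma induced_char_eq:
  assumes \<chi>: "\<chi> \<in> Irr GN" and g: "g \<in> carrier G"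
  shows "induced_char G N \<chi> g = (\<Sum>x\<in>carrier G. conj_char x \<chi> g) / of_nat (card N)"
proof -
  have "(let y = x \<otimes> g \<otimes> inv x in if y \<in> N then \<chi> y else 0) = conj_char x \<chi> g" if x: "x \<in> carrier G" for x
  proof -
    have "g \<in> N" if "x \<otimes> g \<otimes> inv x \<in> N"
    proof -
      have "inv x \<otimes> (x \<otimes> g \<otimes> inv x) \<otimes> x \<in> N" by (rule N.inv_op_closed1[OF x that])
      moreover have "inv x \<otimes> (x \<otimes> g \<otimes> inv x) \<otimes> x = g"
      proof -
        have "inv x \<otimes> (x \<otimes> g) = g" using x g by (simp add: m_assoc[symmetric])
        moreover have "inv x \<otimes> (x \<otimes> g \<otimes> inv x) \<otimes> x = inv x \<otimes> (x \<otimes> g)" using x g by (simp add: m_assoc)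
        ultimately show ?thesis by simp
      qed
      ultimately show ?thesis by simp
    qed
    then show ?thesis using conj_N[OF x] by (auto simp: conj_char_def Let_def)
  qed
  then show ?thesis using g by (simp add: induced_char_def)
qed

text \<open>
  \<open>\<chi>\<^sup>G\<close> is a multiple of the sum of all conjugates of \<open>\<chi>\<close>, and distinct conjugates are orthogonal.
\<close>

lemma induced_char_norm:
  assumes \<chi>: "\<chi> \<in> Irr GN"
  shows "(\<Sum>g\<in>carrier G. induced_char G N \<chi> g * cnj (induced_char G N \<chi> g)) =
    of_nat (\<Sum>y\<in>carrier G. card {z \<in> carrier G. conj_char z \<chi> = conj_char y \<chi>}) / of_nat (card N)"
proof -
  let ?n = "of_nat (card N) :: complex"
  have n: "?n \<noteq> 0" using card_N_pos by simp
  have "(\<Sum>g\<in>carrier G. induced_char G N \<chi> g * cnj (induced_char G N \<chi> g)) =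
      (\<Sum>g\<in>carrier G. \<Sum>y\<in>carrier G. \<Sum>z\<in>carrier G. conj_char y \<chi> g * cnj (conj_char z \<chi> g)) / (?n * ?n)"
    by (simp add: induced_char_eq[OF \<chi>] sum_product sum_divide_distrib cong: sum.cong)
  also have "(\<Sum>g\<in>carrier G. \<Sum>y\<in>carrier G. \<Sum>z\<in>carrier G. conj_char y \<chi> g * cnj (conj_char z \<chi> g))
      = (\<Sum>y\<in>carrier G. \<Sum>g\<in>carrier G. \<Sum>z\<in>carrier G. conj_char y \<chi> g * cnj (conj_char z \<chi> g))"
    by (rule sum.swap)
  also have "\<dots> = (\<Sum>y\<in>carrier G. \<Sum>z\<in>carrier G. \<Sum>g\<in>carrier G. conj_char y \<chi> g * cnj (conj_char z \<chi> g))"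
    by (intro sum.cong refl sum.swap)
  also have "\<dots> = (\<Sum>y\<in>carrier G. \<Sum>z\<in>carrier G. if conj_char z \<chi> = conj_char y \<chi> then ?n else 0)"
  proof (intro sum.cong refl)
    fix y z assume yz: "y \<in> carrier G" "z \<in> carrier G"
    have "(\<Sum>g\<in>carrier G. conj_char y \<chi> g * cnj (conj_char z \<chi> g))
        = (\<Sum>g\<in>N. conj_char y \<chi> g * cnj (conj_char z \<chi> g))"
      by (rule sum.mono_neutral_right) (use fin N.subset in \<open>auto simp: conj_char_def\<close>)
    also have "\<dots> = (if conj_char z \<chi> = conj_char y \<chi> then ?n else 0)"
      using GN.Irr_orthogonal[OF conj_char_Irr[OF yz(1) \<chi>] conj_char_Irr[OF yz(2) \<chi>]] by auto
    finally show "(\<Sum>g\<in>carrier G. conj_char y \<chi> g * cnj (conj_char z \<chi> g))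
        = (if conj_char z \<chi> = conj_char y \<chi> then ?n else 0)" .
  qed
  also have "\<dots> = (\<Sum>y\<in>carrier G. of_nat (card {z \<in> carrier G. conj_char z \<chi> = conj_char y \<chi>}) * ?n)"
    using fin by (intro sum.cong refl) (simp add: sum.If_cases Int_def)
  also have "\<dots> / (?n * ?n) = of_nat (\<Sum>y\<in>carrier G. card {z \<in> carrier G. conj_char z \<chi> = conj_char y \<chi>}) / ?n"
    using n by (simp add: sum_distrib_right[symmetric])
  finally show ?thesis .
qed

text \<open>
  If \<open>x\<close> outside \<open>N\<close> fixed \<open>\<chi>\<close>, each conjugate of \<open>\<chi>\<close> would be obtained from at least the two cosets
  \<open>N y\<close> and \<open>N x y\<close>, and the squared norm of \<open>\<chi>\<^sup>G\<close> would be at least \<open>2\<close>.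
\<close>

lemma inertia_of_irreducible_induced:
  assumes \<chi>: "\<chi> \<in> Irr GN" and ind: "induced_char G N \<chi> \<in> Irr G"
    and x: "x \<in> carrier G" and fix_x: "conj_char x \<chi> = \<chi>"
  shows "x \<in> N"
proof (rule ccontr)
  assume xN: "x \<notin> N"
  let ?T = "\<lambda>y. {z \<in> carrier G. conj_char z \<chi> = conj_char y \<chi>}"
  note n0 = card_N_pos
  have cT: "2 * card N \<le> card (?T y)" if y: "y \<in> carrier G" for y
  proof -
    have xy: "x \<otimes> y \<in> carrier G" using x y by simp
    have sub: "N #> z \<subseteq> ?T y" if z: "z \<in> carrier G" "conj_char z \<chi> = conj_char y \<chi>" for z
    proof
      fix w assume "w \<in> N #> z"
      then obtain n where n: "n \<in> N" "w = n \<otimes> z" by (auto simp: r_coset_def)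
      then show "w \<in> ?T y" using z N_carrier by (simp add: conj_char_mult conj_char_N[OF _ \<chi>])
    qed
    have fixed: "conj_char (x \<otimes> y) \<chi> = conj_char y \<chi>" using x y by (simp add: conj_char_mult fix_x)
    have "N #> y \<noteq> N #> (x \<otimes> y)"
    proof
      assume "N #> y = N #> (x \<otimes> y)"
      then have "x \<otimes> y \<otimes> inv y \<in> N" using rcos_eq_iff[OF N.subgroup_axioms xy y] by simp
      then show False using x y xN by (simp add: m_assoc)
    qed
    then have disj: "(N #> y) \<inter> (N #> (x \<otimes> y)) = {}"
      using rcos_disjoint[OF N.subgroup_axioms] y xy N.subset
      by (auto simp: pairwise_def disjnt_def intro!: rcosetsI)
    have card: "card (N #> z) = card N" if "z \<in> carrier G" for z
      using card_rcosets_equal[OF rcosetsI[OF N.subset that] N.subset] by simp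
    have fincos: "finite (N #> z)" if "z \<in> carrier G" for z
      using fin r_coset_subset_G[OF N.subset that] by (rule finite_subset[rotated])
    have "2 * card N = card ((N #> y) \<union> (N #> (x \<otimes> y)))"
      using card_Un_disjoint[OF fincos[OF y] fincos[OF xy] disj] card y xy by simp
    also have "\<dots> \<le> card (?T y)"
      by (rule card_mono) (use fin sub[OF y refl] sub[OF xy fixed] in auto)
    finally show ?thesis .
  qed
  have "of_nat (card (carrier G)) = (of_nat (\<Sum>y\<in>carrier G. card (?T y)) / of_nat (card N) :: complex)"
    using induced_char_norm[OF \<chi>] Irr_orthogonal[OF ind ind] by simp
  then have "of_nat (card (carrier G) * card N) = (of_nat (\<Sum>y\<in>carrier G. card (?T y)) :: complex)"
    using n0 by (simp add: field_simps)
  then have eq: "card (carrier G) * card N = (\<Sum>y\<in>carrier G. card (?T y))" by (simp only: of_nat_eq_iff)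
  have "card (carrier G) * (2 * card N) = (\<Sum>y\<in>carrier G. 2 * card N)" by simp
  also have "\<dots> \<le> (\<Sum>y\<in>carrier G. card (?T y))" by (rule sum_mono) (rule cT)
  finally have "card (carrier G) * (2 * card N) \<le> card (carrier G) * card N" using eq by simp
  moreover have "card (carrier G) > 0" using fin one_closed by (auto simp: card_gt_0_iff)
  ultimately show False using n0 by simp
qed

section \<open>The index is prime to the order of the normal subgroup\<close>

lemma card_conj_class_conj:
  assumes x: "x \<in> carrier G" and g: "g \<in> N"
  shows "card (conj_class GN (x \<otimes> g \<otimes> inv x)) = card (conj_class GN g)"
proof -
  have le: "card (conj_class GN g) \<le> card (conj_class GN (x \<otimes> g \<otimes> inv x))"
    if x: "x \<in> carrier G" and g: "g \<in> N" for x g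
  proof (rule card_inj_on_le[of "\<lambda>h. x \<otimes> h \<otimes> inv x"])
    have gc: "g \<in> carrier G" using g N_carrier by simp
    show "inj_on (\<lambda>h. x \<otimes> h \<otimes> inv x) (conj_class GN g)"
      using x GN.conj_class_subset[of g] g N.subset by (auto simp: inj_on_def subset_iff)
    show "finite (conj_class GN (x \<otimes> g \<otimes> inv x))"
      using finite_subset[OF GN.conj_class_subset GN.fin, of "x \<otimes> g \<otimes> inv x"] conj_N[OF x g] by simp
    show "(\<lambda>h. x \<otimes> h \<otimes> inv x) ` conj_class GN g \<subseteq> conj_class GN (x \<otimes> g \<otimes> inv x)"
    proof
      fix h assume "h \<in> (\<lambda>h. x \<otimes> h \<otimes> inv x) ` conj_class GN g"
      then obtain m where m: "m \<in> N" "h = x \<otimes> (m \<otimes> g \<otimes> inv m) \<otimes> inv x"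
        by (auto simp: conj_class_def GN_inv)
      define n where "n = x \<otimes> m \<otimes> inv x"
      have n: "n \<in> N" unfolding n_def by (rule conj_N[OF x m(1)])
      have nc: "n \<in> carrier G" "m \<in> carrier G" using n m N_carrier by auto
      have nx: "n \<otimes> x = x \<otimes> m" using x nc(2) by (simp add: n_def m_assoc)
      have "n \<otimes> (x \<otimes> g \<otimes> inv x) \<otimes> inv n = (n \<otimes> x) \<otimes> g \<otimes> inv (n \<otimes> x)"
        using x nc gc by (simp add: inv_mult_group m_assoc)
      also have "\<dots> = h" unfolding nx using x nc gc m(2) by (simp add: inv_mult_group m_assoc)
      finally show "h \<in> conj_class GN (x \<otimes> g \<otimes> inv x)"
        using n by (auto simp: conj_class_def GN_inv intro!: exI[of _ n])
    qed
  qed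
  have gc: "g \<in> carrier G" using g N_carrier by simp
  have "inv x \<otimes> (x \<otimes> g) = g" using x gc by (simp add: m_assoc[symmetric])
  then have "inv x \<otimes> (x \<otimes> g \<otimes> inv x) \<otimes> inv (inv x) = g" using x gc by (simp add: m_assoc)
  then show ?thesis using le[OF x g] le[OF inv_closed[OF x] conj_N[OF x g]] by simp
qed

text \<open>
  Conjugation by \<open>x\<close> maps classes of \<open>N\<close> to classes of the same size, hence permutes the central
  characters; that of the trivial character is unchanged.
\<close>

lemma conj_char_principal_block:
  assumes x: "x \<in> carrier G" and \<chi>: "\<chi> \<in> principal_block GN M"
  shows "conj_char x \<chi> \<in> principal_block GN M"
proof -
  have \<chi>I: "\<chi> \<in> Irr GN" and b: "\<And>g. g \<in> N \<Longrightarrow> central_char GN (trivial_char GN) g - central_char GN \<chi> g \<in> M"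
    using \<chi> by (auto simp: principal_block_def block_rel_def)
  have "central_char GN (trivial_char GN) g - central_char GN (conj_char x \<chi>) g \<in> M" if g: "g \<in> N" for g
  proof -
    have "central_char GN (conj_char x \<chi>) g = central_char GN \<chi> (x \<otimes> g \<otimes> inv x)"
      using g x by (simp add: central_char_def conj_char_def card_conj_class_conj N.one_closed)
    moreover have "central_char GN (trivial_char GN) g = central_char GN (trivial_char GN) (x \<otimes> g \<otimes> inv x)"
      using g x conj_N[OF x g] by (simp add: central_char_def trivial_char_def card_conj_class_conj)
    ultimately show ?thesis using b[OF conj_N[OF x g]] by simp
  qed
  then show ?thesis
    using conj_char_Irr[OF x \<chi>I] GN.trivial_char_Irr by (simp add: principal_block_def block_rel_def)
qed

text \<open>
  The Sylow subgroup \<open>P\<close> of \<open>G\<close> acts on the nontrivial characters of the block, separately on each set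
  \<open>X d\<close> of those of degree \<open>d\<close>, so that the cardinalities of the \<open>X d\<close> control the sum of squared
  degrees.
\<close>

lemma not_dvd_index:
  assumes p: "prime p" "p dvd card N" and M: "maximal_ideal_over p M"
    and ind: "\<And>\<chi>. \<chi> \<in> principal_block GN M \<Longrightarrow> \<chi> \<noteq> trivial_char GN \<Longrightarrow> induced_char G N \<chi> \<in> Irr G"
  shows "\<not> p dvd card (rcosets N)"
proof
  assume idx: "p dvd card (rcosets N)"
  interpret GNM: finite_group_mod GN p M
    by (intro finite_group_mod.intro GN.finite_group_axioms maximal_ideal_over_prime.intro p(1) M)
  let ?B = "principal_block GN M" and ?t = "trivial_char GN"
  have finB: "finite ?B" using GNM.principal_block_subset GN.finite_Irr by (rule finite_subset)
  obtain P k where P: "subgroup P G" "card P = p ^ k" "\<not> p dvd card (rcosets P)"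
    using sylow_subgroup_exists[OF fin p(1)] .
  interpret PG: group "G\<lparr>carrier := P\<rparr>" by (rule subgroup_imp_group[OF P(1)])
  note Pc = subgroup.mem_carrier[OF P(1)]
  \<comment> \<open>a Sylow subgroup of \<open>G\<close> inside \<open>N\<close> would have index divisible by the index of \<open>N\<close>\<close>
  have "\<not> P \<subseteq> N"
  proof
    assume "P \<subseteq> N"
    then have "subgroup P GN" using subgroup_incl[OF P(1) N.subgroup_axioms] by simp
    from GN.lagrange_card[OF this] have "card N = card (rcosets\<^bsub>GN\<^esub> P) * card P" by simp
    then have "card (rcosets P) * card P = card (rcosets N) * card (rcosets\<^bsub>GN\<^esub> P) * card P"
      using lagrange_card[OF P(1)] lagrange_card[OF N.subgroup_axioms] by (simp add: mult.assoc)
    then have "card (rcosets P) = card (rcosets N) * card (rcosets\<^bsub>GN\<^esub> P)"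
      using P(2) prime_gt_0_nat[OF p(1)] by simp
    then show False using idx P(3) by simp
  qed
  then obtain x where x: "x \<in> P" "x \<notin> N" by blast
  define X where "X d = {\<chi> \<in> ?B - {?t}. char_degree GN \<chi> = d}" for d
  have conj_t: "conj_char y ?t = ?t" if y: "y \<in> carrier G" for y
    by (rule ext) (use conj_N[OF y] in \<open>simp add: conj_char_def trivial_char_def\<close>)
  have cancel: "conj_char (inv y) (conj_char y \<chi>) = \<chi>" if "y \<in> carrier G" "\<chi> \<in> Irr GN" for y \<chi>
    using conj_char_mult[of y "inv y" \<chi>] that by (simp add: conj_char_one)
  have dvdX: "p dvd card (X d)" for d
  proof (rule ccontr)
    assume "\<not> p dvd card (X d)"
    moreover have "conj_char y \<chi> \<in> X d" if y: "y \<in> carrier G" and \<chi>: "\<chi> \<in> X d" for y \<chi>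
    proof -
      have \<chi>B: "\<chi> \<in> ?B" "\<chi> \<noteq> ?t" "char_degree GN \<chi> = d" using \<chi> by (auto simp: X_def)
      have "conj_char y \<chi> \<noteq> ?t"
        using cancel[OF y, of \<chi>] conj_t[of "inv y"] y \<chi>B GNM.principal_block_subset by auto
      moreover have "char_degree GN (conj_char y \<chi>) = d"
        using \<chi>B(3) y by (simp add: char_degree_def conj_char_def N.one_closed)
      ultimately show ?thesis using conj_char_principal_block[OF y \<chi>B(1)] by (simp add: X_def)
    qed
    moreover have "finite (X d)" using finB by (simp add: X_def)
    moreover have "conj_char (inv (g \<otimes> h)) \<chi> = conj_char (inv g) (conj_char (inv h) \<chi>)"
      if "g \<in> P" "h \<in> P" for g h \<chi>
      using that Pc by (simp add: inv_mult_group conj_char_mult)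
    moreover have "X d \<subseteq> Irr GN" using GNM.principal_block_subset by (auto simp: X_def)
    ultimately have "\<exists>\<chi>\<in>X d. \<forall>g\<in>carrier (G\<lparr>carrier := P\<rparr>). conj_char (inv g) \<chi> = \<chi>"
      using P(2) Pc
      by (intro PG.prime_power_group_fixed_point[OF p(1), of k]) (auto simp: conj_char_one)
    then obtain \<chi> where \<chi>: "\<chi> \<in> X d" "\<And>g. g \<in> P \<Longrightarrow> conj_char (inv g) \<chi> = \<chi>" by auto
    have \<chi>B: "\<chi> \<in> ?B" "\<chi> \<noteq> ?t" using \<chi>(1) by (auto simp: X_def)
    have "conj_char x \<chi> = \<chi>"
      using \<chi>(2)[of "inv x"] subgroup.m_inv_closed[OF P(1) x(1)] Pc[OF x(1)] by simp
    then have "x \<in> N"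
      using inertia_of_irreducible_induced[OF _ ind[OF \<chi>B] Pc[OF x(1)]] \<chi>B(1) GNM.principal_block_subset by blast
    then show False using x(2) by simp
  qed
  let ?deg = "char_degree GN"
  have "(\<Sum>\<chi>\<in>?B - {?t}. (?deg \<chi>)\<^sup>2) = (\<Sum>d\<in>?deg ` (?B - {?t}). \<Sum>\<chi>\<in>X d. (?deg \<chi>)\<^sup>2)"
    unfolding X_def by (rule sum.image_gen) (use finB in simp)
  also have "\<dots> = (\<Sum>d\<in>?deg ` (?B - {?t}). card (X d) * d\<^sup>2)"
    by (intro sum.cong refl) (simp add: X_def)
  also have "p dvd \<dots>" by (intro dvd_sum dvd_mult2 dvdX)
  finally have "p dvd (\<Sum>\<chi>\<in>?B - {?t}. (?deg \<chi>)\<^sup>2)" .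
  moreover have "p dvd (\<Sum>\<chi>\<in>?B. (?deg \<chi>)\<^sup>2)"
    using GNM.principal_block_degree_squares p(2) by simp
  moreover have "(\<Sum>\<chi>\<in>?B. (?deg \<chi>)\<^sup>2) = (?deg ?t)\<^sup>2 + (\<Sum>\<chi>\<in>?B - {?t}. (?deg \<chi>)\<^sup>2)"
    by (rule sum.remove[OF finB GNM.trivial_in_principal_block])
  ultimately have "p dvd (?deg ?t)\<^sup>2" by (simp add: dvd_add_left_iff)
  moreover have "?deg ?t = 1"
  proof -
    have "of_nat (?deg ?t) = (1 :: complex)"
      using GNM.char_degree[OF GN.trivial_char_Irr] by (simp add: trivial_char_def N.one_closed)
    then show ?thesis by (simp only: of_nat_eq_1_iff)
  qed
  ultimately show False using p(1) by auto
qed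

end

theorem theorem5p5:
  fixes G :: "('a, 'b) monoid_scheme" and N :: "'a set" and M :: "nat \<Rightarrow> complex set"
  assumes "group G" and "finite (carrier G)" and "N \<lhd> G"
    and "\<And>p. prime p \<Longrightarrow> maximal_ideal_over p (M p)"
    and "\<And>p. prime p \<Longrightarrow> p dvd card N \<Longrightarrow>
           frobenius_corresponding_blocks G N (M p)
             (principal_block (G\<lparr>carrier := N\<rparr>) (M p)) (principal_block G (M p))"
  shows "\<exists>H. subgroup H G \<and> N <#>\<^bsub>G\<^esub> H = carrier G \<and> N \<inter> H = {\<one>\<^bsub>G\<^esub>}"
proof -
  interpret finite_normal_subgroup G N
    using assms(1-3) by (simp add: finite_normal_subgroup_def finite_group_def finite_group_axioms_def)
  have "coprime (card N) (card (rcosets\<^bsub>G\<^esub> N))"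
  proof (rule ccontr)
    assume "\<not> coprime (card N) (card (rcosets\<^bsub>G\<^esub> N))"
    then obtain p where "prime p" "p dvd gcd (card N) (card (rcosets\<^bsub>G\<^esub> N))"
      using prime_factor_nat unfolding coprime_iff_gcd_eq_1 by blast
    then have p: "prime p" "p dvd card N" "p dvd card (rcosets\<^bsub>G\<^esub> N)" by simp_all
    have "induced_char G N \<chi> \<in> Irr G"
      if "\<chi> \<in> principal_block (G\<lparr>carrier := N\<rparr>) (M p)" "\<chi> \<noteq> trivial_char (G\<lparr>carrier := N\<rparr>)" for \<chi>
      using assms(5)[OF p(1,2)] that by (simp add: frobenius_corresponding_blocks_def)
    from not_dvd_index[OF p(1,2) assms(4)[OF p(1)] this] p(3) show False by simp
  qed
  then show ?thesis by (rule Schur_Zassenhaus[OF assms(2,3)])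
qed

end
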